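(* Let $d,n\in\mathbb{Z}_{>0}$ and $m\in\mathbb{Z}_{>0}\cup\{\infty\}$, and let $z$ and $x_{a,b}$, with $a\in E_m$ and $b\in\{0,\ldots,d-1\}$, be parameters in $\mathcal{R}_m$ such that $x_{0,0}=1$. Let $\{\mathrm{tr}_k\}_{k\in\mathbb{Z}_{>0}}$ be the unique chain of relative traces with parameters $z$ and $x_{a,b}$, and let $\tau:\mathrm{Y}(d,m,n)\to\mathcal{R}_m$ be the linear map $\tau:=\mathrm{tr}_1\circ\mathrm{tr}_2\circ\cdots\circ\mathrm{tr}_{n-1}\circ\mathrm{tr}_n$. The map $\tau$ is the unique Markov trace with parameters $z$ and $x_{a,b}$ on the algebra $\mathrm{Y}(d,m,n)$.
   Context: Algebra. Let $q,v_1,v_2,\ldots$ be indeterminates; $\mathcal{R}_m:=\mathbb{C}[q^{\pm1},v_1^{\pm1},\ldots,v_m^{\pm1}]$ for $m<\infty$ and $\mathcal{R}_\infty:=\mathbb{C}[q^{\pm1}]$. Set $E_m:=\{0,\ldots,m-1\}$ for $m<\infty$ and $E_\infty:=\mathbb{Z}$. For $n\ge1$, $\mathrm{Y}(d,m,n)$ is the associative $\mathcal{R}_m$-algebra generated by $t_1,\ldots,t_n,g_1,\ldots,g_{n-1},X_1^{\pm1}$ with relations: $g_ig_j=g_jg_i$ if $|i-j|>1$; $g_ig_{i+1}g_i=g_{i+1}g_ig_{i+1}$; $t_it_j=t_jt_i$; $t_jg_i=g_it_{s_i(j)}$ with $s_i=(i,i+1)$; $t_j^d=1$; $g_i^2=1+(q-q^{-1})e_ig_i$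 with $e_i:=\frac1d\sum_{s=0}^{d-1}t_i^st_{i+1}^{-s}$; $X_1g_1X_1g_1=g_1X_1g_1X_1$; $X_1g_i=g_iX_1$ for $i\ge2$; $X_1t_j=t_jX_1$ for all $j$; and, if $m<\infty$, $(X_1-v_1)\cdots(X_1-v_m)=0$. Each $g_i$ is invertible with $g_i^{-1}=g_i-(q-q^{-1})e_i$. Put $\mathrm{Y}(d,m,0):=\mathcal{R}_m$. For $k\le n$, $\mathrm{Y}(d,m,k)$ is identified with the subalgebra of $\mathrm{Y}(d,m,n)$ generated by $t_1,\ldots,t_k,g_1,\ldots,g_{k-1},X_1^{\pm1}$. Define $\widetilde X_1:=X_1$ and $\widetilde X_{i+1}:=g_i^{-1}\widetilde X_ig_i$. Chain of relative traces with parameters $z$, $x_{a,b}$: a set of $\mathcal{R}_m$-linear maps $\mathrm{tr}_k:\mathrm{Y}(d,m,k)\to\mathrm{Y}(d,m,k-1)$, $k\ge1$, satisfying $\mathrm{tr}_1(X_1^at_1^b)=x_{a,b}$ for $a\in E_m$, $b\in\{0,\ldots,d-1\}$, and, for all $k\ge2$, $u,v\in\mathrm{Y}(d,m,k-1)$, $Z\in\mathrm{Y}(d,m,k)$: $\mathrm{tr}_k(uZv)=u\,\mathrm{tr}_k(Z)\,v$; $\mathrm{tr}_k(g_{k-1}^{\varepsilon}ug_{k-1}^{-\varepsilon})=\mathrm{tr}_{k-1}(u)$ for $\varepsilon=\pm1$; $\mathrm{tr}_{k-1}(\mathrm{tr}_k(g_{k-1}Z))=\mathrm{tr}_{k-1}(\mathrm{tr}_k(Zg_{k-1}))$;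 $\mathrm{tr}_k(g_{k-1})=z$. It exists and is unique for every choice of parameters. Markov trace with parameters $z$, $x_{a,b}$ ($x_{0,0}=1$) on $\mathrm{Y}(d,m,n)$: an $\mathcal{R}_m$-linear map $\mathrm{tr}:\mathrm{Y}(d,m,n)\to\mathcal{R}_m$ such that $\mathrm{tr}(YZ)=\mathrm{tr}(ZY)$ for all $Y,Z\in\mathrm{Y}(d,m,n)$; $\mathrm{tr}(g_{k-1}u)=z\,\mathrm{tr}(u)$ for $k\in\{2,\ldots,n\}$, $u\in\mathrm{Y}(d,m,k-1)$; and $\mathrm{tr}(\widetilde X_k^at_k^bu)=x_{a,b}\,\mathrm{tr}(u)$ for $k\in\{1,\ldots,n\}$, $u\in\mathrm{Y}(d,m,k-1)$, $a\in E_m$, $b\in\{0,\ldots,d-1\}$. (The definition of Markov trace does not by itself impose $\mathrm{tr}(1)=1$; this follows from the last condition... with $k=1$, $a=b=0$ it reads $\mathrm{tr}(u)=x_{0,0}\mathrm{tr}(u)$, and the normalisation is understood as $\mathrm{tr}(1)=x_{0,0}=1$.) *)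

theory Defs
  imports
    "HOL-Library.Poly_Mapping"
    "HOL-Library.Extended_Nat"
    "HOL-Combinatorics.Transposition"
    "HOL-Algebra.QuotRing"
    "HOL-Algebra.Module"
    "HOL.Complex"
begin

text \<open>
  Laurent polynomials over the complex numbers in countably many variables, as the group algebra of
  the free abelian group of exponent vectors. Variable \<open>0\<close> is \<open>q\<close> and variable \<open>i \<ge> 1\<close> is \<open>v\<^sub>i\<close>;
  the ground ring for a given \<open>m\<close> is the subring in which only the allowed variables occur.
\<close>

type_synonym laurent = "(nat \<Rightarrow>\<^sub>0 int) \<Rightarrow>\<^sub>0 complex"

definition lvar :: "nat \<Rightarrow> int \<Rightarrow> laurent" where
  "lvar i k = Poly_Mapping.single (Poly_Mapping.single i k) 1"

definition ground_vars :: "enat \<Rightarrow> nat set" where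
  "ground_vars m = (case m of enat l \<Rightarrow> {0..l} | \<infinity> \<Rightarrow> {0})"

text \<open>The ground ring is also a module over itself, so that it can be the target of linear maps.\<close>

definition ground_ring :: "enat \<Rightarrow> (laurent, laurent) module" where
  "ground_ring m =
    \<lparr>carrier = {p. \<forall>\<mu>\<in>Poly_Mapping.keys p. Poly_Mapping.keys \<mu> \<subseteq> ground_vars m},
     mult = (*), one = 1, zero = 0, add = (+), smult = (*)\<rparr>"

definition exponents :: "enat \<Rightarrow> int set" where
  "exponents m = (case m of enat l \<Rightarrow> {0..<int l} | \<infinity> \<Rightarrow> UNIV)"


text \<open>
  \<open>XLinv\<close> is a formal inverse of \<open>XL\<close>. Words form the free monoid, written additively because
  \<open>Poly_Mapping\<close> turns a \<open>monoid_add\<close> into its monoid algebra.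
\<close>

datatype letter = TL nat | GL nat | XL | XLinv

datatype 'a word = Word (letters: "'a list")

instantiation word :: (type) monoid_add
begin

definition zero_word :: "'a word" where
  "zero_word = Word []"

definition plus_word :: "'a word \<Rightarrow> 'a word \<Rightarrow> 'a word" where
  "plus_word u v = Word (letters u @ letters v)"

instance
  by standard (simp_all add: zero_word_def plus_word_def)

end

type_synonym fpoly = "letter word \<Rightarrow>\<^sub>0 laurent"

definition scal :: "laurent \<Rightarrow> fpoly" where
  "scal r = Poly_Mapping.single 0 r"

definition gen :: "letter \<Rightarrow> fpoly" where
  "gen a = Poly_Mapping.single (Word [a]) 1"

text \<open>There are no generators for \<open>n = 0\<close>, so the algebra is then the ground ring.\<close>

definition generators :: "nat \<Rightarrow> letter set" where
  "generators n = (if n = 0 then {} else TL ` {1..n} \<union> GL ` {1..<n} \<union> {XL, XLinv})"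

definition free_alg :: "enat \<Rightarrow> nat \<Rightarrow> fpoly ring" where
  "free_alg m n =
    \<lparr>carrier = {f. \<forall>w\<in>Poly_Mapping.keys f. set (letters w) \<subseteq> generators n \<and>
                               Poly_Mapping.lookup f w \<in> carrier (ground_ring m)},
     mult = (*), one = 1, zero = 0, add = (+)\<rparr>"


abbreviation tF :: "nat \<Rightarrow> fpoly" where "tF j \<equiv> gen (TL j)"
abbreviation gF :: "nat \<Rightarrow> fpoly" where "gF i \<equiv> gen (GL i)"
abbreviation XF :: fpoly where "XF \<equiv> gen XL"
abbreviation XinvF :: fpoly where "XinvF \<equiv> gen XLinv"

text \<open>
  The negative power of \<open>t\<^bsub>i+1\<^esub>\<close> with exponent \<open>-s\<close> is written with exponent \<open>d - s\<close>; the two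
  agree in the quotient because of the relation \<open>t\<^bsub>i+1\<^esub> ^ d = 1\<close>.
\<close>

definition eF :: "nat \<Rightarrow> nat \<Rightarrow> fpoly" where
  "eF d i = scal (Poly_Mapping.single 0 (1 / of_nat d)) * (\<Sum>s<d. tF i ^ s * tF (i + 1) ^ (d - s))"

definition qdiff :: laurent where
  "qdiff = lvar 0 1 - lvar 0 (-1)"

inductive Y_relation :: "nat \<Rightarrow> enat \<Rightarrow> nat \<Rightarrow> fpoly \<Rightarrow> fpoly \<Rightarrow> bool" for d m n where
  gg_commute: "\<lbrakk>i \<in> {1..<n}; j \<in> {1..<n}; \<bar>int i - int j\<bar> > 1\<rbrakk>
    \<Longrightarrow> Y_relation d m n (gF i * gF j) (gF j * gF i)"
| braid: "\<lbrakk>i \<in> {1..<n}; i + 1 \<in> {1..<n}\<rbrakk>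
    \<Longrightarrow> Y_relation d m n (gF i * gF (i + 1) * gF i) (gF (i + 1) * gF i * gF (i + 1))"
| tt_commute: "\<lbrakk>i \<in> {1..n}; j \<in> {1..n}\<rbrakk>
    \<Longrightarrow> Y_relation d m n (tF i * tF j) (tF j * tF i)"
| tg: "\<lbrakk>i \<in> {1..<n}; j \<in> {1..n}\<rbrakk>
    \<Longrightarrow> Y_relation d m n (tF j * gF i) (gF i * tF (transpose i (i + 1) j))"
| t_order: "j \<in> {1..n} \<Longrightarrow> Y_relation d m n (tF j ^ d) 1"
| g_square: "i \<in> {1..<n}
    \<Longrightarrow> Y_relation d m n (gF i ^ 2) (1 + scal qdiff * eF d i * gF i)"
| X_inv_right: "n \<ge> 1 \<Longrightarrow> Y_relation d m n (XF * XinvF) 1"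
| X_inv_left: "n \<ge> 1 \<Longrightarrow> Y_relation d m n (XinvF * XF) 1"
| Xg1: "n \<ge> 2 \<Longrightarrow> Y_relation d m n (XF * gF 1 * XF * gF 1) (gF 1 * XF * gF 1 * XF)"
| Xg_commute: "i \<in> {2..<n} \<Longrightarrow> Y_relation d m n (XF * gF i) (gF i * XF)"
| Xt_commute: "j \<in> {1..n} \<Longrightarrow> Y_relation d m n (XF * tF j) (tF j * XF)"
| cyclotomic: "\<lbrakk>n \<ge> 1; m = enat l\<rbrakk>
    \<Longrightarrow> Y_relation d m n (prod_list (map (\<lambda>i. XF - scal (lvar i 1)) [1..<l + 1])) 0"

definition rel_ideal :: "nat \<Rightarrow> enat \<Rightarrow> nat \<Rightarrow> fpoly set" where
  "rel_ideal d m n = Idl\<^bsub>free_alg m n\<^esub> {f - g |f g. Y_relation d m n f g}"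

definition to_Y :: "nat \<Rightarrow> enat \<Rightarrow> nat \<Rightarrow> fpoly \<Rightarrow> fpoly set" where
  "to_Y d m n f = rel_ideal d m n +>\<^bsub>free_alg m n\<^esub> f"

text \<open>
  The algebra is noncommutative, so the locale \<open>algebra\<close> does not apply; only its record type
  \<open>module\<close> is used, to carry the ring operations together with the scalar action.
\<close>

definition Yalg :: "nat \<Rightarrow> enat \<Rightarrow> nat \<Rightarrow> (laurent, fpoly set) module" where
  "Yalg d m n = (let Q = free_alg m n Quot rel_ideal d m n in
    \<lparr>carrier = carrier Q, mult = mult Q, one = one Q, zero = zero Q, add = add Q,
     smult = (\<lambda>r C. to_Y d m n (scal r) \<otimes>\<^bsub>Q\<^esub> C)\<rparr>)"

text \<open>
  The canonical homomorphism to \<open>Yalg d m n\<close> from \<open>Yalg d m k\<close>, for \<open>k \<le> n\<close>, through which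
  the latter is viewed as a subalgebra: a coset \<open>C = I\<^sub>k + f\<close> goes to \<open>I\<^sub>n + C = I\<^sub>n + f\<close>.
\<close>

definition Yemb :: "nat \<Rightarrow> enat \<Rightarrow> nat \<Rightarrow> fpoly set \<Rightarrow> fpoly set" where
  "Yemb d m n C = rel_ideal d m n <+>\<^bsub>free_alg m n\<^esub> C"

definition tY :: "nat \<Rightarrow> enat \<Rightarrow> nat \<Rightarrow> nat \<Rightarrow> fpoly set" where
  "tY d m n j = to_Y d m n (tF j)"

definition gY :: "nat \<Rightarrow> enat \<Rightarrow> nat \<Rightarrow> nat \<Rightarrow> fpoly set" where
  "gY d m n i = to_Y d m n (gF i)"

definition XY :: "nat \<Rightarrow> enat \<Rightarrow> nat \<Rightarrow> fpoly set" where
  "XY d m n = to_Y d m n XF"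

text \<open>\<open>Xtilde d m n k\<close> is only meaningful for \<open>1 \<le> k \<le> n\<close>.\<close>

fun Xtilde :: "nat \<Rightarrow> enat \<Rightarrow> nat \<Rightarrow> nat \<Rightarrow> fpoly set" where
  "Xtilde d m n 0 = undefined"
| "Xtilde d m n (Suc 0) = XY d m n"
| "Xtilde d m n (Suc (Suc i)) =
    inv\<^bsub>Yalg d m n\<^esub> (gY d m n (Suc i)) \<otimes>\<^bsub>Yalg d m n\<^esub> Xtilde d m n (Suc i) \<otimes>\<^bsub>Yalg d m n\<^esub> gY d m n (Suc i)"


definition linear_map ::
  "('r, 'x) ring_scheme \<Rightarrow> ('r, 'a) module \<Rightarrow> ('r, 'b) module \<Rightarrow> ('a \<Rightarrow> 'b) \<Rightarrow> bool" where
  "linear_map R M N f \<longleftrightarrow>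
    f \<in> carrier M \<rightarrow> carrier N \<and>
    (\<forall>a\<in>carrier M. \<forall>b\<in>carrier M. f (a \<oplus>\<^bsub>M\<^esub> b) = f a \<oplus>\<^bsub>N\<^esub> f b) \<and>
    (\<forall>r\<in>carrier R. \<forall>a\<in>carrier M. f (r \<odot>\<^bsub>M\<^esub> a) = r \<odot>\<^bsub>N\<^esub> f a)"

text \<open>Elements of \<open>Yalg d m (k - 1)\<close> that occur as elements of \<open>Yalg d m k\<close> are passed through \<open>Yemb\<close>.\<close>

definition relative_trace_chain ::
  "nat \<Rightarrow> enat \<Rightarrow> laurent \<Rightarrow> (int \<Rightarrow> nat \<Rightarrow> laurent) \<Rightarrow> (nat \<Rightarrow> fpoly set \<Rightarrow> fpoly set) \<Rightarrow> bool" where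
  "relative_trace_chain d m z x tr \<longleftrightarrow>
    (\<forall>k\<ge>1. linear_map (ground_ring m) (Yalg d m k) (Yalg d m (k - 1)) (tr k)) \<and>
    (\<forall>a\<in>exponents m. \<forall>b<d.
       tr 1 (XY d m 1 [^]\<^bsub>Yalg d m 1\<^esub> a \<otimes>\<^bsub>Yalg d m 1\<^esub> tY d m 1 1 [^]\<^bsub>Yalg d m 1\<^esub> b)
         = x a b \<odot>\<^bsub>Yalg d m 0\<^esub> \<one>\<^bsub>Yalg d m 0\<^esub>) \<and>
    (\<forall>k\<ge>2.
      (\<forall>u\<in>carrier (Yalg d m (k - 1)). \<forall>v\<in>carrier (Yalg d m (k - 1)). \<forall>Z\<in>carrier (Yalg d m k).
         tr k (Yemb d m k u \<otimes>\<^bsub>Yalg d m k\<^esub> Z \<otimes>\<^bsub>Yalg d m k\<^esub> Yemb d m k v)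
           = u \<otimes>\<^bsub>Yalg d m (k - 1)\<^esub> tr k Z \<otimes>\<^bsub>Yalg d m (k - 1)\<^esub> v) \<and>
      (\<forall>\<epsilon>\<in>{1, -1 :: int}. \<forall>u\<in>carrier (Yalg d m (k - 1)).
         tr k (gY d m k (k - 1) [^]\<^bsub>Yalg d m k\<^esub> \<epsilon> \<otimes>\<^bsub>Yalg d m k\<^esub> Yemb d m k u
                 \<otimes>\<^bsub>Yalg d m k\<^esub> gY d m k (k - 1) [^]\<^bsub>Yalg d m k\<^esub> (- \<epsilon>))
           = Yemb d m (k - 1) (tr (k - 1) u)) \<and>
      (\<forall>Z\<in>carrier (Yalg d m k).
         tr (k - 1) (tr k (gY d m k (k - 1) \<otimes>\<^bsub>Yalg d m k\<^esub> Z))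
           = tr (k - 1) (tr k (Z \<otimes>\<^bsub>Yalg d m k\<^esub> gY d m k (k - 1)))) \<and>
      tr k (gY d m k (k - 1)) = z \<odot>\<^bsub>Yalg d m (k - 1)\<^esub> \<one>\<^bsub>Yalg d m (k - 1)\<^esub>)"

text \<open>
  The instance \<open>k = 1\<close>, \<open>a = b = 0\<close> of the last condition only says \<open>T \<one> = x 0 0 * T \<one>\<close>, which also
  holds for the zero map; the normalisation \<open>T \<one> = 1\<close> is therefore stated explicitly.
\<close>

definition markov_trace ::
  "nat \<Rightarrow> enat \<Rightarrow> nat \<Rightarrow> laurent \<Rightarrow> (int \<Rightarrow> nat \<Rightarrow> laurent) \<Rightarrow> (fpoly set \<Rightarrow> laurent) \<Rightarrow> bool" where
  "markov_trace d m n z x T \<longleftrightarrow>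
    linear_map (ground_ring m) (Yalg d m n) (ground_ring m) T \<and>
    T \<one>\<^bsub>Yalg d m n\<^esub> = 1 \<and>
    (\<forall>Y\<in>carrier (Yalg d m n). \<forall>Z\<in>carrier (Yalg d m n).
       T (Y \<otimes>\<^bsub>Yalg d m n\<^esub> Z) = T (Z \<otimes>\<^bsub>Yalg d m n\<^esub> Y)) \<and>
    (\<forall>k\<in>{2..n}. \<forall>u\<in>carrier (Yalg d m (k - 1)).
       T (gY d m n (k - 1) \<otimes>\<^bsub>Yalg d m n\<^esub> Yemb d m n u) = z * T (Yemb d m n u)) \<and>
    (\<forall>k\<in>{1..n}. \<forall>u\<in>carrier (Yalg d m (k - 1)). \<forall>a\<in>exponents m. \<forall>b<d.
       T (Xtilde d m n k [^]\<^bsub>Yalg d m n\<^esub> a \<otimes>\<^bsub>Yalg d m n\<^esub> tY d m n k [^]\<^bsub>Yalg d m n\<^esub> b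
            \<otimes>\<^bsub>Yalg d m n\<^esub> Yemb d m n u)
         = x a b * T (Yemb d m n u))"

text \<open>The identification of \<open>Yalg d m 0\<close> with the ground ring, inverse to \<open>r \<mapsto> r \<odot> \<one>\<close>.\<close>

definition to_ground :: "nat \<Rightarrow> enat \<Rightarrow> fpoly set \<Rightarrow> laurent" where
  "to_ground d m =
    the_inv_into (carrier (ground_ring m)) (\<lambda>r. r \<odot>\<^bsub>Yalg d m 0\<^esub> \<one>\<^bsub>Yalg d m 0\<^esub>)"

primrec iterated_trace :: "(nat \<Rightarrow> fpoly set \<Rightarrow> fpoly set) \<Rightarrow> nat \<Rightarrow> fpoly set \<Rightarrow> fpoly set" where
  "iterated_trace tr 0 = id"
| "iterated_trace tr (Suc k) = iterated_trace tr k \<circ> tr (Suc k)"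

end

theory Submission
  imports Defs "HOL-Algebra.Generated_Rings"
begin

text \<open>
  Uniqueness: let \<open>A k\<close> be generated by the scalars, \<open>t\<^sub>1, \<dots>, t\<^sub>k\<close>, \<open>g\<^sub>1, \<dots>, g\<^bsub>k-1\<^esub>\<close> and
  \<open>X\<close>, \<open>X\<^sup>-\<^sup>1\<close>. Conjugating \<open>A 1\<close> by \<open>g\<^sub>1 \<dots> g\<^sub>k\<close> gives a
  commutative algebra \<open>Q (k + 1)\<close> spanned by the products of powers of the modified generator and of
  \<open>t\<^bsub>k+1\<^esub>\<close>, and \<open>A (k + 1)\<close> is spanned by \<open>A k \<cdot> g\<^sub>k \<cdot> A k\<close> and \<open>Q (k + 1) \<cdot> A k\<close>, because this span is
  stable under left multiplication by all generators. On both parts a Markov trace is determined by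
  its restriction to \<open>A k\<close>. Existence: \<open>tr\<^bsub>k+1\<^esub>\<close> is a bimodule map fixing \<open>A k\<close>, so the composite of the
  chain is tracial as soon as it is tracial against \<open>g\<^sub>k\<close>; the values on powers of the modified
  generator follow by conjugating down to the first one.
\<close>

section \<open>Additive spans and units in noncommutative rings\<close>

text \<open>Right stability is built into the span; the difficulty is on the left, at two places.
  First, \<open>g k\<close> times \<open>u \<otimes> g k \<otimes> v\<close> contains
  \<open>g k\<close> twice. Writing \<open>g k\<close> as \<open>inv (g k)\<close> plus an element
  generated by scalars, \<open>t k\<close> and \<open>t (k + 1)\<close> replaces this by a conjugate
  of \<open>A k\<close>, and such conjugates are controlled by the spanning statement one rank
  lower: hence the recurring hypothesis \<open>k = 1 \<or> A k \<subseteq> M (k - 1)\<close>.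
  Second, for \<open>k = 1\<close> the element \<open>X\<close> need not commute with
  \<open>g 1\<close>. It is recovered as \<open>inv (g 1) \<otimes> J \<otimes> inv (g 1)\<close>,
  where \<open>J = g 1 \<otimes> (X \<otimes> g 1)\<close> commutes with \<open>A 1\<close>. Powers
  of \<open>X\<close> outside the allowed exponents are reduced by the cyclotomic relation, which is
  monic with invertible constant term because the variables \<open>lvar i 1\<close> are units. For
  existence, a chain imposes cyclicity only from rank two on, so rank one rests on commutativity of
  the algebra there. Passing from rank \<open>k \<ge> 1\<close> to \<open>k + 1\<close> adds only
  the generators \<open>g k\<close> and \<open>t (k + 1)\<close>, and the latter is
  \<open>t k\<close> conjugated by \<open>g k\<close>.\<close>

inductive_set addspan :: "('a, 'b) ring_scheme \<Rightarrow> 'a set \<Rightarrow> 'a set" for R and S where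
  zero: "\<zero>\<^bsub>R\<^esub> \<in> addspan R S"
| incl: "s \<in> S \<Longrightarrow> s \<in> addspan R S"
| add: "\<lbrakk>a \<in> addspan R S; b \<in> addspan R S\<rbrakk> \<Longrightarrow> a \<oplus>\<^bsub>R\<^esub> b \<in> addspan R S"

context ring
begin

lemma addspan_in_carrier:
  assumes "S \<subseteq> carrier R"
  shows "addspan R S \<subseteq> carrier R"
proof
  fix y assume "y \<in> addspan R S"
  then show "y \<in> carrier R"
    by induction (use assms in auto)
qed

text \<open>Two-sided because conjugation by \<open>g k\<close> is one of its uses; the one-sided
  versions take \<open>\<one>\<close> as the other factor.\<close>

lemma addspan_sandwich:
  assumes "y \<in> addspan R S" "S \<subseteq> carrier R" "a \<in> carrier R" "b \<in> carrier R"
    and "\<And>s. s \<in> S \<Longrightarrow> a \<otimes> s \<otimes> b \<in> addspan R S'"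
  shows "a \<otimes> y \<otimes> b \<in> addspan R S'"
  using assms(1)
proof induction
  case (add c d)
  then have "c \<in> carrier R" "d \<in> carrier R"
    using addspan_in_carrier[OF assms(2)] by auto
  then show ?case
    using add assms(3,4) by (simp add: l_distr r_distr addspan.add)
qed (use assms in \<open>auto intro: addspan.intros\<close>)

lemma addspan_lmult:
  assumes "y \<in> addspan R S" "S \<subseteq> carrier R" "a \<in> carrier R" "\<And>s. s \<in> S \<Longrightarrow> a \<otimes> s \<in> addspan R S'"
  shows "a \<otimes> y \<in> addspan R S'"
  using addspan_sandwich[OF assms(1-3) one_closed, of S'] assms addspan_in_carrier[OF assms(2)]
  by (auto simp: subset_iff)

lemma addspan_rmult:
  assumes "y \<in> addspan R S" "S \<subseteq> carrier R" "a \<in> carrier R" "\<And>s. s \<in> S \<Longrightarrow> s \<otimes> a \<in> addspan R S'"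
  shows "y \<otimes> a \<in> addspan R S'"
  using addspan_sandwich[OF assms(1,2) one_closed assms(3), of S'] assms addspan_in_carrier[OF assms(2)]
  by (auto simp: subset_iff)

text \<open>The elements whose left multiplication preserves the span form a subring, so the
  generators \<open>H\<close> suffice. With \<open>w = \<one>\<close> this turns stability into a
  spanning statement. Closure under negation is a hypothesis because \<open>addspan\<close> only
  forms sums.\<close>

lemma generate_ring_lmult_stable:
  assumes "y \<in> generate_ring R H" "H \<subseteq> carrier R"
    and "addspan R S \<subseteq> carrier R"
    and "\<And>w. w \<in> addspan R S \<Longrightarrow> \<ominus> w \<in> addspan R S"
    and "\<And>h w. \<lbrakk>h \<in> H; w \<in> addspan R S\<rbrakk> \<Longrightarrow> h \<otimes> w \<in> addspan R S"
    and "w \<in> addspan R S"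
  shows "y \<otimes> w \<in> addspan R S"
proof -
  note carr = generate_ring_in_carrier[OF assms(2)] subsetD[OF assms(3)]
  show ?thesis
    using assms(1,6)
  proof (induction arbitrary: w)
    case one
    then show ?case using carr by simp
  next
    case (incl h)
    then show ?case using assms(5) by simp
  next
    case (a_inv h)
    then show ?case using carr assms(4) by (simp add: l_minus)
  next
    case (eng_add h1 h2)
    then show ?case using carr by (simp add: l_distr addspan.add)
  next
    case (eng_mult h1 h2)
    then show ?case using carr by (simp add: m_assoc)
  qed
qed

text \<open>The centralizer of \<open>a\<close> is a subring.\<close>

lemma generate_ring_commute:
  assumes "y \<in> generate_ring R H" "H \<subseteq> carrier R" "a \<in> carrier R"
    and "\<And>h. h \<in> H \<Longrightarrow> a \<otimes> h = h \<otimes> a"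
  shows "a \<otimes> y = y \<otimes> a"
  using assms(1)
proof induction
  case one
  then show ?case using assms(3) by simp
next
  case (incl h)
  then show ?case using assms(4) by simp
next
  case (a_inv h)
  then show ?case
    using generate_ring_in_carrier[OF assms(2)] assms(3) by (simp add: l_minus r_minus)
next
  case (eng_add h1 h2)
  then show ?case
    using generate_ring_in_carrier[OF assms(2)] assms(3) by (simp add: l_distr r_distr)
next
  case (eng_mult h1 h2)
  then have c: "h1 \<in> carrier R" "h2 \<in> carrier R"
    using generate_ring_in_carrier[OF assms(2)] by auto
  have "a \<otimes> (h1 \<otimes> h2) = h1 \<otimes> a \<otimes> h2"
    using c assms(3) eng_mult.IH(1) by (simp flip: m_assoc)
  also have "\<dots> = h1 \<otimes> h2 \<otimes> a"
    using c assms(3) eng_mult.IH(2) by (simp add: m_assoc)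
  finally show ?case .
qed

lemma Units_cancel_left:
  assumes "g \<in> Units R" "y \<in> carrier R"
  shows "g \<otimes> (inv g \<otimes> y) = y" and "inv g \<otimes> (g \<otimes> y) = y"
  using assms Units_closed[OF assms(1)] by (simp_all flip: m_assoc)

text \<open>Products are normalised to the right, so a relation between two adjacent factors must
  carry the tail \<open>y\<close> to act as a rewrite rule.\<close>

lemma rewrite_left:
  assumes "a \<otimes> b = c \<otimes> e" "a \<in> carrier R" "b \<in> carrier R" "c \<in> carrier R" "e \<in> carrier R" "y \<in> carrier R"
  shows "a \<otimes> (b \<otimes> y) = c \<otimes> (e \<otimes> y)"
  using assms by (metis m_assoc)

lemma inv_commute:
  assumes "g \<in> Units R" "y \<in> carrier R" "g \<otimes> y = y \<otimes> g"
  shows "inv g \<otimes> y = y \<otimes> inv g"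
proof -
  note [simp] = Units_closed[OF assms(1)]
  have "inv g \<otimes> y = inv g \<otimes> ((y \<otimes> g) \<otimes> inv g)"
    using assms by (simp add: m_assoc)
  also have "\<dots> = y \<otimes> inv g"
    using assms by (simp add: m_assoc Units_cancel_left flip: assms(3))
  finally show ?thesis .
qed

end

section \<open>Conjugation and integer powers of units\<close>

context monoid
begin

lemma Units_conj:
  assumes "g \<in> Units G" "y \<in> Units G"
  shows "inv g \<otimes> y \<otimes> g \<in> Units G" and "inv (inv g \<otimes> y \<otimes> g) = inv g \<otimes> inv y \<otimes> g"
proof -
  note c = assms[THEN Units_closed] assms[THEN Units_inv_closed]
  have cancel: "a \<otimes> (inv a \<otimes> w) = w" "inv a \<otimes> (a \<otimes> w) = w" if "a \<in> Units G" "w \<in> carrier G" for a w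
    using that Units_closed[OF that(1)] by (simp_all flip: m_assoc)
  show "inv g \<otimes> y \<otimes> g \<in> Units G"
    using assms by simp
  show "inv (inv g \<otimes> y \<otimes> g) = inv g \<otimes> inv y \<otimes> g"
    using assms c by (intro inv_char) (simp_all add: m_assoc cancel)
qed

lemma nat_pow_conj:
  assumes "g \<in> Units G" "y \<in> carrier G"
  shows "(inv g \<otimes> y \<otimes> g) [^] (k::nat) = inv g \<otimes> y [^] k \<otimes> g"
proof (induction k)
  case (Suc k)
  have "g \<otimes> (inv g \<otimes> w) = w" if "w \<in> carrier G" for w
    using that assms(1) Units_closed[OF assms(1)] by (simp flip: m_assoc)
  then show ?case
    using Suc assms Units_closed[OF assms(1)] by (simp add: m_assoc)
qed (use assms in simp)

text \<open>The exponent laws for integers live in groups; on units they are transferred from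
  \<open>units_of G\<close>.\<close>

lemma int_pow_Units: "y \<in> Units G \<Longrightarrow> y [^] (a::int) = y [^]\<^bsub>units_of G\<^esub> a"
  by (simp add: int_pow_def2 units_of_pow units_of_inv Units_pow_closed del: pow_nat)

lemma int_pow_Units_closed: "y \<in> Units G \<Longrightarrow> y [^] (a::int) \<in> Units G"
  using group.int_pow_closed[OF units_group, of y a] by (simp add: int_pow_Units units_of_carrier)

lemma int_pow_Units_add:
  "y \<in> Units G \<Longrightarrow> y [^] (a + b::int) = y [^] a \<otimes> y [^] b"
  using group.int_pow_mult[OF units_group, of y a b] by (simp add: int_pow_Units units_of_carrier units_of_mult)

lemma int_pow_Units_neg_one: "y \<in> Units G \<Longrightarrow> y [^] (- 1::int) = inv y"
  by (simp add: int_pow_def2 Units_closed del: pow_nat)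

lemma int_pow_conj:
  assumes "g \<in> Units G" "y \<in> Units G"
  shows "(inv g \<otimes> y \<otimes> g) [^] (a::int) = inv g \<otimes> y [^] a \<otimes> g"
  using assms Units_conj[of g y] Units_conj[of g "y [^] nat (- a)"] nat_pow_conj[of g y]
  by (simp add: int_pow_def2 Units_closed Units_pow_closed del: pow_nat)

lemma int_pow_1: "y \<in> carrier G \<Longrightarrow> y [^] (1::int) = y"
  by (simp add: int_pow_def2 del: pow_nat)

end

section \<open>Spanning sets from the Yokonuma--Hecke relations\<close>

text \<open>In the application, \<open>Y\<close> is the inverse of \<open>X\<close> and \<open>eps i\<close> is \<open>(q - q\<^sup>-\<^sup>1) e\<^sub>i\<close>.\<close>

locale yokonuma_relations = ring R for R (structure) +
  fixes K :: "'a set" and t g eps :: "nat \<Rightarrow> 'a" and X Y :: 'a and n :: nat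
  assumes K_subring: "subring K R"
    and K_central: "\<lbrakk>c \<in> K; y \<in> carrier R\<rbrakk> \<Longrightarrow> c \<otimes> y = y \<otimes> c"
    and t_closed: "j \<in> {1..n} \<Longrightarrow> t j \<in> carrier R"
    and g_closed: "i \<in> {1..<n} \<Longrightarrow> g i \<in> carrier R"
    and X_closed [simp]: "X \<in> carrier R" and Y_closed [simp]: "Y \<in> carrier R"
    and gg_comm: "\<lbrakk>i \<in> {1..<n}; j \<in> {1..<n}; \<bar>int i - int j\<bar> > 1\<rbrakk> \<Longrightarrow> g i \<otimes> g j = g j \<otimes> g i"
    and g_braid: "\<lbrakk>i \<in> {1..<n}; i + 1 \<in> {1..<n}\<rbrakk>
      \<Longrightarrow> g i \<otimes> g (i + 1) \<otimes> g i = g (i + 1) \<otimes> g i \<otimes> g (i + 1)"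
    and tt_comm: "\<lbrakk>i \<in> {1..n}; j \<in> {1..n}\<rbrakk> \<Longrightarrow> t i \<otimes> t j = t j \<otimes> t i"
    and tg_comm: "\<lbrakk>i \<in> {1..<n}; j \<in> {1..n}\<rbrakk> \<Longrightarrow> t j \<otimes> g i = g i \<otimes> t (transpose i (i + 1) j)"
    and eps_span: "i \<in> {1..<n} \<Longrightarrow> eps i \<in> generate_ring R (K \<union> {t i, t (i + 1)})"
    and eps_g: "i \<in> {1..<n} \<Longrightarrow> eps i \<otimes> g i = g i \<otimes> eps i"
    and g_sq: "i \<in> {1..<n} \<Longrightarrow> g i \<otimes> g i = \<one> \<oplus> eps i \<otimes> g i"
    and XY_one: "X \<otimes> Y = \<one>" and YX_one: "Y \<otimes> X = \<one>"
    and XgXg: "n \<ge> 2 \<Longrightarrow> X \<otimes> g 1 \<otimes> X \<otimes> g 1 = g 1 \<otimes> X \<otimes> g 1 \<otimes> X"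
    and Xg_comm: "i \<in> {2..<n} \<Longrightarrow> X \<otimes> g i = g i \<otimes> X"
    and Xt_comm: "j \<in> {1..n} \<Longrightarrow> X \<otimes> t j = t j \<otimes> X"
begin

text \<open>Omitting \<open>X\<close> and \<open>Y\<close> at rank 0 makes \<open>A 0\<close> equal
  to \<open>K\<close>, the starting point of the uniqueness induction.\<close>

definition gens :: "nat \<Rightarrow> 'a set" where
  "gens k = K \<union> t ` {1..k} \<union> g ` {1..<k} \<union> (if k = 0 then {} else {X, Y})"

definition A :: "nat \<Rightarrow> 'a set" where
  "A k = generate_ring R (gens k)"

text \<open>Indexed by rank, so that \<open>Q k\<close> lies in \<open>A k\<close>; the value at 0
  is a default.\<close>

fun Q :: "nat \<Rightarrow> 'a set" where
  "Q 0 = {}"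
| "Q (Suc 0) = A 1"
| "Q (Suc (Suc k)) = (\<lambda>y. inv (g (Suc k)) \<otimes> y \<otimes> g (Suc k)) ` Q (Suc k)"

text \<open>The second family has no left factor from \<open>A k\<close>; that left multiplication
  stays in the span is what has to be proved.\<close>

definition S :: "nat \<Rightarrow> 'a set" where
  "S k = {u \<otimes> g k \<otimes> v |u v. u \<in> A k \<and> v \<in> A k} \<union> {q \<otimes> v |q v. q \<in> Q (Suc k) \<and> v \<in> A k}"

abbreviation M :: "nat \<Rightarrow> 'a set" where
  "M k \<equiv> addspan R (S k)"

section \<open>The generated subrings \<open>A k\<close>\<close>

lemma gens_carrier: "k \<le> n \<Longrightarrow> gens k \<subseteq> carrier R"
  using subringE(1)[OF K_subring] t_closed g_closed by (auto simp: gens_def split: if_splits)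

lemma A_subring: "k \<le> n \<Longrightarrow> subring (A k) R"
  unfolding A_def by (rule generate_ring_is_subring[OF gens_carrier])

lemma A_carrier: "k \<le> n \<Longrightarrow> A k \<subseteq> carrier R"
  by (rule subringE(1)[OF A_subring])

lemma A_closed: "\<lbrakk>y \<in> A k; k \<le> n\<rbrakk> \<Longrightarrow> y \<in> carrier R"
  using A_carrier by blast

lemma A_mono: "\<lbrakk>j \<le> k; k \<le> n\<rbrakk> \<Longrightarrow> A j \<subseteq> A k"
  unfolding A_def by (rule mono_generate_ring[OF _ gens_carrier]) (auto simp: gens_def split: if_splits)

lemma A_mult: "\<lbrakk>u \<in> A k; v \<in> A k; k \<le> n\<rbrakk> \<Longrightarrow> u \<otimes> v \<in> A k"
  using subringE(6)[OF A_subring] by blast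

lemma gens_in_A: "a \<in> gens k \<Longrightarrow> a \<in> A k"
  unfolding A_def by (rule generate_ring.incl)

lemma t_in_A: "\<lbrakk>1 \<le> j; j \<le> k\<rbrakk> \<Longrightarrow> t j \<in> A k"
  and g_in_A: "\<lbrakk>1 \<le> i; i < k\<rbrakk> \<Longrightarrow> g i \<in> A k"
  and X_in_A: "1 \<le> k \<Longrightarrow> X \<in> A k"
  and Y_in_A: "1 \<le> k \<Longrightarrow> Y \<in> A k"
  and K_in_A: "c \<in> K \<Longrightarrow> c \<in> A k"
  by (rule gens_in_A; simp add: gens_def)+

lemma one_in_A: "\<one> \<in> A k"
  unfolding A_def by (rule generate_ring.one)

lemma eps_in_A:
  assumes "i \<in> {1..<k}" "k \<le> n"
  shows "eps i \<in> A k"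
proof -
  have "generate_ring R (K \<union> {t i, t (i + 1)}) \<subseteq> A k"
    unfolding A_def
    by (rule mono_generate_ring[OF _ gens_carrier]) (use assms in \<open>auto simp: gens_def\<close>)
  then show ?thesis
    using eps_span[of i] assms by auto
qed

lemma eps_closed: "i \<in> {1..<n} \<Longrightarrow> eps i \<in> carrier R"
  using eps_in_A[of i n] A_closed by auto

text \<open>The quadratic relation says \<open>(g i \<ominus> eps i) \<otimes> g i = \<one>\<close>;
  since \<open>eps i\<close> commutes with \<open>g i\<close>, this inverse is two-sided.\<close>

lemma g_inverse:
  assumes "i \<in> {1..<n}"
  shows "g i \<in> Units R" "inv (g i) = g i \<ominus> eps i"
proof -
  note [simp] = g_closed[OF assms] eps_closed[OF assms]
  have eq: "g i \<otimes> g i \<ominus> eps i \<otimes> g i = \<one>"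
    unfolding g_sq[OF assms] by (simp add: a_minus_def a_assoc r_neg)
  have l: "(g i \<ominus> eps i) \<otimes> g i = \<one>"
    using eq by (simp add: a_minus_def l_distr l_minus)
  have r: "g i \<otimes> (g i \<ominus> eps i) = \<one>"
    using eq by (simp add: a_minus_def r_distr r_minus eps_g[OF assms])
  show "g i \<in> Units R"
    unfolding Units_def using l r by (auto intro: bexI[of _ "g i \<ominus> eps i"])
  show "inv (g i) = g i \<ominus> eps i"
    by (rule inv_char[OF _ _ r l]) simp_all
qed

lemma g_inv_closed: "i \<in> {1..<n} \<Longrightarrow> inv (g i) \<in> carrier R"
  using g_inverse(1) by (rule Units_inv_closed)

lemma g_inv_in_A:
  assumes "i \<in> {1..<k}" "k \<le> n"
  shows "inv (g i) \<in> A k"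
  using assms g_inverse(2)[of i] g_in_A[of i k] eps_in_A[OF assms] subringE(5,7)[OF A_subring[of k]]
  by (simp add: a_minus_def)

lemma Y_comm:
  assumes "X \<otimes> y = y \<otimes> X" "y \<in> carrier R"
  shows "Y \<otimes> y = y \<otimes> Y"
proof -
  have "X \<in> Units R"
    unfolding Units_def using XY_one YX_one by (auto intro: bexI[of _ Y])
  moreover have "inv X = Y"
    using XY_one YX_one by (intro inv_char) simp_all
  ultimately show ?thesis using inv_commute[of X y] assms by simp
qed

text \<open>Checked on generators: for \<open>i < k < j\<close> the transposition of
  \<open>i\<close> and \<open>i + 1\<close> fixes \<open>j\<close>.\<close>

lemma t_comm_A:
  assumes "y \<in> A k" "k < j" "j \<le> n"
  shows "t j \<otimes> y = y \<otimes> t j"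
proof (rule generate_ring_commute[OF assms(1)[unfolded A_def]])
  show "gens k \<subseteq> carrier R"
    using assms by (intro gens_carrier) simp
  show "t j \<in> carrier R"
    using assms by (intro t_closed) simp
  fix h assume "h \<in> gens k"
  then consider "h \<in> K" | i where "h = t i" "i \<in> {1..k}" | i where "h = g i" "i \<in> {1..<k}" | "h = X" | "h = Y"
    by (auto simp: gens_def split: if_splits)
  then show "t j \<otimes> h = h \<otimes> t j"
  proof cases
    case 1
    then show ?thesis using K_central[of h "t j"] assms t_closed by simp
  next
    case 2
    then show ?thesis using tt_comm assms by simp
  next
    case 3
    then have "transpose i (i + 1) j = j"
      using assms by (simp add: transpose_def)
    then show ?thesis using tg_comm[of i j] assms 3 by simp
  next
    case 4
    then show ?thesis using Xt_comm assms by simp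
  next
    case 5
    then show ?thesis using Y_comm[OF Xt_comm] t_closed assms by simp
  qed
qed

text \<open>With \<open>k < i\<close>, every \<open>g j\<close> in \<open>gens k\<close> has index
  at distance at least two from \<open>i\<close>, and \<open>i \<ge> 2\<close> as soon as
  \<open>X\<close> occurs.\<close>

lemma g_comm_A:
  assumes "y \<in> A k" "k < i" "i < n"
  shows "g i \<otimes> y = y \<otimes> g i"
proof (rule generate_ring_commute[OF assms(1)[unfolded A_def]])
  show "gens k \<subseteq> carrier R"
    using assms by (intro gens_carrier) simp
  show gc: "g i \<in> carrier R"
    using assms by (intro g_closed) simp
  fix h assume "h \<in> gens k"
  then consider "h \<in> K" | j where "h = t j" "j \<in> {1..k}" | j where "h = g j" "j \<in> {1..<k}"
    | "h = X" "k \<ge> 1" | "h = Y" "k \<ge> 1"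
    by (auto simp: gens_def split: if_splits)
  then show "g i \<otimes> h = h \<otimes> g i"
  proof cases
    case 1
    then show ?thesis using K_central[of h "g i"] gc by simp
  next
    case 2
    then have "transpose i (i + 1) j = j"
      using assms by (simp add: transpose_def)
    then show ?thesis using tg_comm[of i j] assms 2 by simp
  next
    case 3
    then show ?thesis using gg_comm[of i j] assms by simp
  next
    case 4
    then show ?thesis using Xg_comm assms by simp
  next
    case 5
    then show ?thesis using Y_comm[OF Xg_comm] gc assms by simp
  qed
qed

lemma Q_subset_A: "k \<le> n \<Longrightarrow> Q k \<subseteq> A k"
proof (induction k rule: Q.induct)
  case (3 k)
  show ?case
  proof
    fix y assume "y \<in> Q (Suc (Suc k))"
    then obtain q where q: "q \<in> Q (Suc k)" "y = inv (g (Suc k)) \<otimes> q \<otimes> g (Suc k)"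
      by auto
    then have "q \<in> A (Suc (Suc k))"
      using 3 A_mono[of "Suc k" "Suc (Suc k)"] by auto
    then show "y \<in> A (Suc (Suc k))"
      using q(2) 3(2) g_inv_in_A[of "Suc k" "Suc (Suc k)"] g_in_A[of "Suc k" "Suc (Suc k)"]
      by (simp add: A_mult)
  qed
qed simp_all

lemma one_in_Q: "\<lbrakk>1 \<le> k; k \<le> n\<rbrakk> \<Longrightarrow> \<one> \<in> Q k"
proof (induction k rule: Q.induct)
  case (3 k)
  then have "\<one> \<in> Q (Suc k)" "g (Suc k) \<in> Units R"
    using g_inverse by auto
  then show ?case
    by (auto intro!: rev_image_eqI[of \<one>])
qed (simp_all add: one_in_A)

section \<open>The span \<open>M k\<close> and its stability under multiplication\<close>

lemma S_carrier:
  assumes "k \<in> {1..<n}"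
  shows "S k \<subseteq> carrier R"
proof -
  have "Q (Suc k) \<subseteq> carrier R"
    using Q_subset_A[of "Suc k"] A_carrier[of "Suc k"] assms by auto
  then show ?thesis
    using A_carrier[of k] g_closed[OF assms] assms by (auto simp: S_def subset_iff)
qed

lemma M_carrier: "k \<in> {1..<n} \<Longrightarrow> M k \<subseteq> carrier R"
  by (rule addspan_in_carrier[OF S_carrier])

lemma AgA_in_M: "\<lbrakk>u \<in> A k; v \<in> A k\<rbrakk> \<Longrightarrow> u \<otimes> g k \<otimes> v \<in> M k"
  by (rule addspan.incl) (auto simp: S_def)

lemma QA_in_M: "\<lbrakk>q \<in> Q (Suc k); v \<in> A k\<rbrakk> \<Longrightarrow> q \<otimes> v \<in> M k"
  by (rule addspan.incl) (auto simp: S_def)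

lemma Q_Suc: "k \<ge> 1 \<Longrightarrow> Q (Suc k) = (\<lambda>y. inv (g k) \<otimes> y \<otimes> g k) ` Q k"
  by (cases k) auto

lemma A_in_M:
  assumes "k \<in> {1..<n}" "v \<in> A k"
  shows "v \<in> M k"
  using QA_in_M[OF one_in_Q assms(2)] A_closed[OF assms(2)] assms(1) by simp

text \<open>Both families in \<open>S k\<close> end in a factor from \<open>A k\<close>, which
  absorbs \<open>v\<close>.\<close>

lemma M_rmult:
  assumes "k \<in> {1..<n}" "w \<in> M k" "v \<in> A k"
  shows "w \<otimes> v \<in> M k"
proof (rule addspan_rmult[OF assms(2) S_carrier[OF assms(1)]])
  have k: "k \<le> n"
    using assms by simp
  show v: "v \<in> carrier R"
    using A_closed assms by simp
  fix s assume "s \<in> S k"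
  then consider u u' where "s = u \<otimes> g k \<otimes> u'" "u \<in> A k" "u' \<in> A k"
    | q u' where "s = q \<otimes> u'" "q \<in> Q (Suc k)" "u' \<in> A k"
    by (auto simp: S_def)
  then show "s \<otimes> v \<in> M k"
  proof cases
    case 1
    then have "s \<otimes> v = u \<otimes> g k \<otimes> (u' \<otimes> v)"
      using A_closed[OF _ k] g_closed assms v by (simp add: m_assoc)
    then show ?thesis
      using 1 A_mult[OF _ _ k] assms by (simp add: AgA_in_M)
  next
    case 2
    then have "s \<otimes> v = q \<otimes> (u' \<otimes> v)"
      using A_closed[OF _ k] A_closed[of q "Suc k"] Q_subset_A[of "Suc k"] assms v
      by (auto simp add: m_assoc)
    then show ?thesis
      using 2 A_mult[OF _ _ k] assms by (simp add: QA_in_M)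
  qed
qed

text \<open>\<open>M k\<close> is only closed under sums by construction; negatives come from right
  multiplication by \<open>\<ominus> \<one>\<close>, an element of \<open>A k\<close>.\<close>

lemma M_neg:
  assumes "k \<in> {1..<n}" "w \<in> M k"
  shows "\<ominus> w \<in> M k"
proof -
  have k: "k \<le> n"
    using assms by simp
  have "\<ominus> w = w \<otimes> \<ominus> \<one>"
    using M_carrier[OF assms(1)] assms(2) by (auto simp: r_minus)
  then show ?thesis
    using M_rmult[OF assms, of "\<ominus> \<one>"] one_in_A subringE(5)[OF A_subring[OF k]] by simp
qed

lemma M_diff:
  assumes "k \<in> {1..<n}" "w \<in> M k" "w' \<in> M k"
  shows "w \<ominus> w' \<in> M k"
  using M_neg[OF assms(1,3)] assms(2) by (simp add: a_minus_def addspan.add)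

text \<open>Right stability disposes of the trailing factor of \<open>q \<otimes> v\<close>, so in
  the second family only the bare conjugate has to be tested.\<close>

lemma M_cases_lmult:
  assumes "k \<in> {1..<n}" "w \<in> M k" "a \<in> carrier R"
    and "\<And>u v. \<lbrakk>u \<in> A k; v \<in> A k\<rbrakk> \<Longrightarrow> a \<otimes> (u \<otimes> (g k \<otimes> v)) \<in> M k"
    and "\<And>q. q \<in> Q k \<Longrightarrow> a \<otimes> (inv (g k) \<otimes> (q \<otimes> g k)) \<in> M k"
  shows "a \<otimes> w \<in> M k"
proof (rule addspan_lmult[OF assms(2) S_carrier[OF assms(1)] assms(3)])
  have k: "k \<le> n" "1 \<le> k"
    using assms by simp_all
  note cl = A_closed[OF _ k(1)] g_closed[OF assms(1)] g_inv_closed[OF assms(1)]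
  fix s assume "s \<in> S k"
  then consider u v where "s = u \<otimes> g k \<otimes> v" "u \<in> A k" "v \<in> A k"
    | q v where "s = (inv (g k) \<otimes> q \<otimes> g k) \<otimes> v" "q \<in> Q k" "v \<in> A k"
    using Q_Suc[OF k(2)] by (auto simp: S_def)
  then show "a \<otimes> s \<in> M k"
  proof cases
    case 1
    then show ?thesis using assms(3,4) cl by (simp add: m_assoc)
  next
    case 2
    have "q \<in> carrier R"
      using 2 Q_subset_A[OF k(1)] cl by auto
    then have "a \<otimes> s = a \<otimes> (inv (g k) \<otimes> (q \<otimes> g k)) \<otimes> v"
      using 2 assms(3) cl by (simp add: m_assoc)
    then show ?thesis
      using M_rmult[OF assms(1) assms(5)[OF 2(2)] 2(3)] by simp
  qed
qed

text \<open>The braid relation multiplied by inverses. The first form leaves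
  \<open>g (Suc j)\<close> only once and uninverted in the conjugate of \<open>g j\<close>; the
  second moves \<open>g j\<close> through two inverses.\<close>

lemma g_braid_conj:
  assumes "j \<in> {1..<n}" "Suc j \<in> {1..<n}"
  shows "inv (g (Suc j)) \<otimes> (g j \<otimes> g (Suc j)) = g j \<otimes> (g (Suc j) \<otimes> inv (g j))"
    and "g j \<otimes> (inv (g (Suc j)) \<otimes> inv (g j)) = inv (g (Suc j)) \<otimes> (inv (g j) \<otimes> g (Suc j))"
proof -
  let ?a = "g j" and ?b = "g (Suc j)"
  note U = g_inverse(1)[OF assms(1)] g_inverse(1)[OF assms(2)]
  note cl = g_closed[OF assms(1)] g_closed[OF assms(2)] g_inv_closed[OF assms(1)] g_inv_closed[OF assms(2)]
  have br: "?a \<otimes> (?b \<otimes> ?a) = ?b \<otimes> (?a \<otimes> ?b)"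
    using g_braid[of j] assms cl by (simp add: m_assoc)
  have "inv ?b \<otimes> (?a \<otimes> ?b) = inv ?b \<otimes> ((?a \<otimes> (?b \<otimes> ?a)) \<otimes> inv ?a)"
    using cl U by (simp add: m_assoc)
  also have "\<dots> = ?a \<otimes> (?b \<otimes> inv ?a)"
    unfolding br using cl U by (simp add: m_assoc Units_cancel_left)
  finally show "inv ?b \<otimes> (?a \<otimes> ?b) = ?a \<otimes> (?b \<otimes> inv ?a)" .
  have "?a \<otimes> (inv ?b \<otimes> inv ?a) = inv ?b \<otimes> (inv ?a \<otimes> (?a \<otimes> (?b \<otimes> ?a)) \<otimes> (inv ?b \<otimes> inv ?a))"
    using cl U by (simp add: m_assoc Units_cancel_left)
  also have "\<dots> = inv ?b \<otimes> (inv ?a \<otimes> ?b)"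
    unfolding br using cl U by (simp add: m_assoc Units_cancel_left)
  finally show "?a \<otimes> (inv ?b \<otimes> inv ?a) = inv ?b \<otimes> (inv ?a \<otimes> ?b)" .
qed

text \<open>For \<open>k \<ge> 2\<close> this rests on the spanning property one level below, and it reduces most
  of the left stability of \<open>M k\<close> to moving a generator past \<open>g k\<close>.\<close>

lemma conj_A_in_M:
  assumes "k \<in> {1..<n}" "k = 1 \<or> A k \<subseteq> M (k - 1)" "y \<in> A k"
  shows "inv (g k) \<otimes> (y \<otimes> g k) \<in> M k"
proof (cases "k = 1")
  case True
  \<comment> \<open>Here \<open>A 1 = Q 1\<close>, so conjugation lands in \<open>Q 2\<close> by
    construction.\<close>
  have "inv (g k) \<otimes> y \<otimes> g k \<in> Q (Suc k)"
    using True assms(3) by (auto simp: Q_Suc)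
  from QA_in_M[OF this one_in_A] show ?thesis
    using A_closed[OF assms(3)] g_closed[OF assms(1)] g_inv_closed[OF assms(1)] assms(1)
    by (simp add: m_assoc)
next
  case False
  then obtain j where j: "k = Suc j" "j \<in> {1..<n}"
    using assms(1) by (cases k) auto
  have y: "y \<in> M j"
    using assms(2,3) False j by auto
  note cl = g_closed[OF assms(1)] g_closed[OF j(2)] g_inv_closed[OF assms(1)] g_inv_closed[OF j(2)]
  have "inv (g k) \<otimes> y \<otimes> g k \<in> M k"
  proof (rule addspan_sandwich[OF y S_carrier[OF j(2)] cl(3,1)])
    fix s assume "s \<in> S j"
    then consider u v where "s = u \<otimes> g j \<otimes> v" "u \<in> A j" "v \<in> A j"
      | q v where "s = q \<otimes> v" "q \<in> Q k" "v \<in> A j"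
      using j by (auto simp: S_def)
    then show "inv (g k) \<otimes> s \<otimes> g k \<in> M k"
    proof cases
      case 1
      have uv: "u \<in> carrier R" "v \<in> carrier R" "u \<in> A k" "v \<in> A k"
        using 1 A_closed[of _ j] A_mono[of j k] j assms(1) by auto
      \<comment> \<open>\<open>u\<close> and \<open>v\<close> lie in \<open>A j\<close> with
        \<open>j < k\<close> and slide out of the conjugation. Only \<open>g j\<close> is
        conjugated, and it becomes \<open>g j \<otimes> g k \<otimes> inv (g j)\<close>, whose outer
        factors lie in \<open>A k\<close>.\<close>
      have com: "inv (g k) \<otimes> u = u \<otimes> inv (g k)" "v \<otimes> g k = g k \<otimes> v"
        using g_comm_A[of u j k] g_comm_A[of v j k] 1 j assms(1) uv g_inverse(1)[of k]
        by (simp_all add: inv_commute)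
      have "inv (g k) \<otimes> s \<otimes> g k = (inv (g k) \<otimes> u) \<otimes> g j \<otimes> (v \<otimes> g k)"
        using 1 uv cl by (simp add: m_assoc)
      also have "\<dots> = u \<otimes> (inv (g k) \<otimes> (g j \<otimes> g k)) \<otimes> v"
        unfolding com using uv cl by (simp add: m_assoc)
      also have "\<dots> = (u \<otimes> g j) \<otimes> g k \<otimes> (inv (g j) \<otimes> v)"
        using g_braid_conj(1)[OF j(2)] assms(1) j uv cl by (simp add: m_assoc)
      also have "\<dots> \<in> M k"
        using j assms(1) uv g_in_A[of j k] g_inv_in_A[of j k]
        by (intro AgA_in_M A_mult) simp_all
      finally show ?thesis .
    next
      case 2
      have v: "v \<in> carrier R" "v \<in> A k"
        using 2 A_closed[of _ j] A_mono[of j k] j assms(1) by auto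
      have q: "q \<in> carrier R"
        using 2 Q_subset_A[of k] A_closed[of q k] assms(1) by auto
      have "v \<otimes> g k = g k \<otimes> v"
        using g_comm_A[of v j k] 2 j assms(1) by simp
      then have "inv (g k) \<otimes> s \<otimes> g k = (inv (g k) \<otimes> q \<otimes> g k) \<otimes> v"
        using 2 v q cl by (simp add: m_assoc)
      also have "\<dots> \<in> M k"
        using 2 v assms(1) by (intro QA_in_M) (auto simp: Q_Suc)
      finally show ?thesis .
    qed
  qed
  then show ?thesis
    using cl A_closed[OF assms(3)] assms(1) by (simp add: m_assoc)
qed

lemma t_inv_g:
  assumes "i \<in> {1..<n}" "j \<in> {1..n}"
  shows "t j \<otimes> inv (g i) = inv (g i) \<otimes> t (transpose i (i + 1) j)"
proof -
  let ?j = "transpose i (i + 1) j"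
  have j: "?j \<in> {1..n}"
    using assms by (auto simp: transpose_def)
  note cl = g_closed[OF assms(1)] g_inv_closed[OF assms(1)] t_closed[OF assms(2)] t_closed[OF j]
  note U = g_inverse(1)[OF assms(1)]
  have "t j \<otimes> inv (g i) = inv (g i) \<otimes> ((g i \<otimes> t j) \<otimes> inv (g i))"
    using cl U by (simp add: m_assoc Units_cancel_left)
  also have "g i \<otimes> t j = t ?j \<otimes> g i"
    using tg_comm[OF assms(1) j] by simp
  also have "inv (g i) \<otimes> (t ?j \<otimes> g i \<otimes> inv (g i)) = inv (g i) \<otimes> t ?j"
    using cl U by (simp add: m_assoc)
  finally show ?thesis .
qed

text \<open>Crossing \<open>g k\<close> or its inverse exchanges \<open>t k\<close> and
  \<open>t (k + 1)\<close> and fixes the others, so \<open>t j\<close> either enters a factor from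
  \<open>A k\<close> or travels to the right end.\<close>

lemma t_M_stable:
  assumes "k \<in> {1..<n}" "k = 1 \<or> A k \<subseteq> M (k - 1)" "j \<in> {1..Suc k}" "w \<in> M k"
  shows "t j \<otimes> w \<in> M k"
proof (rule M_cases_lmult[OF assms(1,4)])
  have k: "k \<le> n" "k \<ge> 1" and jn: "j \<in> {1..n}"
    using assms by simp_all
  note cl = g_closed[OF assms(1)] g_inv_closed[OF assms(1)] t_closed
  show tj: "t j \<in> carrier R"
    using t_closed jn by simp
  {
    fix u v assume uv: "u \<in> A k" "v \<in> A k"
    note uvc = uv[THEN A_closed[OF _ k(1)]]
    show "t j \<otimes> (u \<otimes> (g k \<otimes> v)) \<in> M k"
    proof (cases "j = Suc k")
      case False
      then have "(t j \<otimes> u) \<otimes> g k \<otimes> v \<in> M k"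
        using assms(3) uv k by (intro AgA_in_M A_mult t_in_A) auto
      then show ?thesis
        using uvc cl tj by (simp add: m_assoc)
    next
      case True
      have c: "t j \<otimes> u = u \<otimes> t j" "t j \<otimes> g k = g k \<otimes> t k"
        using t_comm_A[of u k j] tg_comm[of k j] True uv assms(1) by simp_all
      have "t j \<otimes> (u \<otimes> (g k \<otimes> v)) = u \<otimes> g k \<otimes> (t k \<otimes> v)"
        using uvc cl tj k
        by (simp add: m_assoc rewrite_left[OF c(1)] rewrite_left[OF c(2)])
      then show ?thesis
        using uv k by (simp add: AgA_in_M A_mult t_in_A)
    qed
  next
    fix q assume q: "q \<in> Q k"
    then have qA: "q \<in> A k" and qc: "q \<in> carrier R"
      using Q_subset_A[OF k(1)] A_closed[of q k] k by auto
    let ?i = "transpose k (k + 1) j"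
    have i: "?i \<in> {1..n}"
      using jn assms(1) by (auto simp: transpose_def)
    have "t j \<otimes> (inv (g k) \<otimes> (q \<otimes> g k)) = inv (g k) \<otimes> ((t ?i \<otimes> q) \<otimes> g k)"
      using rewrite_left[OF t_inv_g[OF assms(1) jn]] cl i jn qc by (simp add: m_assoc)
    also have "\<dots> \<in> M k"
    proof (cases "j = k")
      case False
      then have "t ?i \<otimes> q \<in> A k"
        using assms(3) k qA by (intro A_mult t_in_A) (auto simp: transpose_def)
      then show ?thesis
        by (rule conj_A_in_M[OF assms(1,2)])
    next
      case True
      \<comment> \<open>After crossing \<open>inv (g k)\<close> the factor \<open>t (Suc k)\<close>
        is outside \<open>A k\<close>. It commutes with \<open>q\<close> and crosses
        \<open>g k\<close> back into \<open>t k\<close>, now on the right.\<close>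
      then have "?i = Suc k" by simp
      have c: "t (Suc k) \<otimes> q = q \<otimes> t (Suc k)" "t (Suc k) \<otimes> g k = g k \<otimes> t k"
        using t_comm_A[of q k "Suc k"] tg_comm[of k "Suc k"] qA assms(1) by simp_all
      have "inv (g k) \<otimes> ((t ?i \<otimes> q) \<otimes> g k) = (inv (g k) \<otimes> q \<otimes> g k) \<otimes> t k"
        unfolding \<open>?i = Suc k\<close> c(1) using cl assms(1) qc c(2) by (simp add: m_assoc)
      also have "\<dots> \<in> M k"
        using q k t_in_A[of k k] by (intro QA_in_M) (auto simp: Q_Suc)
      finally show ?thesis .
    qed
    finally show "t j \<otimes> (inv (g k) \<otimes> (q \<otimes> g k)) \<in> M k" .
  }
qed

lemma K_M_stable:
  assumes "k \<in> {1..<n}" "c \<in> K" "w \<in> M k"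
  shows "c \<otimes> w \<in> M k"
proof -
  have "c \<otimes> w = w \<otimes> c"
    using K_central assms M_carrier[OF assms(1)] by auto
  then show ?thesis using M_rmult[OF assms(1,3) K_in_A[OF assms(2)]] by simp
qed

text \<open>\<open>eps k\<close> is generated by scalars, \<open>t k\<close> and
  \<open>t (k + 1)\<close>, each already known to preserve \<open>M k\<close>.\<close>

lemma eps_M_stable:
  assumes "k \<in> {1..<n}" "k = 1 \<or> A k \<subseteq> M (k - 1)" "w \<in> M k"
  shows "eps k \<otimes> w \<in> M k"
proof (rule generate_ring_lmult_stable[OF eps_span[OF assms(1)] _ M_carrier[OF assms(1)] M_neg[OF assms(1)] _ assms(3)])
  show "K \<union> {t k, t (k + 1)} \<subseteq> carrier R"
    using subringE(1)[OF K_subring] t_closed assms(1) by auto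
  fix h w assume "h \<in> K \<union> {t k, t (k + 1)}" "w \<in> M k"
  then show "h \<otimes> w \<in> M k"
    using K_M_stable[OF assms(1)] t_M_stable[OF assms(1,2)] assms(1) by auto
qed assumption

lemma g_eq: "i \<in> {1..<n} \<Longrightarrow> g i = inv (g i) \<oplus> eps i"
  using g_closed[of i] eps_closed[of i] g_inverse(2)[of i]
  by (simp add: a_minus_def a_assoc l_neg)

text \<open>For the first family the left \<open>g k\<close> is split as
  \<open>inv (g k) \<oplus> eps k\<close>: one term contains a conjugate of \<open>A k\<close>, the
  other is handled by stability under \<open>eps k\<close>. For the second family the left
  \<open>g k\<close> cancels \<open>inv (g k)\<close>.\<close>

lemma g_M_stable:
  assumes "k \<in> {1..<n}" "k = 1 \<or> A k \<subseteq> M (k - 1)" "w \<in> M k"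
  shows "g k \<otimes> w \<in> M k" and "inv (g k) \<otimes> w \<in> M k"
proof -
  have k: "k \<le> n" "k \<ge> 1"
    using assms by simp_all
  note cl = g_closed[OF assms(1)] g_inv_closed[OF assms(1)] eps_closed[OF assms(1)]
  note U = g_inverse(1)[OF assms(1)]
  show gM: "g k \<otimes> w \<in> M k"
  proof (rule M_cases_lmult[OF assms(1,3) cl(1)])
    fix u v assume uv: "u \<in> A k" "v \<in> A k"
    note uvc = uv[THEN A_closed[OF _ k(1)]]
    have "g k \<otimes> (u \<otimes> (g k \<otimes> v)) = (inv (g k) \<oplus> eps k) \<otimes> (u \<otimes> (g k \<otimes> v))"
      using g_eq[OF assms(1)] by simp
    also have "\<dots> = inv (g k) \<otimes> (u \<otimes> g k) \<otimes> v \<oplus> eps k \<otimes> (u \<otimes> g k \<otimes> v)"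
      using uvc cl by (simp add: m_assoc l_distr)
    also have "\<dots> \<in> M k"
      by (intro addspan.add M_rmult eps_M_stable conj_A_in_M AgA_in_M assms uv)
    finally show "g k \<otimes> (u \<otimes> (g k \<otimes> v)) \<in> M k" .
  next
    fix q assume q: "q \<in> Q k"
    then have qA: "q \<in> A k" and qc: "q \<in> carrier R"
      using Q_subset_A[OF k(1)] A_closed[of q k] k by auto
    have "g k \<otimes> (inv (g k) \<otimes> (q \<otimes> g k)) = q \<otimes> g k \<otimes> \<one>"
      using qc cl U by (simp add: Units_cancel_left)
    then show "g k \<otimes> (inv (g k) \<otimes> (q \<otimes> g k)) \<in> M k"
      using AgA_in_M[OF qA one_in_A] by simp
  qed
  have "inv (g k) \<otimes> w = g k \<otimes> w \<ominus> eps k \<otimes> w"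
    using g_inverse(2)[OF assms(1)] cl M_carrier[OF assms(1)] assms(3)
    by (auto simp: a_minus_def l_distr l_minus)
  then show "inv (g k) \<otimes> w \<in> M k"
    using M_diff[OF assms(1) gM eps_M_stable[OF assms]] by simp
qed

text \<open>Such an \<open>a\<close> is absorbed by the left factor \<open>u\<close>, or moved past
  \<open>inv (g k)\<close> into the conjugated element. It serves \<open>g i\<close> with
  \<open>i + 1 < k\<close> and, for \<open>k \<ge> 2\<close>, the elements \<open>X\<close> and
  \<open>Y\<close>.\<close>

lemma commuting_M_stable:
  assumes "k \<in> {1..<n}" "k = 1 \<or> A k \<subseteq> M (k - 1)" "w \<in> M k"
    and "a \<in> A k" "g k \<otimes> a = a \<otimes> g k"
  shows "a \<otimes> w \<in> M k"
proof (rule M_cases_lmult[OF assms(1,3)])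
  have k: "k \<le> n" "k \<ge> 1"
    using assms by simp_all
  note cl = g_closed[OF assms(1)] g_inv_closed[OF assms(1)] eps_closed[OF assms(1)]
  show a: "a \<in> carrier R"
    using A_closed[OF assms(4) k(1)] .
  {
    fix u v assume uv: "u \<in> A k" "v \<in> A k"
    then have "(a \<otimes> u) \<otimes> g k \<otimes> v \<in> M k"
      using assms(4) k by (intro AgA_in_M A_mult)
    then show "a \<otimes> (u \<otimes> (g k \<otimes> v)) \<in> M k"
      using uv[THEN A_closed[OF _ k(1)]] cl a by (simp add: m_assoc)
  next
    fix q assume q: "q \<in> Q k"
    then have qA: "q \<in> A k" and qc: "q \<in> carrier R"
      using Q_subset_A[OF k(1)] A_closed[of q k] k by auto
    have c: "a \<otimes> inv (g k) = inv (g k) \<otimes> a"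
      using inv_commute[OF g_inverse(1)[OF assms(1)] a assms(5)] by simp
    have "a \<otimes> (inv (g k) \<otimes> (q \<otimes> g k)) = inv (g k) \<otimes> ((a \<otimes> q) \<otimes> g k)"
      using rewrite_left[OF c] cl a qc by (simp add: m_assoc)
    also have "\<dots> \<in> M k"
      using assms(4) qA k by (intro conj_A_in_M[OF assms(1,2)] A_mult)
    finally show "a \<otimes> (inv (g k) \<otimes> (q \<otimes> g k)) \<in> M k" .
  }
qed

text \<open>\<open>g j\<close> is adjacent to \<open>g (Suc j)\<close>, but it commutes with any
  \<open>p\<close> from \<open>Q j\<close> conjugated successively by \<open>g j\<close> and
  \<open>g (Suc j)\<close>: by the braid relation it re-emerges on the right, as an element of
  \<open>A (Suc j)\<close>.\<close>

lemma g_pred_M_stable: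
  assumes "Suc j \<in> {1..<n}" "j \<ge> 1" "w \<in> M (Suc j)"
  shows "g j \<otimes> w \<in> M (Suc j)"
proof (rule M_cases_lmult[OF assms(1,3)])
  define k where "k = Suc j"
  have k: "k \<le> n" "k \<ge> 1" "k \<in> {1..<n}" and j: "j \<in> {1..<n}" "j < n"
    using assms by (simp_all add: k_def)
  note cl = g_closed[OF k(3)] g_closed[OF j(1)] g_inv_closed[OF k(3)] g_inv_closed[OF j(1)]
  note U = g_inverse(1)[OF k(3)] g_inverse(1)[OF j(1)]
  have gA: "g j \<in> A k"
    using g_in_A j by (simp add: k_def)
  show "g j \<in> carrier R" by fact
  {
    fix u v assume uv: "u \<in> A (Suc j)" "v \<in> A (Suc j)"
    then have "(g j \<otimes> u) \<otimes> g k \<otimes> v \<in> M k"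
      using gA k by (intro AgA_in_M A_mult) (simp_all add: k_def)
    then show "g j \<otimes> (u \<otimes> (g (Suc j) \<otimes> v)) \<in> M (Suc j)"
      using uv[THEN A_closed[OF _ k(1)[unfolded k_def]]] cl by (simp add: m_assoc k_def)
  next
    fix q assume "q \<in> Q (Suc j)"
    then obtain p where p: "p \<in> Q j" "q = inv (g j) \<otimes> p \<otimes> g j"
      using Q_Suc[of j] assms(2) by auto
    then have pA: "p \<in> A j" and pc: "p \<in> carrier R"
      using Q_subset_A[of j] A_closed[of p j] j by auto
    have c: "g k \<otimes> p = p \<otimes> g k"
      using g_comm_A[OF pA, of k] k by (simp add: k_def)
    have br: "g k \<otimes> (g j \<otimes> g k) = g j \<otimes> (g k \<otimes> g j)"
      using g_braid[of j] j k cl by (simp add: k_def m_assoc)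
    have qc: "q \<in> carrier R"
      using p cl pc by simp
    have "g j \<otimes> (inv (g k) \<otimes> (q \<otimes> g k))
        = (g j \<otimes> (inv (g k) \<otimes> inv (g j))) \<otimes> (p \<otimes> (g j \<otimes> g k))"
      unfolding p(2) using cl pc by (simp add: m_assoc)
    also have "\<dots> = inv (g k) \<otimes> (inv (g j) \<otimes> ((g k \<otimes> p) \<otimes> (g j \<otimes> g k)))"
      using g_braid_conj(2)[OF j(1)] k cl pc by (simp add: m_assoc k_def)
    also have "\<dots> = (inv (g k) \<otimes> q \<otimes> g k) \<otimes> g j"
      unfolding c p(2) using br cl pc by (simp add: m_assoc)
    also have "\<dots> \<in> M k"
    proof (rule QA_in_M[OF _ gA])
      show "inv (g k) \<otimes> q \<otimes> g k \<in> Q (Suc k)"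
        using \<open>q \<in> Q (Suc j)\<close> k(2) by (auto simp: Q_Suc[of k] k_def)
    qed
    finally show "g j \<otimes> (inv (g (Suc j)) \<otimes> (q \<otimes> g (Suc j))) \<in> M (Suc j)"
      by (simp add: k_def)
  }
qed

section \<open>The case \<open>k = 1\<close>: stability under \<open>X\<close> and its
  inverse\<close>

lemma t1_comm_A1:
  assumes "u \<in> A 1" "n \<ge> 1" "i \<in> {1, 2}" "i \<le> n"
  shows "t i \<otimes> u = u \<otimes> t i"
proof (rule generate_ring_commute[OF assms(1)[unfolded A_def] gens_carrier[OF assms(2)]])
  show c: "t i \<in> carrier R"
    using t_closed assms by auto
  fix h assume "h \<in> gens 1"
  then show "t i \<otimes> h = h \<otimes> t i"
    using K_central[of h "t i"] tt_comm[of i 1] Xt_comm[of i] Y_comm[OF Xt_comm, of i] c assms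
    by (auto simp: gens_def)
qed

lemma eps1_comm:
  assumes "n \<ge> 2" "u \<in> carrier R" "u \<otimes> t 1 = t 1 \<otimes> u" "u \<otimes> t 2 = t 2 \<otimes> u"
  shows "u \<otimes> eps 1 = eps 1 \<otimes> u"
proof (rule generate_ring_commute[OF eps_span _ assms(2)])
  show "1 \<in> {1..<n}" "K \<union> {t 1, t (1 + 1)} \<subseteq> carrier R"
    using assms subringE(1)[OF K_subring] t_closed by auto
  fix h assume "h \<in> K \<union> {t 1, t (1 + 1)}"
  then show "u \<otimes> h = h \<otimes> u"
    using assms K_central[of h u] by (auto simp: numeral_2_eq_2)
qed

text \<open>Compare the affine Hecke algebra, where \<open>g X g\<close> is the second Bernstein generator and
  commutes with the first.\<close>

definition J :: 'a where
  "J = g 1 \<otimes> (X \<otimes> g 1)"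

context
  notes [simp del] = One_nat_def
  assumes n2: "n \<ge> 2"
begin

lemma n2_bounds: "1 \<in> {1..<n}" "1 \<in> {1..n}" "2 \<in> {1..n}" "1 \<le> n"
  using n2 by auto

lemmas g1_closed [simp] = g_closed[OF n2_bounds(1)] g_inv_closed[OF n2_bounds(1)]
  t_closed[OF n2_bounds(2)] t_closed[OF n2_bounds(3)] eps_closed[OF n2_bounds(1)]

lemma J_closed [simp]: "J \<in> carrier R"
  unfolding J_def by simp

text \<open>The two factors \<open>g 1\<close> of \<open>J\<close> exchange the indices 1 and 2
  twice.\<close>

lemma J_comm_t: "i \<in> {1, 2} \<Longrightarrow> J \<otimes> t i = t i \<otimes> J"
proof -
  assume i: "i \<in> {1, 2}"
  let ?j = "transpose 1 2 i"
  have [simp]: "t i \<in> carrier R" "t ?j \<in> carrier R"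
    using i by (auto simp: transpose_def)
  have ij: "i \<in> {1..n}" "?j \<in> {1..n}" "transpose 1 2 ?j = i"
    using i n2_bounds by auto
  have c: "t i \<otimes> g 1 = g 1 \<otimes> t ?j" "t ?j \<otimes> X = X \<otimes> t ?j" "t ?j \<otimes> g 1 = g 1 \<otimes> t i"
    using tg_comm[OF n2_bounds(1) ij(1)] tg_comm[OF n2_bounds(1) ij(2)] Xt_comm[OF ij(2)] ij(3)
    by (simp_all add: numeral_2_eq_2)
  show "J \<otimes> t i = t i \<otimes> J"
    unfolding J_def by (simp add: m_assoc rewrite_left[OF c(1)] rewrite_left[OF c(2)] c(3))
qed

text \<open>The relation between \<open>X\<close> and \<open>g 1\<close> is precisely
  \<open>J \<otimes> X = X \<otimes> J\<close>.\<close>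

lemma J_comm_A1: "u \<in> A 1 \<Longrightarrow> J \<otimes> u = u \<otimes> J"
proof (rule generate_ring_commute[OF _ gens_carrier[of 1] J_closed])
  have X: "J \<otimes> X = X \<otimes> J"
    using XgXg n2 by (simp add: J_def m_assoc)
  fix h assume "h \<in> gens 1"
  then show "J \<otimes> h = h \<otimes> J"
    using K_central[of h J] J_comm_t[of 1] X Y_comm[OF X[symmetric]] by (auto simp: gens_def)
qed (use n2 in \<open>simp_all add: A_def\<close>)

lemma eps1_comm_A1: "u \<in> A 1 \<Longrightarrow> u \<otimes> eps 1 = eps 1 \<otimes> u"
  using t1_comm_A1[of u] A_closed[of u 1] n2 by (intro eps1_comm) auto

lemma eps1_comm_J: "J \<otimes> eps 1 = eps 1 \<otimes> J"
  using J_comm_t n2 by (intro eps1_comm) auto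

lemma J_inverse: "J \<in> Units R" "inv J = inv (g 1) \<otimes> (Y \<otimes> inv (g 1))"
proof -
  let ?I = "inv (g 1) \<otimes> (Y \<otimes> inv (g 1))"
  note U = g_inverse(1)[OF n2_bounds(1)]
  have XY: "X \<otimes> (Y \<otimes> y) = y" "Y \<otimes> (X \<otimes> y) = y" if "y \<in> carrier R" for y
    using XY_one YX_one that by (simp_all flip: m_assoc)
  have I: "J \<otimes> ?I = \<one>" "?I \<otimes> J = \<one>"
    unfolding J_def using U by (simp_all add: m_assoc Units_cancel_left XY)
  then show "J \<in> Units R"
    unfolding Units_def by (auto intro!: bexI[of _ ?I])
  show "inv J = ?I"
    using I by (intro inv_char) simp_all
qed

text \<open>Commuting with \<open>A 1\<close>, \<open>J\<close> passes \<open>u\<close> and meets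
  \<open>g 1\<close> directly, where the quadratic relation applies. Before a conjugate, the last
  \<open>g 1\<close> of \<open>J\<close> cancels \<open>inv (g 1)\<close>.\<close>

lemma J_M_stable:
  assumes "w \<in> M 1"
  shows "J \<otimes> w \<in> M 1" and "inv J \<otimes> w \<in> M 1"
proof -
  note U = g_inverse(1)[OF n2_bounds(1)]
  note A1c = A_closed[OF _ n2_bounds(4)]
  note A1m = A_mult[OF _ _ n2_bounds(4)]
  have XA: "X \<in> A 1" "Y \<in> A 1"
    by (simp_all add: X_in_A Y_in_A)
  show "J \<otimes> w \<in> M 1"
  proof (rule M_cases_lmult[OF n2_bounds(1) assms J_closed])
    fix u v assume uv: "u \<in> A 1" "v \<in> A 1"
    note c = uv[THEN A1c]
    have "J \<otimes> g 1 = g 1 \<otimes> X \<otimes> (g 1 \<otimes> g 1)"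
      by (simp add: J_def m_assoc)
    also have "\<dots> = g 1 \<otimes> X \<oplus> (g 1 \<otimes> (X \<otimes> eps 1)) \<otimes> g 1"
      unfolding g_sq[OF n2_bounds(1)] by (simp add: r_distr m_assoc)
    also have "g 1 \<otimes> (X \<otimes> eps 1) = eps 1 \<otimes> (g 1 \<otimes> X)"
      using eps1_comm_A1[OF XA(1)] rewrite_left[OF eps_g[OF n2_bounds(1)], of X] by simp
    finally have Jg: "J \<otimes> g 1 = g 1 \<otimes> X \<oplus> eps 1 \<otimes> J"
      by (simp add: J_def m_assoc)
    have "J \<otimes> (u \<otimes> (g 1 \<otimes> v)) = u \<otimes> (J \<otimes> g 1) \<otimes> v"
      using rewrite_left[OF J_comm_A1[OF uv(1)]] c by (simp add: m_assoc)
    also have "\<dots> = u \<otimes> g 1 \<otimes> (X \<otimes> v) \<oplus> (u \<otimes> eps 1) \<otimes> (J \<otimes> v)"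
      unfolding Jg using c by (simp add: l_distr r_distr m_assoc)
    \<comment> \<open>\<open>eps 1\<close> and \<open>J\<close> are moved to the left of
      \<open>u\<close>, and \<open>J\<close> is then opened, leaving \<open>eps 1\<close> and
      \<open>g 1\<close> acting on an element of the first family.\<close>
    also have "(u \<otimes> eps 1) \<otimes> (J \<otimes> v) = eps 1 \<otimes> ((u \<otimes> J) \<otimes> v)"
      unfolding eps1_comm_A1[OF uv(1)] using c by (simp add: m_assoc)
    also have "\<dots> = eps 1 \<otimes> (g 1 \<otimes> (X \<otimes> g 1 \<otimes> (u \<otimes> v)))"
      unfolding J_comm_A1[OF uv(1), symmetric] using c by (simp add: J_def m_assoc)
    also have "u \<otimes> g 1 \<otimes> (X \<otimes> v) \<oplus> eps 1 \<otimes> (g 1 \<otimes> (X \<otimes> g 1 \<otimes> (u \<otimes> v))) \<in> M 1"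
      using uv XA by (intro addspan.add eps_M_stable g_M_stable AgA_in_M A1m n2_bounds disjI1 refl)
    finally show "J \<otimes> (u \<otimes> (g 1 \<otimes> v)) \<in> M 1" .
  next
    fix q assume q: "q \<in> Q 1"
    then have q: "q \<in> A 1" by (simp add: One_nat_def)
    have "J \<otimes> (inv (g 1) \<otimes> (q \<otimes> g 1)) = g 1 \<otimes> ((X \<otimes> q) \<otimes> g 1 \<otimes> \<one>)"
      using U A1c[OF q] by (simp add: J_def m_assoc Units_cancel_left)
    also have "\<dots> \<in> M 1"
      using q XA by (intro g_M_stable AgA_in_M A1m n2_bounds one_in_A disjI1 refl)
    finally show "J \<otimes> (inv (g 1) \<otimes> (q \<otimes> g 1)) \<in> M 1" .
  qed
  have inv_J_AgA: "inv J \<otimes> (u \<otimes> (g 1 \<otimes> v)) \<in> M 1" if uv: "u \<in> A 1" "v \<in> A 1" for u v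
  proof -
    note c = uv[THEN A1c]
    have Ju: "inv J \<otimes> u = u \<otimes> inv J"
      by (rule inv_commute[OF J_inverse(1) c(1) J_comm_A1[OF uv(1)]])
    have "inv J \<otimes> (u \<otimes> (g 1 \<otimes> v)) = u \<otimes> (inv J \<otimes> (g 1 \<otimes> v))"
      using rewrite_left[OF Ju] c J_inverse(1) by (simp add: m_assoc)
    also have "\<dots> = u \<otimes> ((g 1 \<ominus> eps 1) \<otimes> (Y \<otimes> v))"
      using c U unfolding J_inverse(2) g_inverse(2)[OF n2_bounds(1), symmetric]
      by (simp add: m_assoc Units_cancel_left)
    also have "\<dots> = u \<otimes> g 1 \<otimes> (Y \<otimes> v) \<ominus> (u \<otimes> eps 1) \<otimes> (Y \<otimes> v)"
      using c by (simp add: a_minus_def l_distr r_distr l_minus r_minus m_assoc)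
    also have "\<dots> = u \<otimes> g 1 \<otimes> (Y \<otimes> v) \<ominus> eps 1 \<otimes> (u \<otimes> (Y \<otimes> v))"
      unfolding eps1_comm_A1[OF uv(1)] using c by (simp add: m_assoc)
    also have "\<dots> \<in> M 1"
      using uv XA by (intro M_diff eps_M_stable AgA_in_M A_in_M A1m n2_bounds disjI1 refl)
    finally show ?thesis .
  qed
  show "inv J \<otimes> w \<in> M 1"
  proof (rule M_cases_lmult[OF n2_bounds(1) assms])
    show Jc: "inv J \<in> carrier R"
      using J_inverse(1) by simp
    fix q assume "q \<in> Q 1"
    then have q: "q \<in> A 1" by (simp add: One_nat_def)
    note c = A1c[OF q]
    \<comment> \<open>With \<open>inv (g 1) = g 1 \<ominus> eps 1\<close>, the first term cancels
      the last factor of \<open>inv J\<close>. In the second, \<open>eps 1\<close> commutes past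
      \<open>inv J\<close>, which then acts on the first family.\<close>
    have "inv (g 1) \<otimes> (q \<otimes> g 1) = g 1 \<otimes> (q \<otimes> g 1) \<ominus> eps 1 \<otimes> (q \<otimes> g 1)"
      using c g_inverse(2)[OF n2_bounds(1)] by (simp add: a_minus_def l_distr l_minus)
    then have "inv J \<otimes> (inv (g 1) \<otimes> (q \<otimes> g 1))
        = inv J \<otimes> (g 1 \<otimes> (q \<otimes> g 1)) \<ominus> inv J \<otimes> (eps 1 \<otimes> (q \<otimes> g 1))"
      using c Jc by (simp add: a_minus_def r_distr r_minus)
    also have "inv J \<otimes> (g 1 \<otimes> (q \<otimes> g 1)) = inv (g 1) \<otimes> ((Y \<otimes> q) \<otimes> g 1 \<otimes> \<one>)"
      using c U unfolding J_inverse(2) by (simp add: m_assoc Units_cancel_left)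
    also have "inv J \<otimes> (eps 1 \<otimes> (q \<otimes> g 1)) = eps 1 \<otimes> (inv J \<otimes> (q \<otimes> (g 1 \<otimes> \<one>)))"
      using rewrite_left[OF inv_commute[OF J_inverse(1) _ eps1_comm_J]] c Jc by simp
    also have "inv (g 1) \<otimes> ((Y \<otimes> q) \<otimes> g 1 \<otimes> \<one>) \<ominus> eps 1 \<otimes> (inv J \<otimes> (q \<otimes> (g 1 \<otimes> \<one>))) \<in> M 1"
      using q XA
      by (intro M_diff eps_M_stable g_M_stable AgA_in_M inv_J_AgA A1m one_in_A n2_bounds disjI1 refl)
    finally show "inv J \<otimes> (inv (g 1) \<otimes> (q \<otimes> g 1)) \<in> M 1" .
  qed (rule inv_J_AgA)
qed

text \<open>\<open>X\<close> is \<open>J\<close> stripped of its two factors \<open>g 1\<close>, and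
  \<open>Y\<close> is \<open>inv J\<close> multiplied by \<open>g 1\<close> on both sides; every
  factor involved preserves \<open>M 1\<close>.\<close>

lemma XY_M1_stable:
  assumes "w \<in> M 1"
  shows "X \<otimes> w \<in> M 1" and "Y \<otimes> w \<in> M 1"
proof -
  note U = g_inverse(1)[OF n2_bounds(1)]
  have w: "w \<in> carrier R"
    using M_carrier[OF n2_bounds(1)] assms by auto
  have "X \<otimes> w = inv (g 1) \<otimes> (J \<otimes> (inv (g 1) \<otimes> w))"
    using w U by (simp add: J_def m_assoc Units_cancel_left)
  then show "X \<otimes> w \<in> M 1"
    using assms by (auto intro: g_M_stable(2) J_M_stable(1) n2_bounds)
  have "Y \<otimes> w = g 1 \<otimes> (inv J \<otimes> (g 1 \<otimes> w))"
    unfolding J_inverse(2) using w U by (simp add: m_assoc Units_cancel_left)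
  then show "Y \<otimes> w \<in> M 1"
    using assms by (auto intro: g_M_stable(1) J_M_stable(2) n2_bounds)
qed

end

section \<open>The spanning theorem\<close>

lemma gens_M_stable:
  assumes "k \<in> {1..<n}" "k = 1 \<or> A k \<subseteq> M (k - 1)" "h \<in> gens (Suc k)" "w \<in> M k"
  shows "h \<otimes> w \<in> M k"
proof -
  have k: "k \<le> n" "k \<ge> 1"
    using assms by simp_all
  have gk: "g k \<in> carrier R"
    using g_closed assms by simp
  from assms(3) consider "h \<in> K" | j where "h = t j" "j \<in> {1..Suc k}" | i where "h = g i" "i \<in> {1..<Suc k}"
    | "h = X" | "h = Y"
    by (auto simp: gens_def)
  then show ?thesis
  proof cases
    case 1
    then show ?thesis using K_M_stable assms by simp
  next
    case 2
    then show ?thesis using t_M_stable assms by simp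
  next
    case 3
    consider "i = k" | "k = Suc i" | "i + 1 < k"
      using 3 by force
    then show ?thesis
    proof cases
      case 1
      then show ?thesis using g_M_stable(1) assms 3 by simp
    next
      case 2
      then show ?thesis using g_pred_M_stable[of i w] assms 3 by simp
    next
      case far: 3
      then have "g k \<otimes> g i = g i \<otimes> g k"
        using gg_comm[of k i] assms(1) 3 by auto
      then show ?thesis
        using commuting_M_stable[OF assms(1,2,4)] g_in_A far 3 by simp
    qed
  next
    case 4
    show ?thesis
    proof (cases "k = 1")
      case True
      then show ?thesis using XY_M1_stable(1) 4 assms by simp
    next
      case False
      then show ?thesis
        using commuting_M_stable[OF assms(1,2,4) X_in_A] Xg_comm[of k] 4 assms(1) by simp
    qed
  next
    case 5
    show ?thesis
    proof (cases "k = 1")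
      case True
      then show ?thesis using XY_M1_stable(2) 5 assms by simp
    next
      case False
      then show ?thesis
        using commuting_M_stable[OF assms(1,2,4) Y_in_A] Y_comm[OF Xg_comm[of k]] gk 5 assms(1) by simp
    qed
  qed
qed

theorem A_Suc_subset_M: "k \<in> {1..<n} \<Longrightarrow> A (Suc k) \<subseteq> M k"
proof (induction k)
  case (Suc k)
  \<comment> \<open>At the bottom the first disjunct holds; above it the induction hypothesis gives
    the second.\<close>
  have pre: "Suc k = 1 \<or> A (Suc k) \<subseteq> M (Suc k - 1)"
    using Suc by (cases k) auto
  show ?case
  proof
    fix y assume y: "y \<in> A (Suc (Suc k))"
    have "y \<otimes> \<one> \<in> M (Suc k)"
    proof (rule generate_ring_lmult_stable[OF y[unfolded A_def]])
      show "gens (Suc (Suc k)) \<subseteq> carrier R"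
        using Suc by (intro gens_carrier) simp
    qed (fact M_carrier[OF Suc.prems] M_neg[OF Suc.prems] gens_M_stable[OF Suc.prems pre]
        A_in_M[OF Suc.prems one_in_A])+
    then show "y \<in> M (Suc k)"
      using A_closed[OF y] Suc.prems by simp
  qed
qed simp

lemma A_0: "A 0 = K"
proof
  show "K \<subseteq> A 0"
    using K_in_A by blast
  show "A 0 \<subseteq> K"
    unfolding A_def using subringE(1)[OF K_subring]
    by (intro generate_ring_min_subring1[OF _ K_subring]) (auto simp: gens_def)
qed

text \<open>\<open>P\<close> plays the role of the set of powers \<open>X ^ a\<close> with \<open>a\<close> in the allowed range.\<close>

lemma A_1_subset_addspan:
  fixes d :: nat
  assumes "n \<ge> 1" "d > 0" "t 1 [^] d = \<one>"
    and "P \<subseteq> carrier R" "\<one> \<in> P"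
    and "\<And>p. p \<in> P \<Longrightarrow> X \<otimes> p \<in> addspan R {c \<otimes> p |c p. c \<in> K \<and> p \<in> P}"
    and "\<And>p. p \<in> P \<Longrightarrow> Y \<otimes> p \<in> addspan R {c \<otimes> p |c p. c \<in> K \<and> p \<in> P}"
    and "\<And>p. p \<in> P \<Longrightarrow> t 1 \<otimes> p = p \<otimes> t 1"
  shows "A 1 \<subseteq> addspan R {c \<otimes> (p \<otimes> t 1 [^] b) |c p b. c \<in> K \<and> p \<in> P \<and> b < d}"
    (is "_ \<subseteq> addspan R ?W")
proof
  let ?V = "{c \<otimes> p |c p. c \<in> K \<and> p \<in> P}"
  have Kc: "c \<in> carrier R" if "c \<in> K" for c
    using that subringE(1)[OF K_subring] by auto
  have Pc: "p \<in> carrier R" if "p \<in> P" for p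
    using that assms(4) by auto
  have t1: "t 1 \<in> carrier R"
    using t_closed assms(1) by simp
  have Wc: "?W \<subseteq> carrier R"
    using Kc Pc t1 by auto
  have Vc: "?V \<subseteq> carrier R"
    using Kc Pc by auto
  have KW: "c \<otimes> w \<in> addspan R ?W" if c: "c \<in> K" and w: "w \<in> addspan R ?W" for c w
  proof (rule addspan_lmult[OF w Wc Kc[OF c]])
    fix s assume "s \<in> ?W"
    then obtain c' p b where s: "s = c' \<otimes> (p \<otimes> t 1 [^] b)" "c' \<in> K" "p \<in> P" "b < d" by auto
    then have "c \<otimes> s = (c \<otimes> c') \<otimes> (p \<otimes> t 1 [^] b)"
      using c Kc Pc t1 by (simp add: m_assoc)
    moreover have "c \<otimes> c' \<in> K"
      using s c subringE(6)[OF K_subring] by simp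
    ultimately show "c \<otimes> s \<in> addspan R ?W"
      using s by (auto intro!: addspan.incl)
  qed
  have VW: "v \<otimes> t 1 [^] b \<in> addspan R ?W" if v: "v \<in> addspan R ?V" and b: "b < d" for v and b :: nat
  proof (rule addspan_rmult[OF v Vc])
    fix s assume "s \<in> ?V"
    then obtain c p where s: "s = c \<otimes> p" "c \<in> K" "p \<in> P" by auto
    then have "s \<otimes> t 1 [^] b = c \<otimes> (p \<otimes> t 1 [^] b)"
      using Kc Pc t1 by (simp add: m_assoc)
    then show "s \<otimes> t 1 [^] b \<in> addspan R ?W"
      using s b by (auto intro: addspan.incl)
  qed (use t1 in simp)
  have XW: "z \<otimes> w \<in> addspan R ?W"
    if w: "w \<in> addspan R ?W" and z: "z \<in> carrier R" "\<And>p. p \<in> P \<Longrightarrow> z \<otimes> p \<in> addspan R ?V" for z w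
  proof (rule addspan_lmult[OF w Wc z(1)])
    fix s assume "s \<in> ?W"
    then obtain c p b where s: "s = c \<otimes> (p \<otimes> t 1 [^] b)" "c \<in> K" "p \<in> P" "b < d" by auto
    have "z \<otimes> s = c \<otimes> ((z \<otimes> p) \<otimes> t 1 [^] b)"
      using s rewrite_left[OF K_central[OF s(2) z(1), symmetric]] Kc Pc t1 z(1) by (simp add: m_assoc)
    then show "z \<otimes> s \<in> addspan R ?W"
      using KW[OF s(2) VW[OF z(2)[OF s(3)] s(4)]] by simp
  qed
  have tW: "t 1 \<otimes> w \<in> addspan R ?W" if w: "w \<in> addspan R ?W" for w
  proof (rule addspan_lmult[OF w Wc t1])
    fix s assume "s \<in> ?W"
    then obtain c p b where s: "s = c \<otimes> (p \<otimes> t 1 [^] b)" "c \<in> K" "p \<in> P" "b < d" by auto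
    have "t 1 \<otimes> s = c \<otimes> ((t 1 \<otimes> p) \<otimes> t 1 [^] b)"
      using s rewrite_left[OF K_central[OF s(2) t1, symmetric]] Kc Pc t1 by (simp add: m_assoc)
    also have "\<dots> = c \<otimes> (p \<otimes> t 1 [^] (Suc b))"
      unfolding assms(8)[OF s(3)] using s Kc Pc t1 by (simp only: m_assoc nat_pow_closed nat_pow_Suc2)
    \<comment> \<open>Only \<open>Suc b = d\<close> wraps around, and there
      \<open>t 1 [^] d = \<one>\<close>.\<close>
    also have "t 1 [^] (Suc b) = t 1 [^] (Suc b mod d)"
      using s(4) assms(3) by (cases "Suc b = d") simp_all
    finally have "t 1 \<otimes> s = c \<otimes> (p \<otimes> t 1 [^] (Suc b mod d))" .
    moreover have "Suc b mod d < d"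
      using assms(2) by simp
    ultimately show "t 1 \<otimes> s \<in> addspan R ?W"
      using s(2,3) by (auto intro!: addspan.incl)
  qed
  have one: "\<one> \<in> addspan R ?W"
    using assms(2,5) subringE(3)[OF K_subring]
    by (intro addspan.incl CollectI exI[of _ \<one>] exI[of _ "0::nat"]) simp
  fix y assume y: "y \<in> A 1"
  have "y \<otimes> \<one> \<in> addspan R ?W"
  proof (rule generate_ring_lmult_stable[OF y[unfolded A_def] gens_carrier[OF assms(1)]])
    show "addspan R ?W \<subseteq> carrier R"
      by (rule addspan_in_carrier[OF Wc])
    then show "\<ominus> w \<in> addspan R ?W" if "w \<in> addspan R ?W" for w
      using KW[of "\<ominus> \<one>" w] that subringE(3,5)[OF K_subring] by (auto simp: l_minus)
    fix h w assume "h \<in> gens 1" "w \<in> addspan R ?W"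
    then show "h \<otimes> w \<in> addspan R ?W"
      using KW tW XW assms(6,7) by (auto simp: gens_def)
  qed (fact one)
  then show "y \<in> addspan R ?W"
    using A_closed[OF y assms(1)] by simp
qed

end

section \<open>The quotient of the free algebra\<close>

lemma ground_ring_carrier:
  "p \<in> carrier (ground_ring m) \<longleftrightarrow> (\<forall>\<mu>\<in>Poly_Mapping.keys p. Poly_Mapping.keys \<mu> \<subseteq> ground_vars m)"
  by (simp add: ground_ring_def)

lemma ground_zero [simp]: "0 \<in> carrier (ground_ring m)"
  and ground_one [simp]: "1 \<in> carrier (ground_ring m)"
  by (simp_all add: ground_ring_carrier)

lemma ground_add: "\<lbrakk>p \<in> carrier (ground_ring m); q \<in> carrier (ground_ring m)\<rbrakk> \<Longrightarrow> p + q \<in> carrier (ground_ring m)"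
  using Poly_Mapping.keys_add[of p q] by (auto simp: ground_ring_carrier)

lemma ground_uminus: "p \<in> carrier (ground_ring m) \<Longrightarrow> - p \<in> carrier (ground_ring m)"
  by (auto simp: ground_ring_carrier in_keys_iff)

lemma ground_mult:
  assumes "p \<in> carrier (ground_ring m)" "q \<in> carrier (ground_ring m)"
  shows "p * q \<in> carrier (ground_ring m)"
  unfolding ground_ring_carrier
proof
  fix \<mu> assume "\<mu> \<in> Poly_Mapping.keys (p * q)"
  then obtain a b where "\<mu> = a + b" "a \<in> Poly_Mapping.keys p" "b \<in> Poly_Mapping.keys q"
    using keys_mult[of p q] by auto
  then show "Poly_Mapping.keys \<mu> \<subseteq> ground_vars m"
    using assms Poly_Mapping.keys_add[of a b] unfolding ground_ring_carrier by blast
qed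

lemma ground_single_zero: "Poly_Mapping.single 0 c \<in> carrier (ground_ring m)"
  by (simp add: ground_ring_carrier)

lemma ground_lvar: "i \<in> ground_vars m \<Longrightarrow> lvar i k \<in> carrier (ground_ring m)"
  by (auto simp: ground_ring_carrier lvar_def)

lemma ground_diff: "\<lbrakk>p \<in> carrier (ground_ring m); q \<in> carrier (ground_ring m)\<rbrakk> \<Longrightarrow> p - q \<in> carrier (ground_ring m)"
  using ground_add[of p m "- q"] ground_uminus[of q m] by simp

lemma ground_qdiff: "qdiff \<in> carrier (ground_ring m)"
  unfolding qdiff_def by (intro ground_diff ground_lvar) (auto simp: ground_vars_def split: enat.split)

lemma ground_var_exists: "\<lbrakk>m = enat l; i \<le> l\<rbrakk> \<Longrightarrow> i \<in> ground_vars m"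
  by (simp add: ground_vars_def)

lemma lvar_inverse: "lvar i 1 * lvar i (- 1) = 1"
  by (simp add: lvar_def mult_single single_add[symmetric] flip: single_one)

section \<open>The free algebra\<close>

lemma free_alg_carrier:
  "f \<in> carrier (free_alg m n) \<longleftrightarrow> (\<forall>w\<in>Poly_Mapping.keys f. set (letters w) \<subseteq> generators n \<and>
     Poly_Mapping.lookup f w \<in> carrier (ground_ring m))"
  by (simp add: free_alg_def)

lemma free_alg_simps [simp]:
  "mult (free_alg m n) = (*)" "one (free_alg m n) = 1" "zero (free_alg m n) = 0" "add (free_alg m n) = (+)"
  by (simp_all add: free_alg_def)

lemma letters_zero [simp]: "letters 0 = []"
  by (simp add: zero_word_def)

lemma letters_plus [simp]: "letters (u + v) = letters u @ letters v"
  by (simp add: plus_word_def)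

lemma free_alg_single:
  "\<lbrakk>set (letters w) \<subseteq> generators n; c \<in> carrier (ground_ring m)\<rbrakk> \<Longrightarrow> Poly_Mapping.single w c \<in> carrier (free_alg m n)"
  by (simp add: free_alg_carrier)

lemma free_alg_zero [simp]: "0 \<in> carrier (free_alg m n)"
  by (simp add: free_alg_carrier)

lemma free_alg_one [simp]: "1 \<in> carrier (free_alg m n)"
  by (simp add: free_alg_carrier)

lemma free_alg_uminus: "f \<in> carrier (free_alg m n) \<Longrightarrow> - f \<in> carrier (free_alg m n)"
  by (auto simp: free_alg_carrier in_keys_iff ground_uminus)

lemma free_alg_add:
  assumes "f \<in> carrier (free_alg m n)" "g \<in> carrier (free_alg m n)"
  shows "f + g \<in> carrier (free_alg m n)"
proof -
  have "Poly_Mapping.lookup h w \<in> carrier (ground_ring m)" if "h \<in> carrier (free_alg m n)" for h w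
    using that by (cases "w \<in> Poly_Mapping.keys h") (auto simp: free_alg_carrier in_keys_iff)
  then show ?thesis
    using assms Poly_Mapping.keys_add[of f g]
    by (simp add: free_alg_carrier lookup_add ground_add subset_iff) blast
qed

lemma free_alg_sum:
  "(\<And>i. i \<in> I \<Longrightarrow> f i \<in> carrier (free_alg m n)) \<Longrightarrow> sum f I \<in> carrier (free_alg m n)"
  by (induction I rule: infinite_finite_induct) (auto intro: free_alg_add)

lemma sum_single_keys: "f = (\<Sum>w\<in>Poly_Mapping.keys f. Poly_Mapping.single w (Poly_Mapping.lookup f w))"
  by (rule poly_mapping_eqI) (auto simp: lookup_sum lookup_single when_def in_keys_iff)

text \<open>Both factors are expanded into monomials, so only products of single terms need
  checking.\<close>

lemma free_alg_mult:
  assumes "f \<in> carrier (free_alg m n)" "g \<in> carrier (free_alg m n)"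
  shows "f * g \<in> carrier (free_alg m n)"
proof -
  have "f * g = (\<Sum>u\<in>Poly_Mapping.keys f. \<Sum>v\<in>Poly_Mapping.keys g.
      Poly_Mapping.single (u + v) (Poly_Mapping.lookup f u * Poly_Mapping.lookup g v))"
    by (rule arg_cong2[where f = "(*)", OF sum_single_keys sum_single_keys, THEN trans])
      (simp add: sum_product mult_single)
  also have "\<dots> \<in> carrier (free_alg m n)"
    using assms by (intro free_alg_sum free_alg_single ground_mult) (auto simp: free_alg_carrier)
  finally show ?thesis .
qed

lemma free_alg_diff:
  "\<lbrakk>f \<in> carrier (free_alg m n); g \<in> carrier (free_alg m n)\<rbrakk> \<Longrightarrow> f - g \<in> carrier (free_alg m n)"
  using free_alg_add[of f m n "- g"] free_alg_uminus[of g m n] by simp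

lemma free_alg_power: "f \<in> carrier (free_alg m n) \<Longrightarrow> f ^ k \<in> carrier (free_alg m n)"
  by (induction k) (auto intro: free_alg_mult)

lemma free_alg_scal: "c \<in> carrier (ground_ring m) \<Longrightarrow> scal c \<in> carrier (free_alg m n)"
  by (simp add: scal_def free_alg_single)

lemma free_alg_gen: "a \<in> generators n \<Longrightarrow> gen a \<in> carrier (free_alg m n)"
  by (simp add: gen_def free_alg_single)

lemma generators_iff:
  "TL j \<in> generators n \<longleftrightarrow> j \<in> {1..n}" "GL i \<in> generators n \<longleftrightarrow> i \<in> {1..<n}"
  "XL \<in> generators n \<longleftrightarrow> n \<ge> 1" "XLinv \<in> generators n \<longleftrightarrow> n \<ge> 1"
  by (auto simp: generators_def)

lemmas free_alg_intros = free_alg_zero free_alg_one free_alg_uminus free_alg_add free_alg_sum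
  free_alg_mult free_alg_diff free_alg_power free_alg_scal free_alg_gen

lemma free_alg_mono: "k \<le> n \<Longrightarrow> carrier (free_alg m k) \<subseteq> carrier (free_alg m n)"
proof -
  assume "k \<le> n"
  then have "generators k \<subseteq> generators n"
    by (auto simp: generators_def)
  then show ?thesis
    unfolding subset_iff free_alg_carrier by blast
qed

lemma single_Word_Cons:
  "Poly_Mapping.single (Word (a # as)) c = gen a * Poly_Mapping.single (Word as) c"
  by (simp add: gen_def mult_single plus_word_def)

text \<open>Monomials factor into letters, so arguments on the free algebra need not mention words
  or coefficients.\<close>

lemma free_alg_induct [consumes 1, case_names scal gen add mult]:
  assumes "f \<in> carrier (free_alg m n)"
    and scal: "\<And>c. c \<in> carrier (ground_ring m) \<Longrightarrow> P (scal c)"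
    and gen: "\<And>a. a \<in> generators n \<Longrightarrow> P (gen a)"
    and add: "\<And>f g. \<lbrakk>f \<in> carrier (free_alg m n); g \<in> carrier (free_alg m n); P f; P g\<rbrakk> \<Longrightarrow> P (f + g)"
    and mult: "\<And>f g. \<lbrakk>f \<in> carrier (free_alg m n); g \<in> carrier (free_alg m n); P f; P g\<rbrakk> \<Longrightarrow> P (f * g)"
  shows "P f"
proof -
  have single: "P (Poly_Mapping.single (Word as) c)"
    if "set as \<subseteq> generators n" "c \<in> carrier (ground_ring m)" for as c
    using that(1)
  proof (induction as)
    case Nil
    then show ?case
      using scal[OF that(2)] by (simp add: scal_def zero_word_def)
  next
    case (Cons a as)
    then show ?case
      unfolding single_Word_Cons
      by (intro mult gen free_alg_gen free_alg_single) (use that in auto)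
  qed
  have "P (\<Sum>w\<in>W. Poly_Mapping.single w (Poly_Mapping.lookup f w))"
    if "W \<subseteq> Poly_Mapping.keys f" for W
    using finite_subset[OF that finite_keys] that
  proof (induction W rule: finite_induct)
    case empty
    have "scal 0 = 0" by (simp add: scal_def)
    then show ?case using scal[OF ground_zero] by simp
  next
    case (insert w W)
    have "set (letters w) \<subseteq> generators n" "Poly_Mapping.lookup f w \<in> carrier (ground_ring m)"
      using insert.prems assms(1) by (auto simp: free_alg_carrier)
    moreover have "(\<Sum>w\<in>W. Poly_Mapping.single w (Poly_Mapping.lookup f w)) \<in> carrier (free_alg m n)"
      using insert.prems assms(1) by (intro free_alg_sum free_alg_single) (auto simp: free_alg_carrier)
    ultimately show ?case
      using insert single[of "letters w" "Poly_Mapping.lookup f w"]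
      by (auto intro!: add free_alg_single)
  qed
  from this[OF subset_refl] show ?thesis
    using sum_single_keys[of f] by simp
qed

lemma scal_commute: "scal c * f = f * scal c"
proof -
  have "scal c * Poly_Mapping.single w b = Poly_Mapping.single w b * scal c" for w b
    by (simp add: scal_def mult_single mult.commute)
  then show ?thesis
    by (subst (1 2) sum_single_keys[of f]) (simp add: sum_distrib_left sum_distrib_right)
qed

lemma scal_add: "scal (a + b) = scal a + scal b"
  and scal_mult: "scal (a * b) = scal a * scal b"
  and scal_zero [simp]: "scal 0 = 0"
  and scal_one [simp]: "scal 1 = 1"
  and scal_uminus: "scal (- a) = - scal a"
  by (simp_all add: scal_def single_add mult_single single_uminus)

lemma free_alg_ring: "ring (free_alg m n)"
proof (rule ringI)
  show "abelian_group (free_alg m n)"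
    by (rule abelian_groupI)
      (auto intro: free_alg_intros bexI[of _ "- x" for x] simp: add.assoc add.commute)
  show "Group.monoid (free_alg m n)"
    by (rule monoidI) (auto intro: free_alg_intros simp: mult.assoc)
qed (simp_all add: distrib_left distrib_right)

lemma eF_closed: "i \<in> {1..<n} \<Longrightarrow> eF d i \<in> carrier (free_alg m n)"
  unfolding eF_def by (intro free_alg_intros ground_single_zero) (auto simp: generators_iff)

section \<open>The ideal of relations\<close>

lemma Y_relation_closed:
  assumes "Y_relation d m n f g"
  shows "f \<in> carrier (free_alg m n)" "g \<in> carrier (free_alg m n)"
proof -
  have prods: "set fs \<subseteq> carrier (free_alg m n) \<Longrightarrow> prod_list fs \<in> carrier (free_alg m n)" for fs
    by (induction fs) (auto intro: free_alg_intros)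
  have transp: "\<lbrakk>i \<in> {1..<n}; j \<in> {1..n}\<rbrakk> \<Longrightarrow> transpose i (i + 1) j \<in> {1..n}" for i j
    by (auto simp: transpose_def)
  have "f \<in> carrier (free_alg m n) \<and> g \<in> carrier (free_alg m n)"
    using assms
  proof cases
    case (tg i j)
    then show ?thesis
      using transp[of i j] by (auto intro!: free_alg_intros simp: generators_iff)
  next
    case (cyclotomic l)
    have "f \<in> carrier (free_alg m n)"
      unfolding cyclotomic(1)
      by (rule prods)
        (use cyclotomic in \<open>auto intro!: free_alg_intros ground_lvar intro: ground_var_exists simp: generators_iff\<close>)
    then show ?thesis
      using cyclotomic by simp
  qed (auto intro!: free_alg_intros eF_closed ground_qdiff simp: generators_iff)
  then show "f \<in> carrier (free_alg m n)" "g \<in> carrier (free_alg m n)" by auto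
qed

lemma Y_relation_mono:
  assumes "Y_relation d m k f g" "k \<le> n"
  shows "Y_relation d m n f g"
  using assms(1)
proof cases
  case (cyclotomic l)
  then show ?thesis
    using assms(2) Y_relation.cyclotomic[of n m l d] by simp
qed (use assms(2) in \<open>auto intro: Y_relation.intros[simplified]\<close>)

lemma rel_ideal_ideal: "ideal (rel_ideal d m n) (free_alg m n)"
  unfolding rel_ideal_def
  by (rule ring.genideal_ideal[OF free_alg_ring]) (auto intro: free_alg_diff Y_relation_closed)

lemma rel_ideal_closed: "f \<in> rel_ideal d m n \<Longrightarrow> f \<in> carrier (free_alg m n)"
  by (rule ideal.Icarr[OF rel_ideal_ideal])

lemma free_alg_a_inv: "f \<in> carrier (free_alg m n) \<Longrightarrow> \<ominus>\<^bsub>free_alg m n\<^esub> f = - f"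
  by (rule abelian_group.minus_equality[OF ring.is_abelian_group[OF free_alg_ring]])
    (auto intro: free_alg_intros)

lemma to_Y_eq_set: "to_Y d m n f = (\<lambda>h. h + f) ` rel_ideal d m n"
  by (auto simp: to_Y_def a_r_coset_def r_coset_def)

text \<open>Cosets are translates inside the whole type \<open>fpoly\<close>, so the criterion holds
  for arbitrary \<open>f\<close> and \<open>g\<close>.\<close>

lemma to_Y_eq_iff: "to_Y d m n f = to_Y d m n g \<longleftrightarrow> f - g \<in> rel_ideal d m n"
proof
  have 0: "0 \<in> rel_ideal d m n"
    using additive_subgroup.zero_closed[OF ideal.axioms(1)[OF rel_ideal_ideal]] by simp
  have minus: "- h \<in> rel_ideal d m n" if "h \<in> rel_ideal d m n" for h
    using additive_subgroup.a_inv_closed[OF ideal.axioms(1)[OF rel_ideal_ideal] that]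
      free_alg_a_inv[OF rel_ideal_closed[OF that]] by simp
  have add: "h + h' \<in> rel_ideal d m n" if "h \<in> rel_ideal d m n" "h' \<in> rel_ideal d m n" for h h'
    using additive_subgroup.a_closed[OF ideal.axioms(1)[OF rel_ideal_ideal] that] by simp
  {
    assume "to_Y d m n f = to_Y d m n g"
    moreover have "f \<in> to_Y d m n f"
      using 0 unfolding to_Y_eq_set by (auto intro: image_eqI[of _ _ 0])
    ultimately obtain h where "f = h + g" "h \<in> rel_ideal d m n"
      unfolding to_Y_eq_set by auto
    then show "f - g \<in> rel_ideal d m n" by simp
  next
    assume fg: "f - g \<in> rel_ideal d m n"
    have "h + f \<in> to_Y d m n g" if "h \<in> rel_ideal d m n" for h
      unfolding to_Y_eq_set using add[OF that fg] by (auto intro!: image_eqI[of _ _ "h + (f - g)"])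
    moreover have "h + g \<in> to_Y d m n f" if "h \<in> rel_ideal d m n" for h
      unfolding to_Y_eq_set using add[OF that minus[OF fg]] by (auto intro!: image_eqI[of _ _ "h + - (f - g)"])
    ultimately show "to_Y d m n f = to_Y d m n g"
      by (auto simp: to_Y_eq_set)
  }
qed

lemma to_Y_rel: "Y_relation d m n f g \<Longrightarrow> to_Y d m n f = to_Y d m n g"
  unfolding to_Y_eq_iff rel_ideal_def
  by (rule subsetD[OF ring.genideal_self[OF free_alg_ring]]) (auto intro: free_alg_diff Y_relation_closed)

section \<open>The quotient algebra\<close>

lemma Yalg_Quot:
  "carrier (Yalg d m n) = carrier (free_alg m n Quot rel_ideal d m n)"
  "mult (Yalg d m n) = mult (free_alg m n Quot rel_ideal d m n)"
  "one (Yalg d m n) = one (free_alg m n Quot rel_ideal d m n)"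
  "zero (Yalg d m n) = zero (free_alg m n Quot rel_ideal d m n)"
  "add (Yalg d m n) = add (free_alg m n Quot rel_ideal d m n)"
  by (simp_all add: Yalg_def Let_def)

lemma Yalg_carrier: "carrier (Yalg d m n) = to_Y d m n ` carrier (free_alg m n)"
  by (auto simp: Yalg_Quot FactRing_def A_RCOSETS_def' to_Y_def a_r_coset_def)

lemma to_Y_closed [simp, intro]: "f \<in> carrier (free_alg m n) \<Longrightarrow> to_Y d m n f \<in> carrier (Yalg d m n)"
  by (simp add: Yalg_carrier)

lemma to_Y_hom: "to_Y d m n \<in> ring_hom (free_alg m n) (free_alg m n Quot rel_ideal d m n)"
  using ideal.rcos_ring_hom[OF rel_ideal_ideal] by (simp add: to_Y_def[abs_def])

lemma to_Y_add:
  "\<lbrakk>f \<in> carrier (free_alg m n); g \<in> carrier (free_alg m n)\<rbrakk>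
    \<Longrightarrow> to_Y d m n (f + g) = to_Y d m n f \<oplus>\<^bsub>Yalg d m n\<^esub> to_Y d m n g"
  using ring_hom_add[OF to_Y_hom] by (simp add: Yalg_Quot)

lemma to_Y_mult:
  "\<lbrakk>f \<in> carrier (free_alg m n); g \<in> carrier (free_alg m n)\<rbrakk>
    \<Longrightarrow> to_Y d m n (f * g) = to_Y d m n f \<otimes>\<^bsub>Yalg d m n\<^esub> to_Y d m n g"
  using ring_hom_mult[OF to_Y_hom] by (simp add: Yalg_Quot)

lemma to_Y_one: "to_Y d m n 1 = \<one>\<^bsub>Yalg d m n\<^esub>"
  using ring_hom_one[OF to_Y_hom] by (simp add: Yalg_Quot)

lemma Yalg_smult: "r \<odot>\<^bsub>Yalg d m n\<^esub> C = to_Y d m n (scal r) \<otimes>\<^bsub>Yalg d m n\<^esub> C"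
  by (simp add: Yalg_def Let_def)

lemma Yalg_ring: "ring (Yalg d m n)"
proof -
  interpret Q: ring "free_alg m n Quot rel_ideal d m n"
    by (rule ideal.quotient_is_ring[OF rel_ideal_ideal])
  show ?thesis
  proof (rule ringI)
    show "abelian_group (Yalg d m n)"
    proof (rule abelian_groupI)
      fix x assume "x \<in> carrier (Yalg d m n)"
      then show "\<exists>y\<in>carrier (Yalg d m n). y \<oplus>\<^bsub>Yalg d m n\<^esub> x = \<zero>\<^bsub>Yalg d m n\<^esub>"
        using Q.l_neg Q.a_inv_closed unfolding Yalg_Quot by blast
    qed (simp_all add: Yalg_Quot Q.a_ac)
    show "Group.monoid (Yalg d m n)"
      by (rule monoidI) (auto simp: Yalg_Quot Q.m_assoc)
  qed (auto simp: Yalg_Quot Q.l_distr Q.r_distr)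
qed

lemma to_Y_zero: "to_Y d m n 0 = \<zero>\<^bsub>Yalg d m n\<^esub>"
proof -
  interpret ring "Yalg d m n" by (rule Yalg_ring)
  show ?thesis
    using to_Y_add[of 0 m n 0 d] by (simp add: add.r_cancel_one')
qed

lemma to_Y_uminus:
  assumes "f \<in> carrier (free_alg m n)"
  shows "to_Y d m n (- f) = \<ominus>\<^bsub>Yalg d m n\<^esub> to_Y d m n f"
proof -
  interpret ring "Yalg d m n" by (rule Yalg_ring)
  show ?thesis
    using to_Y_add[OF free_alg_uminus[OF assms] assms] assms free_alg_uminus[OF assms]
    by (intro minus_equality[symmetric]) (auto simp: to_Y_zero)
qed

lemma to_Y_power:
  assumes "f \<in> carrier (free_alg m n)"
  shows "to_Y d m n (f ^ k) = to_Y d m n f [^]\<^bsub>Yalg d m n\<^esub> k"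
proof -
  interpret ring "Yalg d m n" by (rule Yalg_ring)
  show ?thesis
    using assms
    by (induction k) (simp_all add: to_Y_one to_Y_mult free_alg_power power_Suc2 del: power_Suc)
qed

lemma to_Y_sum_cong:
  assumes "\<And>s. s \<in> I \<Longrightarrow> f s \<in> carrier (free_alg m n) \<and> g s \<in> carrier (free_alg m n)
    \<and> to_Y d m n (f s) = to_Y d m n (g s)"
  shows "to_Y d m n (sum f I) = to_Y d m n (sum g I)"
  using assms
proof (induction I rule: infinite_finite_induct)
  case (insert x F)
  then show ?case
    by (simp add: to_Y_add free_alg_sum)
qed simp_all

text \<open>The ideal of rank \<open>n\<close> meets the free algebra of rank \<open>k\<close> in an
  ideal that contains the rank \<open>k\<close> relations; \<open>rel_ideal d m k\<close> is the
  smallest such ideal.\<close>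

lemma rel_ideal_mono:
  assumes "k \<le> n"
  shows "rel_ideal d m k \<subseteq> rel_ideal d m n"
proof -
  interpret I: ideal "rel_ideal d m n" "free_alg m n" by (rule rel_ideal_ideal)
  let ?J = "rel_ideal d m n \<inter> carrier (free_alg m k)"
  have minus: "- h \<in> rel_ideal d m n" if "h \<in> rel_ideal d m n" for h
    using additive_subgroup.a_inv_closed[OF I.is_additive_subgroup that]
      free_alg_a_inv[OF rel_ideal_closed[OF that]] by simp
  have "ideal ?J (free_alg m k)"
  proof (rule idealI)
    show "ring (free_alg m k)" by (rule free_alg_ring)
    show "subgroup ?J (add_monoid (free_alg m k))"
    proof (rule group.subgroupI[OF abelian_group.a_group[OF ring.is_abelian_group[OF free_alg_ring]]])
      have "0 \<in> ?J"
        using additive_subgroup.zero_closed[OF I.is_additive_subgroup] by simp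
      then show "?J \<noteq> {}" by blast
      fix a assume a: "a \<in> ?J"
      then have "inv\<^bsub>add_monoid (free_alg m k)\<^esub> a = - a"
        using free_alg_a_inv[of a m k] unfolding a_inv_def by auto
      then show "inv\<^bsub>add_monoid (free_alg m k)\<^esub> a \<in> ?J"
        using a minus free_alg_uminus by auto
    qed (use additive_subgroup.a_closed[OF I.is_additive_subgroup] in \<open>auto intro: free_alg_add\<close>)
    fix a x assume "a \<in> ?J" "x \<in> carrier (free_alg m k)"
    then show "x \<otimes>\<^bsub>free_alg m k\<^esub> a \<in> ?J" "a \<otimes>\<^bsub>free_alg m k\<^esub> x \<in> ?J"
      using I.I_l_closed[of a x] I.I_r_closed[of a x] free_alg_mono[OF assms, of m]
        free_alg_mult[of a m k x] free_alg_mult[of x m k a]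
      by auto
  qed
  moreover have "{f - g |f g. Y_relation d m k f g} \<subseteq> ?J"
    using to_Y_rel[OF Y_relation_mono[OF _ assms]]
    by (auto simp: to_Y_eq_iff intro: free_alg_diff Y_relation_closed)
  ultimately have "rel_ideal d m k \<subseteq> ?J"
    unfolding rel_ideal_def[of d m k] by (rule ring.genideal_minimal[OF free_alg_ring])
  then show ?thesis by blast
qed

text \<open>Adding the larger ideal absorbs the smaller one, so \<open>Yemb\<close> acts on
  representatives as the identity.\<close>

lemma Yemb_to_Y:
  assumes "k \<le> n"
  shows "Yemb d m n (to_Y d m k f) = to_Y d m n f"
proof -
  interpret I: ideal "rel_ideal d m n" "free_alg m n" by (rule rel_ideal_ideal)
  interpret I': ideal "rel_ideal d m k" "free_alg m k" by (rule rel_ideal_ideal)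
  show ?thesis
  proof (intro equalityI subsetI)
    fix y assume "y \<in> Yemb d m n (to_Y d m k f)"
    then obtain a b where "y = a + (b + f)" "a \<in> rel_ideal d m n" "b \<in> rel_ideal d m k"
      by (auto simp: Yemb_def set_add_def set_mult_def to_Y_eq_set)
    then show "y \<in> to_Y d m n f"
      using additive_subgroup.a_closed[OF I.is_additive_subgroup, of a b] rel_ideal_mono[OF assms, of d m]
      by (auto simp: to_Y_eq_set add.assoc intro!: image_eqI[of _ _ "a + b"])
  next
    fix y assume "y \<in> to_Y d m n f"
    then obtain a where "y = a + f" "a \<in> rel_ideal d m n"
      by (auto simp: to_Y_eq_set)
    then have "y = a + (0 + f)" "a \<in> rel_ideal d m n" "0 \<in> rel_ideal d m k"
      using additive_subgroup.zero_closed[OF I'.is_additive_subgroup] by simp_all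
    then show "y \<in> Yemb d m n (to_Y d m k f)"
      unfolding Yemb_def set_add_def set_mult_def to_Y_eq_set by fastforce
  qed
qed

text \<open>Moving \<open>g\<close> across a summand exchanges the exponents \<open>s\<close> and
  \<open>d - s\<close>, and the sum is invariant under this exchange because exponents count modulo
  \<open>d\<close>.\<close>

lemma eF_gF_commute:
  assumes "i \<in> {1..<n}" "d > 0"
  shows "to_Y d m n (eF d i * gF i) = to_Y d m n (gF i * eF d i)"
proof -
  interpret ring "Yalg d m n" by (rule Yalg_ring)
  let ?q = "to_Y d m n"
  have gens: "tF i \<in> carrier (free_alg m n)" "tF (Suc i) \<in> carrier (free_alg m n)" "gF i \<in> carrier (free_alg m n)"
    using assms by (auto intro!: free_alg_gen simp: generators_iff)
  note cl = free_alg_power[OF gens(1)] free_alg_power[OF gens(2)] gens(3)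
  note qcl = to_Y_closed[OF gens(1)] to_Y_closed[OF gens(2)] to_Y_closed[OF gens(3)]
  \<comment> \<open>\<open>H u\<close> is \<open>g\<close> times the summand of index
    \<open>u\<close>; the summand of index \<open>s\<close> with \<open>g\<close> on its right
    becomes \<open>H (d - s)\<close>.\<close>
  define H where "H u = gF i * tF i ^ u * tF (Suc i) ^ (d - u)" for u
  have H: "H u \<in> carrier (free_alg m n)" for u
    unfolding H_def by (intro free_alg_mult cl)
  have rel: "?q (tF i) \<otimes>\<^bsub>Yalg d m n\<^esub> ?q (gF i) = ?q (gF i) \<otimes>\<^bsub>Yalg d m n\<^esub> ?q (tF (Suc i))"
     "?q (tF (Suc i)) \<otimes>\<^bsub>Yalg d m n\<^esub> ?q (gF i) = ?q (gF i) \<otimes>\<^bsub>Yalg d m n\<^esub> ?q (tF i)"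
     "?q (tF i) \<otimes>\<^bsub>Yalg d m n\<^esub> ?q (tF (Suc i)) = ?q (tF (Suc i)) \<otimes>\<^bsub>Yalg d m n\<^esub> ?q (tF i)"
    using to_Y_rel[OF Y_relation.tg[of i n i d m]] to_Y_rel[OF Y_relation.tg[of i n "Suc i" d m]]
      to_Y_rel[OF Y_relation.tt_commute[of i n "Suc i" d m]] assms gens by (simp_all add: to_Y_mult)
  have ord: "?q (tF i ^ d) = \<one>\<^bsub>Yalg d m n\<^esub>" "?q (tF (Suc i) ^ d) = \<one>\<^bsub>Yalg d m n\<^esub>"
    using to_Y_rel[OF Y_relation.t_order[of i n d m]] to_Y_rel[OF Y_relation.t_order[of "Suc i" n d m]]
      assms by (simp_all add: to_Y_one)
  have pow: "a [^]\<^bsub>Yalg d m n\<^esub> k \<otimes>\<^bsub>Yalg d m n\<^esub> b = b \<otimes>\<^bsub>Yalg d m n\<^esub> c [^]\<^bsub>Yalg d m n\<^esub> k" if "a \<otimes>\<^bsub>Yalg d m n\<^esub> b = b \<otimes>\<^bsub>Yalg d m n\<^esub> c" "a \<in> carrier (Yalg d m n)"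
    "b \<in> carrier (Yalg d m n)" "c \<in> carrier (Yalg d m n)" for a b c and k :: nat
  proof (induction k)
    case (Suc k)
    have "a [^]\<^bsub>Yalg d m n\<^esub> Suc k \<otimes>\<^bsub>Yalg d m n\<^esub> b = a [^]\<^bsub>Yalg d m n\<^esub> k \<otimes>\<^bsub>Yalg d m n\<^esub> b \<otimes>\<^bsub>Yalg d m n\<^esub> c"
      using that by (simp add: m_assoc)
    then show ?case using Suc that by (simp add: m_assoc)
  qed (use that in simp)
  have summand: "?q (tF i ^ s * tF (Suc i) ^ (d - s) * gF i) = ?q (H (d - s))" if "s < d" for s
  proof -
    have "?q (tF i ^ s * tF (Suc i) ^ (d - s) * gF i)
      = ?q (tF i) [^]\<^bsub>Yalg d m n\<^esub> s \<otimes>\<^bsub>Yalg d m n\<^esub> (?q (tF (Suc i)) [^]\<^bsub>Yalg d m n\<^esub> (d - s) \<otimes>\<^bsub>Yalg d m n\<^esub> ?q (gF i))"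
      using cl gens qcl by (simp add: to_Y_mult to_Y_power free_alg_mult m_assoc)
    also have "\<dots> = (?q (tF i) [^]\<^bsub>Yalg d m n\<^esub> s \<otimes>\<^bsub>Yalg d m n\<^esub> ?q (gF i)) \<otimes>\<^bsub>Yalg d m n\<^esub> ?q (tF i) [^]\<^bsub>Yalg d m n\<^esub> (d - s)"
      using qcl by (simp add: pow[OF rel(2)] m_assoc)
    also have "\<dots> = ?q (gF i) \<otimes>\<^bsub>Yalg d m n\<^esub> (?q (tF (Suc i)) [^]\<^bsub>Yalg d m n\<^esub> s \<otimes>\<^bsub>Yalg d m n\<^esub> ?q (tF i) [^]\<^bsub>Yalg d m n\<^esub> (d - s))"
      using qcl by (simp add: pow[OF rel(1)] m_assoc)
    also have "?q (tF (Suc i)) [^]\<^bsub>Yalg d m n\<^esub> s \<otimes>\<^bsub>Yalg d m n\<^esub> ?q (tF i) [^]\<^bsub>Yalg d m n\<^esub> (d - s)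
        = ?q (tF i) [^]\<^bsub>Yalg d m n\<^esub> (d - s) \<otimes>\<^bsub>Yalg d m n\<^esub> ?q (tF (Suc i)) [^]\<^bsub>Yalg d m n\<^esub> s"
      using qcl by (intro pow pow[OF rel(3), symmetric] nat_pow_closed)
    finally show ?thesis
      using that cl gens qcl by (simp add: H_def to_Y_mult to_Y_power free_alg_mult m_assoc)
  qed
  have H_d: "?q (H d) = ?q (H 0)"
    using ord cl gens qcl by (simp add: H_def to_Y_mult)
  define c where "c = scal (Poly_Mapping.single 0 (1 / of_nat d))"
  have c: "c \<in> carrier (free_alg m n)"
    unfolding c_def by (intro free_alg_scal ground_single_zero)
  have sums: "(\<Sum>s<d. H s) \<in> carrier (free_alg m n)" "(\<Sum>s<d. tF i ^ s * tF (Suc i) ^ (d - s) * gF i) \<in> carrier (free_alg m n)"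
    by (intro free_alg_sum free_alg_mult cl H)+
  have "?q (\<Sum>s<d. tF i ^ s * tF (Suc i) ^ (d - s) * gF i) = ?q (\<Sum>s<d. H (d - s))"
    using summand H by (intro to_Y_sum_cong) (auto intro: free_alg_mult cl)
  also have "(\<Sum>s<d. H (d - s)) = (\<Sum>s<d. H (Suc s))"
    using sum.nat_diff_reindex[of "\<lambda>s. H (Suc s)" d] by (simp add: Suc_diff_Suc)
  \<comment> \<open>The reversed indices run over 1 to \<open>d\<close> instead of 0 to
    \<open>d - 1\<close>; the end terms \<open>H d\<close> and \<open>H 0\<close> have the same
    class since both \<open>d\<close>-th powers are 1.\<close>
  also have "?q (\<Sum>s<d. H (Suc s)) = ?q (\<Sum>s<d. H s)"
  proof -
    obtain d' where d': "d = Suc d'"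
      using assms(2) by (cases d) auto
    have "(\<Sum>s<d. H (Suc s)) = (\<Sum>s<d'. H (Suc s)) + H d"
      unfolding d' by (rule sum.lessThan_Suc)
    moreover have "(\<Sum>s<d. H s) = H 0 + (\<Sum>s<d'. H (Suc s))"
      unfolding d' by (rule sum.lessThan_Suc_shift)
    moreover have "(\<Sum>s<d'. H (Suc s)) \<in> carrier (free_alg m n)"
      by (intro free_alg_sum H)
    ultimately show ?thesis
      using H H_d by (simp add: to_Y_add a_comm)
  qed
  finally have sum_eq: "?q (\<Sum>s<d. tF i ^ s * tF (Suc i) ^ (d - s) * gF i) = ?q (\<Sum>s<d. H s)" .
  have "?q (eF d i * gF i) = ?q (c * (\<Sum>s<d. tF i ^ s * tF (Suc i) ^ (d - s) * gF i))"
    by (simp add: eF_def c_def mult.assoc sum_distrib_right)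
  also have "\<dots> = ?q (c * (\<Sum>s<d. H s))"
    using c sums sum_eq by (simp add: to_Y_mult)
  also have "c * (\<Sum>s<d. H s) = (c * gF i) * (\<Sum>s<d. tF i ^ s * tF (Suc i) ^ (d - s))"
    by (simp only: H_def mult.assoc sum_distrib_left)
  also have "\<dots> = gF i * eF d i"
    unfolding c_def scal_commute[of _ "gF i"] by (simp only: eF_def mult.assoc Suc_eq_plus1)
  finally show ?thesis .
qed

section \<open>The quotient as a model of the abstract relations\<close>

definition scalars :: "nat \<Rightarrow> enat \<Rightarrow> nat \<Rightarrow> fpoly set set" where
  "scalars d m n = (\<lambda>c. to_Y d m n (scal c)) ` carrier (ground_ring m)"

definition epsY :: "nat \<Rightarrow> enat \<Rightarrow> nat \<Rightarrow> nat \<Rightarrow> fpoly set" where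
  "epsY d m n i = to_Y d m n (scal qdiff * eF d i)"

abbreviation XinvY :: "nat \<Rightarrow> enat \<Rightarrow> nat \<Rightarrow> fpoly set" where
  "XinvY d m n \<equiv> to_Y d m n XinvF"

lemma Yalg_relations:
  assumes "n \<ge> 1" "d > 0"
  shows "yokonuma_relations (Yalg d m n) (scalars d m n) (tY d m n) (gY d m n) (epsY d m n)
    (XY d m n) (XinvY d m n) n"
proof -
  interpret ring "Yalg d m n" by (rule Yalg_ring)
  let ?q = "to_Y d m n"
  have gens: "j \<in> {1..n} \<Longrightarrow> tF j \<in> carrier (free_alg m n)" "i \<in> {1..<n} \<Longrightarrow> gF i \<in> carrier (free_alg m n)"
    "XF \<in> carrier (free_alg m n)" "XinvF \<in> carrier (free_alg m n)" for i j
    using assms by (auto intro!: free_alg_gen simp: generators_iff)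
  note cl = gens free_alg_mult free_alg_add free_alg_one free_alg_power eF_closed
    free_alg_scal[OF ground_qdiff]
  have rel: "?q f = ?q g" if "Y_relation d m n f g" for f g
    using to_Y_rel[OF that] .
  note defs = tY_def gY_def XY_def epsY_def
  show ?thesis
  proof (intro yokonuma_relations.intro yokonuma_relations_axioms.intro Yalg_ring)
    show "subring (scalars d m n) (Yalg d m n)"
    proof (rule subringI)
      show "\<one>\<^bsub>Yalg d m n\<^esub> \<in> scalars d m n"
        unfolding scalars_def by (rule image_eqI[of _ _ 1]) (simp_all add: to_Y_one)
      fix a b assume "a \<in> scalars d m n" "b \<in> scalars d m n"
      then obtain c e where ce: "a = ?q (scal c)" "c \<in> carrier (ground_ring m)"
          "b = ?q (scal e)" "e \<in> carrier (ground_ring m)"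
        by (auto simp: scalars_def)
      then have "a \<otimes>\<^bsub>Yalg d m n\<^esub> b = ?q (scal (c * e))" "a \<oplus>\<^bsub>Yalg d m n\<^esub> b = ?q (scal (c + e))"
        by (simp_all add: scal_mult scal_add to_Y_mult to_Y_add free_alg_scal)
      then show "a \<otimes>\<^bsub>Yalg d m n\<^esub> b \<in> scalars d m n" "a \<oplus>\<^bsub>Yalg d m n\<^esub> b \<in> scalars d m n"
        using ce by (simp_all add: scalars_def ground_mult ground_add)
    next
      fix a assume "a \<in> scalars d m n"
      then obtain c where "a = ?q (scal c)" "c \<in> carrier (ground_ring m)"
        by (auto simp: scalars_def)
      then show "\<ominus>\<^bsub>Yalg d m n\<^esub> a \<in> scalars d m n"
        unfolding scalars_def
        by (intro image_eqI[of _ _ "- c"]) (simp_all add: ground_uminus scal_uminus free_alg_scal to_Y_uminus)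
    qed (auto simp: scalars_def free_alg_scal)
    show "c \<otimes>\<^bsub>Yalg d m n\<^esub> y = y \<otimes>\<^bsub>Yalg d m n\<^esub> c"
      if "c \<in> scalars d m n" "y \<in> carrier (Yalg d m n)" for c y
    proof -
      obtain e f where "c = ?q (scal e)" "y = ?q f" "e \<in> carrier (ground_ring m)" "f \<in> carrier (free_alg m n)"
        using \<open>c \<in> scalars d m n\<close> \<open>y \<in> carrier (Yalg d m n)\<close> by (auto simp: scalars_def Yalg_carrier)
      then show ?thesis
        using to_Y_mult[of "scal e" m n f d] to_Y_mult[of f m n "scal e" d] scal_commute[of e f]
        by (simp add: free_alg_scal)
    qed
    show "tY d m n j \<in> carrier (Yalg d m n)" if "j \<in> {1..n}" for j
      using gens that by (auto simp: defs)
    show "gY d m n i \<in> carrier (Yalg d m n)" if "i \<in> {1..<n}" for i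
      using gens that by (auto simp: defs)
    show "XY d m n \<in> carrier (Yalg d m n)" "XinvY d m n \<in> carrier (Yalg d m n)"
      using gens by (auto simp: defs)
    show "gY d m n i \<otimes>\<^bsub>Yalg d m n\<^esub> gY d m n j = gY d m n j \<otimes>\<^bsub>Yalg d m n\<^esub> gY d m n i"
      if "i \<in> {1..<n}" "j \<in> {1..<n}" "\<bar>int i - int j\<bar> > 1" for i j
      using rel[OF Y_relation.gg_commute[OF that]] gens that by (simp add: defs to_Y_mult)
    show "gY d m n i \<otimes>\<^bsub>Yalg d m n\<^esub> gY d m n (i + 1) \<otimes>\<^bsub>Yalg d m n\<^esub> gY d m n i
      = gY d m n (i + 1) \<otimes>\<^bsub>Yalg d m n\<^esub> gY d m n i \<otimes>\<^bsub>Yalg d m n\<^esub> gY d m n (i + 1)"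
      if "i \<in> {1..<n}" "i + 1 \<in> {1..<n}" for i
      using rel[OF Y_relation.braid[OF that]] gens that by (simp add: defs to_Y_mult cl)
    show "tY d m n i \<otimes>\<^bsub>Yalg d m n\<^esub> tY d m n j = tY d m n j \<otimes>\<^bsub>Yalg d m n\<^esub> tY d m n i"
      if "i \<in> {1..n}" "j \<in> {1..n}" for i j
      using rel[OF Y_relation.tt_commute[OF that]] gens that by (simp add: defs to_Y_mult)
    show "tY d m n j \<otimes>\<^bsub>Yalg d m n\<^esub> gY d m n i = gY d m n i \<otimes>\<^bsub>Yalg d m n\<^esub> tY d m n (transpose i (i + 1) j)"
      if "i \<in> {1..<n}" "j \<in> {1..n}" for i j
    proof -
      have "transpose i (i + 1) j \<in> {1..n}"
        using that by (auto simp: transpose_def)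
      then show ?thesis
        using rel[OF Y_relation.tg[OF that]] gens that by (simp add: defs to_Y_mult)
    qed
    show "epsY d m n i \<in> generate_ring (Yalg d m n) (scalars d m n \<union> {tY d m n i, tY d m n (i + 1)})"
      (is "_ \<in> ?G") if i: "i \<in> {1..<n}" for i
    proof -
      have t: "tF i \<in> carrier (free_alg m n)" "tF (i + 1) \<in> carrier (free_alg m n)"
        "?q (tF i) \<in> ?G" "?q (tF (i + 1)) \<in> ?G"
        using i gens by (auto intro: generate_ring.incl simp: defs)
      have pow: "?q (f ^ k) \<in> ?G" if "f \<in> carrier (free_alg m n)" "?q f \<in> ?G" for f k
        using that by (induction k) (auto simp: to_Y_one to_Y_mult cl intro: generate_ring.intros)
      have sum: "?q (sum f I) \<in> ?G" if "\<And>s. f s \<in> carrier (free_alg m n) \<and> ?q (f s) \<in> ?G" for f and I :: "nat set"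
        using that
        by (induction I rule: infinite_finite_induct)
          (auto simp: to_Y_zero to_Y_add free_alg_sum zero_in_generate intro: generate_ring.intros)
      have scal: "?q (scal c) \<in> ?G" if "c \<in> carrier (ground_ring m)" for c
        using that by (auto simp: scalars_def intro: generate_ring.incl)
      have "?q (\<Sum>s<d. tF i ^ s * tF (i + 1) ^ (d - s)) \<in> ?G"
        using t pow[OF t(1,3)] pow[OF t(2,4)]
        by (intro sum) (auto simp: to_Y_mult cl intro: generate_ring.eng_mult)
      moreover have "(\<Sum>s<d. tF i ^ s * tF (i + 1) ^ (d - s)) \<in> carrier (free_alg m n)"
        by (intro free_alg_sum free_alg_mult free_alg_power t)
      ultimately show ?thesis
        unfolding epsY_def eF_def
        using scal[OF ground_qdiff] scal[OF ground_single_zero]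
        by (simp add: to_Y_mult free_alg_mult free_alg_scal ground_single_zero ground_qdiff
            generate_ring.eng_mult del: Un_insert_right)
    qed
    show "epsY d m n i \<otimes>\<^bsub>Yalg d m n\<^esub> gY d m n i = gY d m n i \<otimes>\<^bsub>Yalg d m n\<^esub> epsY d m n i"
      if i: "i \<in> {1..<n}" for i
    proof -
      have "?q (scal qdiff * eF d i * gF i) = ?q (scal qdiff * (gF i * eF d i))"
        using eF_gF_commute[OF i assms(2), of m] gens i cl by (simp add: to_Y_mult mult.assoc)
      \<comment> \<open>This holds in the free algebra already, since scalars are central
        there.\<close>
      also have "scal qdiff * (gF i * eF d i) = gF i * (scal qdiff * eF d i)"
        by (simp only: scal_commute[of qdiff "gF i"] flip: mult.assoc)
      finally show ?thesis
        using gens i cl by (simp add: defs to_Y_mult)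
    qed
    show "gY d m n i \<otimes>\<^bsub>Yalg d m n\<^esub> gY d m n i
        = \<one>\<^bsub>Yalg d m n\<^esub> \<oplus>\<^bsub>Yalg d m n\<^esub> epsY d m n i \<otimes>\<^bsub>Yalg d m n\<^esub> gY d m n i"
      if i: "i \<in> {1..<n}" for i
      using rel[OF Y_relation.g_square[OF i]] gens i cl
      by (simp add: defs to_Y_mult to_Y_add to_Y_one power2_eq_square)
    show "XY d m n \<otimes>\<^bsub>Yalg d m n\<^esub> XinvY d m n = \<one>\<^bsub>Yalg d m n\<^esub>"
      "XinvY d m n \<otimes>\<^bsub>Yalg d m n\<^esub> XY d m n = \<one>\<^bsub>Yalg d m n\<^esub>"
      using rel[OF Y_relation.X_inv_right] rel[OF Y_relation.X_inv_left] gens assms(1)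
      by (simp_all add: defs to_Y_mult to_Y_one)
    show "XY d m n \<otimes>\<^bsub>Yalg d m n\<^esub> gY d m n 1 \<otimes>\<^bsub>Yalg d m n\<^esub> XY d m n \<otimes>\<^bsub>Yalg d m n\<^esub> gY d m n 1
      = gY d m n 1 \<otimes>\<^bsub>Yalg d m n\<^esub> XY d m n \<otimes>\<^bsub>Yalg d m n\<^esub> gY d m n 1 \<otimes>\<^bsub>Yalg d m n\<^esub> XY d m n"
      if "n \<ge> 2"
      using rel[OF Y_relation.Xg1[OF that]] gens(2)[of 1] gens that by (simp add: defs to_Y_mult cl)
    show "XY d m n \<otimes>\<^bsub>Yalg d m n\<^esub> gY d m n i = gY d m n i \<otimes>\<^bsub>Yalg d m n\<^esub> XY d m n"
      if "i \<in> {2..<n}" for i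
      using rel[OF Y_relation.Xg_commute[OF that]] gens that by (simp add: defs to_Y_mult)
    show "XY d m n \<otimes>\<^bsub>Yalg d m n\<^esub> tY d m n j = tY d m n j \<otimes>\<^bsub>Yalg d m n\<^esub> XY d m n"
      if "j \<in> {1..n}" for j
      using rel[OF Y_relation.Xt_commute[OF that]] gens that by (simp add: defs to_Y_mult)
  qed
qed

text \<open>Translates the generated subrings of the abstract argument into the embedded algebras
  over which the Markov conditions quantify.\<close>

lemma A_eq_image:
  assumes "n \<ge> 1" "d > 0" "k \<le> n"
  shows "yokonuma_relations.A (Yalg d m n) (scalars d m n) (tY d m n) (gY d m n) (XY d m n) (XinvY d m n) k
    = Yemb d m n ` carrier (Yalg d m k)"
proof -
  interpret Y: yokonuma_relations "Yalg d m n" "scalars d m n" "tY d m n" "gY d m n" "epsY d m n"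
    "XY d m n" "XinvY d m n" n
    using assms by (intro Yalg_relations)
  have im: "Yemb d m n ` carrier (Yalg d m k) = to_Y d m n ` carrier (free_alg m k)" (is "?L = ?I")
    using Yemb_to_Y[OF assms(3)] by (simp add: Yalg_carrier image_image)
  note mono = subsetD[OF free_alg_mono[OF assms(3)]]
  have "Y.A k \<subseteq> ?I"
    unfolding Y.A_def
  proof (rule Y.generate_ring_min_subring1[OF Y.gens_carrier[OF assms(3)]])
    show "subring ?I (Yalg d m n)"
    proof (rule Y.subringI)
      show "\<one>\<^bsub>Yalg d m n\<^esub> \<in> ?I"
        by (rule image_eqI[of _ _ 1]) (simp_all add: to_Y_one)
    next
      fix a b assume "a \<in> ?I" "b \<in> ?I"
      then obtain f g where "a = to_Y d m n f" "b = to_Y d m n g" "f \<in> carrier (free_alg m k)" "g \<in> carrier (free_alg m k)"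
        by auto
      then have "a \<otimes>\<^bsub>Yalg d m n\<^esub> b = to_Y d m n (f * g)" "f * g \<in> carrier (free_alg m k)"
        "a \<oplus>\<^bsub>Yalg d m n\<^esub> b = to_Y d m n (f + g)" "f + g \<in> carrier (free_alg m k)"
        by (simp_all add: to_Y_mult to_Y_add mono free_alg_mult free_alg_add)
      then show "a \<otimes>\<^bsub>Yalg d m n\<^esub> b \<in> ?I" "a \<oplus>\<^bsub>Yalg d m n\<^esub> b \<in> ?I"
        by simp_all
    next
      fix a assume "a \<in> ?I"
      then obtain f where "a = to_Y d m n f" "f \<in> carrier (free_alg m k)"
        by auto
      then show "\<ominus>\<^bsub>Yalg d m n\<^esub> a \<in> ?I"
        by (intro image_eqI[of _ _ "- f"]) (simp_all add: to_Y_uminus mono free_alg_uminus)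
    qed (auto intro: mono)
    show "Y.gens k \<subseteq> ?I"
      unfolding Y.gens_def unfolding scalars_def tY_def gY_def XY_def
      by (auto simp: generators_iff intro!: free_alg_scal free_alg_gen imageI split: if_splits)
  qed
  moreover have "to_Y d m n f \<in> Y.A k" if "f \<in> carrier (free_alg m k)" for f
    using that
  proof (induction rule: free_alg_induct)
    case (scal c)
    then show ?case by (intro Y.K_in_A) (auto simp: scalars_def)
  next
    case (gen a)
    then have "to_Y d m n (gen a) \<in> Y.gens k"
      unfolding Y.gens_def by (cases a) (auto simp: generators_iff tY_def gY_def XY_def)
    then show ?case
      by (rule Y.gens_in_A)
  next
    case (add f g)
    then show ?case
      using subringE(7)[OF Y.A_subring[OF assms(3)]] by (simp add: to_Y_add mono)
  next
    case (mult f g)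
    then show ?case
      using Y.A_mult assms(3) by (simp add: to_Y_mult mono)
  qed
  ultimately show ?thesis
    unfolding im by auto
qed

section \<open>Uniqueness of the Markov trace\<close>

lemma Yalg_smult_one:
  assumes "c \<in> carrier (ground_ring m)"
  shows "c \<odot>\<^bsub>Yalg d m n\<^esub> \<one>\<^bsub>Yalg d m n\<^esub> = to_Y d m n (scal c)"
proof -
  interpret ring "Yalg d m n" by (rule Yalg_ring)
  show ?thesis
    using to_Y_closed[OF free_alg_scal[OF assms], where d = d] by (simp add: Yalg_smult)
qed

text \<open>Up to sign the constant coefficient is the product of the units \<open>v i\<close>. The
  leading 1 later expresses the power \<open>j\<close> of \<open>X\<close> by lower ones, and the
  invertible constant term expresses the inverse of \<open>X\<close>.\<close>

lemma cyclotomic_expansion: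
  fixes v :: "nat \<Rightarrow> laurent"
  assumes "\<And>i. i < j \<Longrightarrow> v i \<in> carrier (ground_ring m) \<and> (\<exists>w\<in>carrier (ground_ring m). v i * w = 1)"
  shows "\<exists>c. (\<forall>i. c i \<in> carrier (ground_ring m)) \<and> c j = 1 \<and> (\<exists>w\<in>carrier (ground_ring m). w * c 0 = 1)
    \<and> prod_list (map (\<lambda>i. XF - scal (v i)) [0..<j]) = (\<Sum>i\<le>j. scal (c i) * XF ^ i)"
  using assms
proof (induction j)
  case 0
  show ?case by (rule exI[of _ "\<lambda>_. 1"]) auto
next
  case (Suc j)
  then obtain c w where c: "\<And>i. c i \<in> carrier (ground_ring m)" "c j = 1" "w \<in> carrier (ground_ring m)"
      "w * c 0 = 1" "prod_list (map (\<lambda>i. XF - scal (v i)) [0..<j]) = (\<Sum>i\<le>j. scal (c i) * XF ^ i)"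
    by auto
  obtain u where u: "u \<in> carrier (ground_ring m)" "v j * u = 1" and v: "v j \<in> carrier (ground_ring m)"
    using Suc.prems[of j] by auto
  \<comment> \<open>\<open>a\<close> comes from multiplication by \<open>XF\<close>, which shifts
    the coefficients, and \<open>b\<close> from multiplication by \<open>v j\<close>; zeros at index
    0 and at \<open>Suc j\<close> bring both sums to a common range.\<close>
  define a where "a i = (case i of 0 \<Rightarrow> 0 | Suc i \<Rightarrow> c i)" for i
  define b where "b i = (if i \<le> j then c i * v j else 0)" for i
  have "prod_list (map (\<lambda>i. XF - scal (v i)) [0..<Suc j])
      = (\<Sum>i\<le>j. scal (c i) * XF ^ i) * (XF - scal (v j))"
    using c(5) by simp
  also have "\<dots> = (\<Sum>i\<le>j. scal (c i) * XF ^ Suc i) - (\<Sum>i\<le>j. scal (c i * v j) * XF ^ i)"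
  proof -
    have "scal (c i) * XF ^ i * scal (v j) = scal (c i * v j) * XF ^ i" for i
      using scal_commute[of "v j" "XF ^ i"] by (simp add: scal_mult mult.assoc)
    moreover have "scal (c i) * XF ^ i * XF = scal (c i) * XF ^ Suc i" for i
      by (simp add: mult.assoc power_commutes)
    ultimately show ?thesis
      by (simp add: right_diff_distrib sum_distrib_right del: power_Suc)
  qed
  also have "(\<Sum>i\<le>j. scal (c i) * XF ^ Suc i) = (\<Sum>i\<le>Suc j. scal (a i) * XF ^ i)"
    by (subst sum.atMost_Suc_shift) (simp add: a_def)
  also have "(\<Sum>i\<le>j. scal (c i * v j) * XF ^ i) = (\<Sum>i\<le>Suc j. scal (b i) * XF ^ i)"
    by (simp add: b_def)
  also have "(\<Sum>i\<le>Suc j. scal (a i) * XF ^ i) - (\<Sum>i\<le>Suc j. scal (b i) * XF ^ i)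
      = (\<Sum>i\<le>Suc j. scal (a i - b i) * XF ^ i)"
    by (simp only: diff_conv_add_uminus[of "a _"] scal_add scal_uminus distrib_right sum.distrib
        sum_negf mult_minus_left diff_conv_add_uminus[of "sum _ _"])
  finally have "prod_list (map (\<lambda>i. XF - scal (v i)) [0..<Suc j]) = (\<Sum>i\<le>Suc j. scal (a i - b i) * XF ^ i)" .
  moreover have "a i - b i \<in> carrier (ground_ring m)" for i
    using c(1) v by (intro ground_diff) (auto simp: a_def b_def ground_mult split: nat.split)
  moreover have "a (Suc j) - b (Suc j) = 1"
    using c(2) by (simp add: a_def b_def)
  \<comment> \<open>The new constant term is \<open>- (c 0 * v j)\<close>, so the inverses
    \<open>w\<close> and \<open>u\<close> combine to its inverse.\<close>
  moreover have "(- (w * u)) * (a 0 - b 0) = (w * c 0) * (v j * u)"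
    by (simp add: a_def b_def ac_simps)
  then have "(- (w * u)) * (a 0 - b 0) = 1"
    using c(4) u(2) by simp
  moreover have "- (w * u) \<in> carrier (ground_ring m)"
    using c(3) u(1) by (intro ground_uminus ground_mult)
  ultimately show ?case
    by (intro exI[of _ "\<lambda>i. a i - b i"]) blast
qed

lemma to_Y_sum_in_addspan:
  assumes "\<And>i. i \<in> I \<Longrightarrow> f i \<in> carrier (free_alg m n) \<and> to_Y d m n (f i) \<in> addspan (Yalg d m n) S"
  shows "to_Y d m n (sum f I) \<in> addspan (Yalg d m n) S"
  using assms
  by (induction I rule: infinite_finite_induct)
    (auto simp: to_Y_zero to_Y_add free_alg_sum intro: addspan.intros)

lemma XY_Units:
  assumes "n \<ge> 1" "d > 0"
  shows "XY d m n \<in> Units (Yalg d m n)" and "inv\<^bsub>Yalg d m n\<^esub> XY d m n = XinvY d m n"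
proof -
  interpret Y: yokonuma_relations "Yalg d m n" "scalars d m n" "tY d m n" "gY d m n" "epsY d m n"
    "XY d m n" "XinvY d m n" n
    using assms by (rule Yalg_relations)
  show "XY d m n \<in> Units (Yalg d m n)"
    unfolding Units_def using Y.XY_one Y.YX_one by (auto intro: bexI[of _ "XinvY d m n"])
  show "inv\<^bsub>Yalg d m n\<^esub> XY d m n = XinvY d m n"
    using Y.XY_one Y.YX_one by (intro Y.inv_char) simp_all
qed

text \<open>Multiplication shifts the exponent by one. Over all integers this is harmless; over a
  finite range only the ends produce new powers, with exponents \<open>l\<close> and -1.\<close>

lemma XY_powers_closed:
  assumes "n \<ge> 1" "d > 0" "m > 0"
  defines "P \<equiv> (\<lambda>a. XY d m n [^]\<^bsub>Yalg d m n\<^esub> a) ` exponents m"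
  defines "V \<equiv> addspan (Yalg d m n) {c \<otimes>\<^bsub>Yalg d m n\<^esub> p |c p. c \<in> scalars d m n \<and> p \<in> P}"
  assumes "p \<in> P"
  shows "XY d m n \<otimes>\<^bsub>Yalg d m n\<^esub> p \<in> V" and "XinvY d m n \<otimes>\<^bsub>Yalg d m n\<^esub> p \<in> V"
proof -
  let ?Y = "Yalg d m n"
  let ?X = "XY d m n"
  interpret Y: yokonuma_relations ?Y "scalars d m n" "tY d m n" "gY d m n" "epsY d m n"
    ?X "XinvY d m n" n
    using assms(1,2) by (rule Yalg_relations)
  note U = XY_Units[OF assms(1,2), of m]
  obtain a where a: "p = ?X [^]\<^bsub>?Y\<^esub> a" "a \<in> exponents m"
    using assms(6) by (auto simp: P_def)
  have up: "?X \<otimes>\<^bsub>?Y\<^esub> p = ?X [^]\<^bsub>?Y\<^esub> (1 + a)"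
    unfolding a(1) Y.int_pow_Units_add[OF U(1)] by (simp add: int_pow_int[of _ _ 1, simplified])
  have down: "XinvY d m n \<otimes>\<^bsub>?Y\<^esub> p = ?X [^]\<^bsub>?Y\<^esub> (- 1 + a)"
    unfolding a(1) Y.int_pow_Units_add[OF U(1)] Y.int_pow_Units_neg_one[OF U(1)] U(2) by simp
  have P_in_V: "?X [^]\<^bsub>?Y\<^esub> b \<in> V" if "b \<in> exponents m" for b
  proof -
    have "\<one>\<^bsub>?Y\<^esub> \<otimes>\<^bsub>?Y\<^esub> ?X [^]\<^bsub>?Y\<^esub> b \<in> V"
      unfolding V_def P_def
      using that subringE(3)[OF Y.K_subring] by (intro addspan.incl) blast
    then show ?thesis
      using Y.Units_closed[OF Y.int_pow_Units_closed[OF U(1)]] by simp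
  qed
  have "?X \<otimes>\<^bsub>?Y\<^esub> p \<in> V \<and> XinvY d m n \<otimes>\<^bsub>?Y\<^esub> p \<in> V"
  proof (cases m)
    case infinity
    then show ?thesis
      using P_in_V unfolding up down by (simp add: exponents_def)
  next
    case (enat l)
    have l: "l > 0" and ex: "exponents m = {0..<int l}"
      using assms(3) enat by (simp_all add: exponents_def zero_enat_def)
    have F: "XF \<in> carrier (free_alg m n)" "XinvF \<in> carrier (free_alg m n)"
      using assms(1) by (auto intro!: free_alg_gen simp: generators_iff)
    have Xpow: "to_Y d m n (XF ^ i) = ?X [^]\<^bsub>?Y\<^esub> int i" for i
      using to_Y_power[OF F(1)] by (simp add: int_pow_int XY_def)
    \<comment> \<open>Shifts the numbering of the variables, which starts at 1 in the relation and
      at 0 in the expansion.\<close>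
    define v where "v i = lvar (Suc i) 1" for i
    have "\<exists>c. (\<forall>i. c i \<in> carrier (ground_ring m)) \<and> c l = 1 \<and> (\<exists>w\<in>carrier (ground_ring m). w * c 0 = 1)
      \<and> prod_list (map (\<lambda>i. XF - scal (v i)) [0..<l]) = (\<Sum>i\<le>l. scal (c i) * XF ^ i)"
    proof (rule cyclotomic_expansion)
      fix i assume "i < l"
      then have "Suc i \<in> ground_vars m"
        using enat by (auto intro: ground_var_exists)
      then show "v i \<in> carrier (ground_ring m) \<and> (\<exists>w\<in>carrier (ground_ring m). v i * w = 1)"
        unfolding v_def using ground_lvar lvar_inverse by blast
    qed
    then obtain c w where c: "\<And>i. c i \<in> carrier (ground_ring m)" "c l = 1" "w \<in> carrier (ground_ring m)"
        "w * c 0 = 1" "prod_list (map (\<lambda>i. XF - scal (v i)) [0..<l]) = (\<Sum>i\<le>l. scal (c i) * XF ^ i)"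
      by blast
    have "map (\<lambda>i. XF - scal (lvar i 1)) [1..<l + 1] = map (\<lambda>i. XF - scal (v i)) [0..<l]"
      by (rule nth_equalityI) (simp_all add: v_def del: upt_Suc)
    then have zero: "to_Y d m n (\<Sum>i\<le>l. scal (c i) * XF ^ i) = \<zero>\<^bsub>?Y\<^esub>"
      using to_Y_rel[OF Y_relation.cyclotomic[OF assms(1) enat]] c(5) by (simp add: to_Y_zero)
    have term_closed: "scal e * XF ^ i \<in> carrier (free_alg m n)" if "e \<in> carrier (ground_ring m)" for e i
      using that F by (intro free_alg_mult free_alg_scal free_alg_power)
    have sum_in_V: "to_Y d m n (\<Sum>i<l. scal (e i) * XF ^ i) \<in> V"
      if "\<And>i. e i \<in> carrier (ground_ring m)" for e
      unfolding V_def
    proof (rule to_Y_sum_in_addspan, intro conjI)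
      fix i assume i: "i \<in> {..<l}"
      show "scal (e i) * XF ^ i \<in> carrier (free_alg m n)"
        by (rule term_closed[OF that])
      have "to_Y d m n (scal (e i) * XF ^ i) = to_Y d m n (scal (e i)) \<otimes>\<^bsub>?Y\<^esub> ?X [^]\<^bsub>?Y\<^esub> int i"
        using that F Xpow by (simp add: to_Y_mult free_alg_scal free_alg_power)
      moreover have "to_Y d m n (scal (e i)) \<in> scalars d m n"
        using that by (simp add: scalars_def)
      moreover have "?X [^]\<^bsub>?Y\<^esub> int i \<in> P"
        unfolding P_def ex using i by (intro imageI) simp
      ultimately show "to_Y d m n (scal (e i) * XF ^ i)
          \<in> addspan ?Y {c \<otimes>\<^bsub>?Y\<^esub> p |c p. c \<in> scalars d m n \<and> p \<in> P}"
        by (intro addspan.incl) blast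
    qed
    \<comment> \<open>The relation is solved for its leading term, using
      \<open>c l = 1\<close>.\<close>
    have "?X [^]\<^bsub>?Y\<^esub> int l \<in> V"
    proof -
      have "XF ^ l = (\<Sum>i\<le>l. scal (c i) * XF ^ i) + (\<Sum>i<l. scal (- c i) * XF ^ i)"
        using c(2) by (simp add: lessThan_Suc_atMost[symmetric] scal_uminus sum_negf)
      moreover have "(\<Sum>i\<le>l. scal (c i) * XF ^ i) \<in> carrier (free_alg m n)"
        "(\<Sum>i<l. scal (- c i) * XF ^ i) \<in> carrier (free_alg m n)"
        using c(1) by (intro free_alg_sum term_closed ground_uminus; simp)+
      ultimately have "to_Y d m n (XF ^ l) = to_Y d m n (\<Sum>i<l. scal (- c i) * XF ^ i)"
        using zero by (simp add: to_Y_add)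
      then show ?thesis
        using sum_in_V[of "\<lambda>i. - c i"] c(1) by (simp add: Xpow ground_uminus)
    qed
    moreover have "?X [^]\<^bsub>?Y\<^esub> (- 1 :: int) \<in> V"
    proof -
      define q where "q = (\<Sum>i<l. scal (c (Suc i)) * XF ^ i)"
      have q: "q \<in> carrier (free_alg m n)"
        unfolding q_def using c(1) by (intro free_alg_sum term_closed)
      \<comment> \<open>Splitting off the constant term gives \<open>c 0 + q X = 0\<close> in the
        quotient; multiplying by the inverse of \<open>X\<close> on the right and by
        \<open>w\<close> on the left yields \<open>- w q\<close> as that inverse.\<close>
      have "(\<Sum>i\<le>l. scal (c i) * XF ^ i) = scal (c 0) + q * XF"
        using l unfolding q_def sum_distrib_right
        by (subst sum.atMost_shift) (simp add: mult.assoc power_commutes)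
      then have 0: "to_Y d m n (scal (c 0)) \<oplus>\<^bsub>?Y\<^esub> to_Y d m n q \<otimes>\<^bsub>?Y\<^esub> ?X = \<zero>\<^bsub>?Y\<^esub>"
        using zero c(1) q F by (simp add: to_Y_add to_Y_mult free_alg_scal free_alg_mult XY_def)
      have cl: "to_Y d m n (scal (c 0)) \<in> carrier ?Y" "to_Y d m n q \<in> carrier ?Y" "to_Y d m n (scal w) \<in> carrier ?Y"
        using c q by (auto intro: free_alg_scal)
      have "to_Y d m n (scal (c 0)) \<otimes>\<^bsub>?Y\<^esub> XinvY d m n \<oplus>\<^bsub>?Y\<^esub> to_Y d m n q = \<zero>\<^bsub>?Y\<^esub> \<otimes>\<^bsub>?Y\<^esub> XinvY d m n"
        using cl Y.XY_one by (simp add: Y.l_distr Y.m_assoc flip: 0)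
      then have "to_Y d m n (scal (c 0)) \<otimes>\<^bsub>?Y\<^esub> XinvY d m n = \<ominus>\<^bsub>?Y\<^esub> to_Y d m n q"
        using cl by (simp add: Y.minus_equality)
      then have "to_Y d m n (scal w) \<otimes>\<^bsub>?Y\<^esub> (to_Y d m n (scal (c 0)) \<otimes>\<^bsub>?Y\<^esub> XinvY d m n)
          = to_Y d m n (scal w) \<otimes>\<^bsub>?Y\<^esub> to_Y d m n (- q)"
        using q by (simp add: to_Y_uminus)
      moreover have "to_Y d m n (scal w) \<otimes>\<^bsub>?Y\<^esub> to_Y d m n (scal (c 0)) = \<one>\<^bsub>?Y\<^esub>"
        using c by (simp add: to_Y_one free_alg_scal flip: to_Y_mult scal_mult)
      ultimately have "XinvY d m n = to_Y d m n (scal w) \<otimes>\<^bsub>?Y\<^esub> to_Y d m n (- q)"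
        using cl by (simp flip: Y.m_assoc)
      also have "\<dots> = to_Y d m n (\<Sum>i<l. scal (- (w * c (Suc i))) * XF ^ i)"
        using c q by (simp add: free_alg_scal free_alg_uminus q_def sum_distrib_left scal_uminus
            scal_mult mult.assoc sum_negf flip: to_Y_mult)
      also have "\<dots> \<in> V"
        using c by (intro sum_in_V ground_uminus ground_mult)
      finally show ?thesis
        using Y.int_pow_Units_neg_one[OF U(1)] U(2) by simp
    qed
    ultimately show ?thesis
      using P_in_V[of "1 + a"] P_in_V[of "- 1 + a"] a(2) unfolding up down ex
      by (cases "a = int l - 1"; cases "a = 0") auto
  qed
  then show "?X \<otimes>\<^bsub>?Y\<^esub> p \<in> V" "XinvY d m n \<otimes>\<^bsub>?Y\<^esub> p \<in> V" by auto
qed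

section \<open>The modified generators and spanning sets of \<open>Q k\<close>\<close>

lemma Xtilde_Suc:
  "k \<ge> 1 \<Longrightarrow> Xtilde d m n (Suc k) =
    inv\<^bsub>Yalg d m n\<^esub> (gY d m n k) \<otimes>\<^bsub>Yalg d m n\<^esub> Xtilde d m n k \<otimes>\<^bsub>Yalg d m n\<^esub> gY d m n k"
  by (cases k) auto

lemma Xtilde_Units:
  assumes "k \<ge> 1" "k \<le> n" "d > 0"
  shows "Xtilde d m n k \<in> Units (Yalg d m n)"
  using assms(1,2)
proof (induction k rule: nat_induct_at_least)
  case base
  then show ?case
    using XY_Units assms(3) by simp
next
  case (Suc k)
  interpret Y: yokonuma_relations "Yalg d m n" "scalars d m n" "tY d m n" "gY d m n" "epsY d m n"
    "XY d m n" "XinvY d m n" n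
    using Suc.prems assms(3) by (intro Yalg_relations) simp_all
  show ?case
    unfolding Xtilde_Suc[OF Suc.hyps] using Suc by (intro Y.Units_conj Y.g_inverse) simp_all
qed

text \<open>\<open>t\<close> of index \<open>k + 1\<close> is the conjugate of \<open>t\<close> of
  index \<open>k\<close> by the same element that defines \<open>Xtilde\<close>, so the product is
  conjugated as a whole.\<close>

lemma Xtilde_t_conj:
  fixes a :: int and b :: nat
  assumes "k \<in> {1..<n}" "d > 0"
  shows "Xtilde d m n (Suc k) [^]\<^bsub>Yalg d m n\<^esub> a \<otimes>\<^bsub>Yalg d m n\<^esub> tY d m n (Suc k) [^]\<^bsub>Yalg d m n\<^esub> b
    = inv\<^bsub>Yalg d m n\<^esub> (gY d m n k) \<otimes>\<^bsub>Yalg d m n\<^esub>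
      (Xtilde d m n k [^]\<^bsub>Yalg d m n\<^esub> a \<otimes>\<^bsub>Yalg d m n\<^esub> tY d m n k [^]\<^bsub>Yalg d m n\<^esub> b) \<otimes>\<^bsub>Yalg d m n\<^esub> gY d m n k"
proof -
  interpret Y: yokonuma_relations "Yalg d m n" "scalars d m n" "tY d m n" "gY d m n" "epsY d m n"
    "XY d m n" "XinvY d m n" n
    using assms by (intro Yalg_relations) simp_all
  note U = Y.g_inverse(1)[OF assms(1)]
  note cl = Y.g_closed[OF assms(1)] Y.g_inv_closed[OF assms(1)]
  have t: "tY d m n k \<in> carrier (Yalg d m n)" "tY d m n (Suc k) \<in> carrier (Yalg d m n)"
    using assms by (auto intro: Y.t_closed)
  have "tY d m n k \<otimes>\<^bsub>Yalg d m n\<^esub> gY d m n k = gY d m n k \<otimes>\<^bsub>Yalg d m n\<^esub> tY d m n (Suc k)"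
    using Y.tg_comm[of k k] assms(1) by simp
  then have t_conj: "tY d m n (Suc k)
      = inv\<^bsub>Yalg d m n\<^esub> (gY d m n k) \<otimes>\<^bsub>Yalg d m n\<^esub> tY d m n k \<otimes>\<^bsub>Yalg d m n\<^esub> gY d m n k"
    using U cl t by (simp add: Y.m_assoc Y.Units_cancel_left)
  have X: "Xtilde d m n k \<in> Units (Yalg d m n)"
    using Xtilde_Units assms by simp
  have Xa: "Xtilde d m n k [^]\<^bsub>Yalg d m n\<^esub> a \<in> carrier (Yalg d m n)"
    using Y.int_pow_Units_closed[OF X] by (rule Y.Units_closed)
  have k: "k \<ge> 1"
    using assms by simp
  show ?thesis
    unfolding t_conj Xtilde_Suc[OF k] Y.int_pow_conj[OF U X] Y.nat_pow_conj[OF U t(1)]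
    using Xa t cl U by (simp add: Y.m_assoc Y.Units_cancel_left)
qed

text \<open>The spanning set of \<open>A 1\<close> is carried up by the conjugations that define
  \<open>Q\<close>; the coefficients are central and stay in front.\<close>

lemma Q_subset_addspan:
  assumes "k \<ge> 1" "k \<le> n" "d > 0" "m > 0"
  shows "yokonuma_relations.Q (Yalg d m n) (scalars d m n) (tY d m n) (gY d m n) (XY d m n) (XinvY d m n) k
    \<subseteq> addspan (Yalg d m n) {c \<otimes>\<^bsub>Yalg d m n\<^esub>
      (Xtilde d m n k [^]\<^bsub>Yalg d m n\<^esub> a \<otimes>\<^bsub>Yalg d m n\<^esub> tY d m n k [^]\<^bsub>Yalg d m n\<^esub> b) |c a b.
      c \<in> scalars d m n \<and> a \<in> exponents m \<and> b < d}"
  using assms(1,2)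
proof (induction k rule: nat_induct_at_least)
  case base
  let ?Y = "Yalg d m n"
  interpret Y: yokonuma_relations "Yalg d m n" "scalars d m n" "tY d m n" "gY d m n" "epsY d m n"
    "XY d m n" "XinvY d m n" n
    using base assms(3) by (intro Yalg_relations) simp_all
  let ?P = "(\<lambda>a. XY d m n [^]\<^bsub>?Y\<^esub> a) ` exponents m"
  note U = XY_Units[OF base assms(3), of m]
  have t1: "tY d m n 1 \<in> carrier ?Y"
    using base by (intro Y.t_closed) simp
  have P_closed: "XY d m n [^]\<^bsub>?Y\<^esub> a \<in> carrier ?Y" for a :: int
    using Y.int_pow_Units_closed[OF U(1)] by (rule Y.Units_closed)
  have P_comm: "tY d m n 1 \<otimes>\<^bsub>?Y\<^esub> XY d m n [^]\<^bsub>?Y\<^esub> a = XY d m n [^]\<^bsub>?Y\<^esub> a \<otimes>\<^bsub>?Y\<^esub> tY d m n 1" for a :: int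
  proof -
    have "XY d m n [^]\<^bsub>?Y\<^esub> (k :: nat) \<in> Y.A 1" for k
      using Y.X_in_A[of 1] Y.A_mult[OF _ _ base] Y.one_in_A[of 1] by (induction k) auto
    then have comm: "XY d m n [^]\<^bsub>?Y\<^esub> (k :: nat) \<otimes>\<^bsub>?Y\<^esub> tY d m n 1
        = tY d m n 1 \<otimes>\<^bsub>?Y\<^esub> XY d m n [^]\<^bsub>?Y\<^esub> k" for k
      using Y.t1_comm_A1[of _ 1] base by simp
    then show ?thesis
      \<comment> \<open>A negative power is the inverse of a natural power, and inverses inherit
        commutation.\<close>
      using Y.inv_commute[OF Y.Units_pow_closed[OF U(1)] t1 comm] by (simp add: int_pow_def2 del: pow_nat)
  qed
  have "Y.A 1 \<subseteq> addspan ?Y {c \<otimes>\<^bsub>?Y\<^esub> (p \<otimes>\<^bsub>?Y\<^esub> tY d m n 1 [^]\<^bsub>?Y\<^esub> b) |c p b.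
      c \<in> scalars d m n \<and> p \<in> ?P \<and> b < d}"
  proof (rule Y.A_1_subset_addspan[OF base assms(3)])
    show "tY d m n 1 [^]\<^bsub>?Y\<^esub> d = \<one>\<^bsub>?Y\<^esub>"
      using to_Y_rel[OF Y_relation.t_order[of 1 n d m]] base
        to_Y_power[OF free_alg_gen[of "TL 1" n m], of d d]
      by (simp add: tY_def to_Y_one generators_iff)
    show "?P \<subseteq> carrier ?Y"
      using P_closed by auto
    show "\<one>\<^bsub>?Y\<^esub> \<in> ?P"
      using assms(4) by (intro image_eqI[of _ _ 0]) (auto simp: exponents_def zero_enat_def split: enat.split)
  qed (use XY_powers_closed[OF base assms(3,4)] P_comm in auto)
  moreover have "{c \<otimes>\<^bsub>?Y\<^esub> (p \<otimes>\<^bsub>?Y\<^esub> tY d m n 1 [^]\<^bsub>?Y\<^esub> b) |c p b. c \<in> scalars d m n \<and> p \<in> ?P \<and> b < d}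
    = {c \<otimes>\<^bsub>?Y\<^esub> (Xtilde d m n 1 [^]\<^bsub>?Y\<^esub> a \<otimes>\<^bsub>?Y\<^esub> tY d m n 1 [^]\<^bsub>?Y\<^esub> b) |c a b.
      c \<in> scalars d m n \<and> a \<in> exponents m \<and> b < d}"
    by auto
  ultimately show ?case
    by simp
next
  case (Suc k)
  let ?Y = "Yalg d m n"
  interpret Y: yokonuma_relations ?Y "scalars d m n" "tY d m n" "gY d m n" "epsY d m n"
    "XY d m n" "XinvY d m n" n
    using Suc.prems assms(3) by (intro Yalg_relations) simp_all
  have kn: "k \<in> {1..<n}"
    using Suc by simp
  note cl = Y.g_closed[OF kn] Y.g_inv_closed[OF kn]
  have x: "Xtilde d m n k [^]\<^bsub>?Y\<^esub> a \<otimes>\<^bsub>?Y\<^esub> tY d m n k [^]\<^bsub>?Y\<^esub> b \<in> carrier ?Y" for a :: int and b :: nat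
    using kn assms(3) by (intro Y.m_closed Y.nat_pow_closed Y.t_closed Y.Units_closed[OF Y.int_pow_Units_closed] Xtilde_Units) auto
  have K: "c \<in> carrier ?Y" if "c \<in> scalars d m n" for c
    using that subringE(1)[OF Y.K_subring] by auto
  show ?case
  proof
    fix q assume "q \<in> Y.Q (Suc k)"
    then obtain q' where q': "q = inv\<^bsub>?Y\<^esub> (gY d m n k) \<otimes>\<^bsub>?Y\<^esub> q' \<otimes>\<^bsub>?Y\<^esub> gY d m n k" "q' \<in> Y.Q k"
      using Y.Q_Suc[OF Suc.hyps] by auto
    have q'': "q' \<in> addspan ?Y {c \<otimes>\<^bsub>?Y\<^esub>
      (Xtilde d m n k [^]\<^bsub>?Y\<^esub> a \<otimes>\<^bsub>?Y\<^esub> tY d m n k [^]\<^bsub>?Y\<^esub> b) |c a b.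
      c \<in> scalars d m n \<and> a \<in> exponents m \<and> b < d}" (is "_ \<in> addspan ?Y ?S")
      using Suc.IH Suc.prems q'(2) by auto
    show "q \<in> addspan ?Y {c \<otimes>\<^bsub>?Y\<^esub>
      (Xtilde d m n (Suc k) [^]\<^bsub>?Y\<^esub> a \<otimes>\<^bsub>?Y\<^esub> tY d m n (Suc k) [^]\<^bsub>?Y\<^esub> b) |c a b.
      c \<in> scalars d m n \<and> a \<in> exponents m \<and> b < d}"
      unfolding q'(1)
    proof (rule Y.addspan_sandwich[OF q'' _ cl(2,1)])
      show "?S \<subseteq> carrier ?Y"
        using x K by auto
      fix s assume "s \<in> ?S"
      then obtain c a b where s: "s = c \<otimes>\<^bsub>?Y\<^esub> (Xtilde d m n k [^]\<^bsub>?Y\<^esub> a \<otimes>\<^bsub>?Y\<^esub> tY d m n k [^]\<^bsub>?Y\<^esub> b)"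
        "c \<in> scalars d m n" "a \<in> exponents m" "b < d"
        by auto
      have "inv\<^bsub>?Y\<^esub> (gY d m n k) \<otimes>\<^bsub>?Y\<^esub> s \<otimes>\<^bsub>?Y\<^esub> gY d m n k
        = c \<otimes>\<^bsub>?Y\<^esub> (inv\<^bsub>?Y\<^esub> (gY d m n k) \<otimes>\<^bsub>?Y\<^esub>
            (Xtilde d m n k [^]\<^bsub>?Y\<^esub> a \<otimes>\<^bsub>?Y\<^esub> tY d m n k [^]\<^bsub>?Y\<^esub> b) \<otimes>\<^bsub>?Y\<^esub> gY d m n k)"
        unfolding s(1) using K[OF s(2)] x cl Y.rewrite_left[OF Y.K_central[OF s(2) cl(2), symmetric]]
        by (simp only: Y.m_assoc Y.m_closed)
      then show "inv\<^bsub>?Y\<^esub> (gY d m n k) \<otimes>\<^bsub>?Y\<^esub> s \<otimes>\<^bsub>?Y\<^esub> gY d m n k \<in> addspan ?Y {c \<otimes>\<^bsub>?Y\<^esub>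
        (Xtilde d m n (Suc k) [^]\<^bsub>?Y\<^esub> a \<otimes>\<^bsub>?Y\<^esub> tY d m n (Suc k) [^]\<^bsub>?Y\<^esub> b) |c a b.
        c \<in> scalars d m n \<and> a \<in> exponents m \<and> b < d}"
        unfolding Xtilde_t_conj[OF kn assms(3), symmetric] using s(2-4) by (auto intro!: addspan.incl)
    qed
  qed
qed

section \<open>Comparison of two Markov traces\<close>

lemma additive_eq_on_addspan:
  fixes T T' :: "'a \<Rightarrow> 'b :: ab_group_add"
  assumes "ring R" "S \<subseteq> carrier R"
    and "\<And>a b. \<lbrakk>a \<in> carrier R; b \<in> carrier R\<rbrakk> \<Longrightarrow> T (a \<oplus>\<^bsub>R\<^esub> b) = T a + T b"
    and "\<And>a b. \<lbrakk>a \<in> carrier R; b \<in> carrier R\<rbrakk> \<Longrightarrow> T' (a \<oplus>\<^bsub>R\<^esub> b) = T' a + T' b"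
    and "\<And>s. s \<in> S \<Longrightarrow> T s = T' s"
    and "y \<in> addspan R S"
  shows "T y = T' y"
  using assms(6)
proof induction
  case zero
  interpret ring R by fact
  show ?case
    using assms(3)[of "\<zero>\<^bsub>R\<^esub>" "\<zero>\<^bsub>R\<^esub>"] assms(4)[of "\<zero>\<^bsub>R\<^esub>" "\<zero>\<^bsub>R\<^esub>"] by simp
next
  case (add a b)
  then have "a \<in> carrier R" "b \<in> carrier R"
    using ring.addspan_in_carrier[OF assms(1,2)] by auto
  then show ?case
    using add assms(3,4) by simp
qed (use assms(5) in simp)

lemma markov_trace_unique:
  assumes "d > 0" "n > 0" "m > 0" "markov_trace d m n z x T" "markov_trace d m n z x T'"
    and "Z \<in> carrier (Yalg d m n)"
  shows "T Z = T' Z"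
proof -
  let ?Y = "Yalg d m n"
  interpret Y: yokonuma_relations ?Y "scalars d m n" "tY d m n" "gY d m n" "epsY d m n"
    "XY d m n" "XinvY d m n" n
    using assms by (intro Yalg_relations) simp_all
  have A_Yemb: "\<exists>u'\<in>carrier (Yalg d m k). u = Yemb d m n u'" if "u \<in> Y.A k" "k \<le> n" for u k
    using that assms(1,2) A_eq_image[of n d k m] by auto
  have T_add: "T (a \<oplus>\<^bsub>?Y\<^esub> b) = T a + T b" and T_scal: "T (to_Y d m n (scal r) \<otimes>\<^bsub>?Y\<^esub> a) = r * T a"
    and T_one: "T \<one>\<^bsub>?Y\<^esub> = 1" and T_sym: "T (a \<otimes>\<^bsub>?Y\<^esub> b) = T (b \<otimes>\<^bsub>?Y\<^esub> a)"
    and T_g: "\<lbrakk>k \<in> {1..<n}; u \<in> Y.A k\<rbrakk> \<Longrightarrow> T (gY d m n k \<otimes>\<^bsub>?Y\<^esub> u) = z * T u"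
    and T_X: "\<lbrakk>k < n; u \<in> Y.A k; c \<in> exponents m; e < d\<rbrakk> \<Longrightarrow>
      T (Xtilde d m n (Suc k) [^]\<^bsub>?Y\<^esub> c \<otimes>\<^bsub>?Y\<^esub> tY d m n (Suc k) [^]\<^bsub>?Y\<^esub> e \<otimes>\<^bsub>?Y\<^esub> u) = x c e * T u"
    if T: "markov_trace d m n z x T" and ab: "a \<in> carrier ?Y" "b \<in> carrier ?Y" "r \<in> carrier (ground_ring m)"
    for T a b r k u c e
  proof -
    have lin: "linear_map (ground_ring m) ?Y (ground_ring m) T"
      using T by (simp add: markov_trace_def)
    show "T (a \<oplus>\<^bsub>?Y\<^esub> b) = T a + T b" "T (to_Y d m n (scal r) \<otimes>\<^bsub>?Y\<^esub> a) = r * T a"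
      using lin ab by (auto simp: linear_map_def ground_ring_def Yalg_smult)
    show "T \<one>\<^bsub>?Y\<^esub> = 1" "T (a \<otimes>\<^bsub>?Y\<^esub> b) = T (b \<otimes>\<^bsub>?Y\<^esub> a)"
      using T ab by (auto simp: markov_trace_def)
    show "T (gY d m n k \<otimes>\<^bsub>?Y\<^esub> u) = z * T u" if k: "k \<in> {1..<n}" and u: "u \<in> Y.A k"
    proof -
      obtain u' where "u' \<in> carrier (Yalg d m k)" "u = Yemb d m n u'"
        using A_Yemb[OF u] k by auto
      moreover have "\<forall>k\<in>{2..n}. \<forall>u\<in>carrier (Yalg d m (k - 1)).
          T (gY d m n (k - 1) \<otimes>\<^bsub>?Y\<^esub> Yemb d m n u) = z * T (Yemb d m n u)"
        using T by (simp add: markov_trace_def)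
      from bspec[OF this, of "Suc k"] have "\<forall>u\<in>carrier (Yalg d m k).
          T (gY d m n k \<otimes>\<^bsub>?Y\<^esub> Yemb d m n u) = z * T (Yemb d m n u)"
        using k by simp
      ultimately show ?thesis by simp
    qed
    show "T (Xtilde d m n (Suc k) [^]\<^bsub>?Y\<^esub> c \<otimes>\<^bsub>?Y\<^esub> tY d m n (Suc k) [^]\<^bsub>?Y\<^esub> e \<otimes>\<^bsub>?Y\<^esub> u) = x c e * T u"
      if k: "k < n" and u: "u \<in> Y.A k" and ce: "c \<in> exponents m" "e < d"
    proof -
      obtain u' where "u' \<in> carrier (Yalg d m k)" "u = Yemb d m n u'"
        using A_Yemb[OF u] k by auto
      moreover have "\<forall>k\<in>{1..n}. \<forall>u\<in>carrier (Yalg d m (k - 1)). \<forall>a\<in>exponents m. \<forall>b<d.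
          T (Xtilde d m n k [^]\<^bsub>?Y\<^esub> a \<otimes>\<^bsub>?Y\<^esub> tY d m n k [^]\<^bsub>?Y\<^esub> b \<otimes>\<^bsub>?Y\<^esub> Yemb d m n u)
            = x a b * T (Yemb d m n u)"
        using T by (simp add: markov_trace_def)
      from bspec[OF this, of "Suc k"] have "\<forall>u\<in>carrier (Yalg d m k). \<forall>a\<in>exponents m. \<forall>b<d.
          T (Xtilde d m n (Suc k) [^]\<^bsub>?Y\<^esub> a \<otimes>\<^bsub>?Y\<^esub> tY d m n (Suc k) [^]\<^bsub>?Y\<^esub> b \<otimes>\<^bsub>?Y\<^esub> Yemb d m n u)
            = x a b * T (Yemb d m n u)"
        using k by simp
      ultimately show ?thesis using ce by simp
    qed
  qed
  have eq_on_addspan: "T y = T' y"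
    if "y \<in> addspan ?Y S" "S \<subseteq> carrier ?Y" "\<And>s. s \<in> S \<Longrightarrow> T s = T' s" for S y
    using T_add[OF assms(4) _ _ ground_one] T_add[OF assms(5) _ _ ground_one]
    by (intro additive_eq_on_addspan[OF Yalg_ring that(2) _ _ that(3,1)]) auto
  have "\<forall>y\<in>Y.A k. T y = T' y" if "k \<le> n" for k
    using that
  proof (induction k)
    case 0
    show ?case
    proof
      fix y assume "y \<in> Y.A 0"
      then obtain r where r: "y = to_Y d m n (scal r)" "r \<in> carrier (ground_ring m)"
        unfolding Y.A_0 unfolding scalars_def by auto
      \<comment> \<open>The normalisation \<open>T \<one> = 1\<close> fixes the values on
        scalars.\<close>
      have val: "T y = r" if "markov_trace d m n z x T" for T
        using T_scal[OF that Y.one_closed Y.one_closed r(2)] T_one[OF that Y.one_closed Y.one_closed r(2)]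
          to_Y_closed[OF free_alg_scal[OF r(2)], of d n] r(1) by simp
      then show "T y = T' y"
        using val[OF assms(4)] val[OF assms(5)] by simp
    qed
  next
    case (Suc k)
    then have IH: "\<And>y. y \<in> Y.A k \<Longrightarrow> T y = T' y" and kn: "k < n" "k \<le> n" and one: "1 \<le> Suc k" by auto
    note Ac = Y.A_closed[OF _ kn(2)]
    \<comment> \<open>The spanning set of \<open>Q (Suc k)\<close> consists of scalar multiples of
      exactly those products of powers whose trace against \<open>A k\<close> the third Markov
      condition prescribes.\<close>
    have QA: "T (q \<otimes>\<^bsub>?Y\<^esub> v) = T' (q \<otimes>\<^bsub>?Y\<^esub> v)" if q: "q \<in> Y.Q (Suc k)" and v: "v \<in> Y.A k" for q v
    proof -
      let ?x = "\<lambda>a b. Xtilde d m n (Suc k) [^]\<^bsub>?Y\<^esub> (a::int) \<otimes>\<^bsub>?Y\<^esub> tY d m n (Suc k) [^]\<^bsub>?Y\<^esub> (b::nat)"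
      let ?S = "{c \<otimes>\<^bsub>?Y\<^esub> ?x a b |c a b. c \<in> scalars d m n \<and> a \<in> exponents m \<and> b < d}"
      let ?S' = "{c \<otimes>\<^bsub>?Y\<^esub> (?x a b \<otimes>\<^bsub>?Y\<^esub> v) |c a b. c \<in> scalars d m n \<and> a \<in> exponents m \<and> b < d}"
      have x: "?x a b \<in> carrier ?Y" for a b
        using kn assms(1) by (intro Y.m_closed Y.nat_pow_closed Y.t_closed Y.Units_closed[OF Y.int_pow_Units_closed] Xtilde_Units) auto
      have K: "c \<in> carrier ?Y" if "c \<in> scalars d m n" for c
        using that subringE(1)[OF Y.K_subring] by auto
      have "q \<in> addspan ?Y ?S"
        using Q_subset_addspan[OF one Suc.prems assms(1,3)] q by blast
      then have "q \<otimes>\<^bsub>?Y\<^esub> v \<in> addspan ?Y ?S'"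
      proof (rule Y.addspan_rmult)
        fix s assume "s \<in> ?S"
        then obtain c a b where "s = c \<otimes>\<^bsub>?Y\<^esub> ?x a b" "c \<in> scalars d m n" "a \<in> exponents m" "b < d"
          by auto
        moreover from this have "s \<otimes>\<^bsub>?Y\<^esub> v = c \<otimes>\<^bsub>?Y\<^esub> (?x a b \<otimes>\<^bsub>?Y\<^esub> v)"
          using x K Ac[OF v] by (simp add: Y.m_assoc)
        ultimately show "s \<otimes>\<^bsub>?Y\<^esub> v \<in> addspan ?Y ?S'"
          by (auto intro!: addspan.incl)
      qed (use x K Ac[OF v] in auto)
      then show ?thesis
      proof (rule eq_on_addspan)
        show "?S' \<subseteq> carrier ?Y"
          using x K Ac[OF v] by auto
        fix s assume "s \<in> ?S'"
        then obtain r a b where s: "s = to_Y d m n (scal r) \<otimes>\<^bsub>?Y\<^esub> (?x a b \<otimes>\<^bsub>?Y\<^esub> v)"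
          "r \<in> carrier (ground_ring m)" "a \<in> exponents m" "b < d"
          by (auto simp: scalars_def)
        have xv: "?x a b \<otimes>\<^bsub>?Y\<^esub> v \<in> carrier ?Y"
          using x Ac[OF v] by simp
        show "T s = T' s"
          unfolding s(1) T_scal[OF assms(4) xv xv s(2)] T_scal[OF assms(5) xv xv s(2)]
            T_X[OF assms(4) xv xv s(2) kn(1) v s(3,4)] T_X[OF assms(5) xv xv s(2) kn(1) v s(3,4)] IH[OF v] ..
      qed
    qed
    show ?case
    proof
      fix y assume y: "y \<in> Y.A (Suc k)"
      show "T y = T' y"
      \<comment> \<open>For \<open>k = 0\<close> there is no \<open>g k\<close>, but
        \<open>Q 1\<close> is all of \<open>A 1\<close>, so \<open>QA\<close> with
        \<open>v = \<one>\<close> suffices.\<close>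
      proof (cases k)
        case 0
        then show ?thesis
          using QA[of y "\<one>\<^bsub>?Y\<^esub>"] y Y.one_in_A Y.A_closed[OF y Suc.prems] by simp
      next
        case (Suc j)
        then have k: "k \<in> {1..<n}"
          using kn by simp
        have "y \<in> Y.M k"
          using Y.A_Suc_subset_M[OF k] y by blast
        then show ?thesis
        proof (rule eq_on_addspan[OF _ Y.S_carrier[OF k]])
          fix s assume "s \<in> Y.S k"
          then consider u v where "s = u \<otimes>\<^bsub>?Y\<^esub> gY d m n k \<otimes>\<^bsub>?Y\<^esub> v" "u \<in> Y.A k" "v \<in> Y.A k"
            | q v where "s = q \<otimes>\<^bsub>?Y\<^esub> v" "q \<in> Y.Q (Suc k)" "v \<in> Y.A k"
            by (auto simp: Y.S_def)
          then show "T s = T' s"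
          proof cases
            case 1
            \<comment> \<open>Cyclicity moves \<open>u\<close> to the end, so that \<open>g\<close>
              is followed by \<open>v \<otimes> u\<close> from \<open>A k\<close>, where both traces
              agree by induction.\<close>
            have val: "T s = z * T (v \<otimes>\<^bsub>?Y\<^esub> u)" if T: "markov_trace d m n z x T" for T
            proof -
              have "T s = T (u \<otimes>\<^bsub>?Y\<^esub> (gY d m n k \<otimes>\<^bsub>?Y\<^esub> v))"
                using 1 Ac Y.g_closed[OF k] by (simp add: Y.m_assoc)
              also have "\<dots> = T (gY d m n k \<otimes>\<^bsub>?Y\<^esub> v \<otimes>\<^bsub>?Y\<^esub> u)"
                using 1 Ac Y.g_closed[OF k] by (intro T_sym[OF T _ _ ground_one]) simp_all
              also have "\<dots> = T (gY d m n k \<otimes>\<^bsub>?Y\<^esub> (v \<otimes>\<^bsub>?Y\<^esub> u))"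
                using 1 Ac Y.g_closed[OF k] by (simp add: Y.m_assoc)
              also have "\<dots> = z * T (v \<otimes>\<^bsub>?Y\<^esub> u)"
                using 1 Y.A_mult[OF _ _ kn(2)]
                by (intro T_g[OF T Y.one_closed Y.one_closed ground_one k]) simp
              finally show ?thesis .
            qed
            then show ?thesis
              using val[OF assms(4)] val[OF assms(5)] IH Y.A_mult[OF 1(3,2) kn(2)] by simp
          next
            case 2
            then show ?thesis using QA by simp
          qed
        qed
      qed
    qed
  qed
  moreover have "Z \<in> Y.A n"
    using assms A_eq_image[of n d n m] Yemb_to_Y[of n n d m] by (auto simp: Yalg_carrier image_image)
  ultimately show ?thesis by blast
qed

section \<open>The composite of a chain of relative traces\<close>

lemma Yemb_closed: "\<lbrakk>k \<le> n; u \<in> carrier (Yalg d m k)\<rbrakk> \<Longrightarrow> Yemb d m n u \<in> carrier (Yalg d m n)"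
  using subsetD[OF free_alg_mono[of k n m]] by (auto simp: Yalg_carrier Yemb_to_Y)

lemma Yemb_mult:
  assumes "k \<le> n" "u \<in> carrier (Yalg d m k)" "v \<in> carrier (Yalg d m k)"
  shows "Yemb d m n (u \<otimes>\<^bsub>Yalg d m k\<^esub> v) = Yemb d m n u \<otimes>\<^bsub>Yalg d m n\<^esub> Yemb d m n v"
proof -
  obtain f g where "u = to_Y d m k f" "v = to_Y d m k g" "f \<in> carrier (free_alg m k)" "g \<in> carrier (free_alg m k)"
    using assms by (auto simp: Yalg_carrier)
  moreover from this have "f \<in> carrier (free_alg m n)" "g \<in> carrier (free_alg m n)"
    using free_alg_mono[OF assms(1)] by auto
  ultimately show ?thesis
    using assms(1) by (simp add: Yemb_to_Y flip: to_Y_mult)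
qed

lemma Yemb_one: "k \<le> n \<Longrightarrow> Yemb d m n \<one>\<^bsub>Yalg d m k\<^esub> = \<one>\<^bsub>Yalg d m n\<^esub>"
  by (simp add: Yemb_to_Y flip: to_Y_one)

lemma Yemb_Yemb:
  "\<lbrakk>j \<le> k; k \<le> n; u \<in> carrier (Yalg d m j)\<rbrakk> \<Longrightarrow> Yemb d m n (Yemb d m k u) = Yemb d m n u"
  by (auto simp: Yalg_carrier Yemb_to_Y)

lemma Yemb_self: "u \<in> carrier (Yalg d m n) \<Longrightarrow> Yemb d m n u = u"
  by (auto simp: Yalg_carrier Yemb_to_Y)

lemma Yemb_nat_pow:
  assumes "k \<le> n" "u \<in> carrier (Yalg d m k)"
  shows "Yemb d m n (u [^]\<^bsub>Yalg d m k\<^esub> (b::nat)) = Yemb d m n u [^]\<^bsub>Yalg d m n\<^esub> b"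
proof -
  interpret ring "Yalg d m k" by (rule Yalg_ring)
  interpret N: ring "Yalg d m n" by (rule Yalg_ring)
  show ?thesis
    by (induction b) (use assms in \<open>auto simp: Yemb_one Yemb_mult\<close>)
qed

lemma Yemb_Units:
  assumes "k \<le> n" "u \<in> Units (Yalg d m k)"
  shows "Yemb d m n u \<in> Units (Yalg d m n)"
    and "Yemb d m n (inv\<^bsub>Yalg d m k\<^esub> u) = inv\<^bsub>Yalg d m n\<^esub> (Yemb d m n u)"
proof -
  interpret ring "Yalg d m k" by (rule Yalg_ring)
  interpret N: ring "Yalg d m n" by (rule Yalg_ring)
  let ?v = "inv\<^bsub>Yalg d m k\<^esub> u"
  have c: "Yemb d m n u \<in> carrier (Yalg d m n)" "Yemb d m n ?v \<in> carrier (Yalg d m n)"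
    using assms by (auto intro: Yemb_closed)
  have i: "Yemb d m n u \<otimes>\<^bsub>Yalg d m n\<^esub> Yemb d m n ?v = \<one>\<^bsub>Yalg d m n\<^esub>"
    "Yemb d m n ?v \<otimes>\<^bsub>Yalg d m n\<^esub> Yemb d m n u = \<one>\<^bsub>Yalg d m n\<^esub>"
    using assms Units_closed[OF assms(2)] Yemb_mult[OF assms(1), of u d m ?v] Yemb_mult[OF assms(1), of ?v d m u]
    by (simp_all add: Yemb_one)
  show "Yemb d m n u \<in> Units (Yalg d m n)"
    unfolding Units_def using c i by blast
  show "Yemb d m n ?v = inv\<^bsub>Yalg d m n\<^esub> (Yemb d m n u)"
    using N.inv_char[OF c i] by simp
qed

lemma Yemb_int_pow:
  assumes "k \<le> n" "u \<in> Units (Yalg d m k)"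
  shows "Yemb d m n (u [^]\<^bsub>Yalg d m k\<^esub> (a::int)) = Yemb d m n u [^]\<^bsub>Yalg d m n\<^esub> a"
proof -
  interpret ring "Yalg d m k" by (rule Yalg_ring)
  show ?thesis
    using assms Yemb_Units(2)[OF assms(1) Units_pow_closed[OF assms(2)]]
    by (simp add: int_pow_def2 Yemb_nat_pow Units_closed del: pow_nat)
qed

lemma Yemb_gens:
  assumes "k \<le> n"
  shows "Yemb d m n (tY d m k j) = tY d m n j" "Yemb d m n (gY d m k i) = gY d m n i"
    "Yemb d m n (XY d m k) = XY d m n"
  using assms by (simp_all add: tY_def gY_def XY_def Yemb_to_Y)

lemma Yemb_Xtilde:
  assumes "1 \<le> j" "j \<le> k" "k \<le> n" "d > 0"
  shows "Yemb d m n (Xtilde d m k j) = Xtilde d m n j"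
  using assms(1,2)
proof (induction j rule: nat_induct_at_least)
  case base
  then show ?case using Yemb_gens(3)[OF assms(3)] by simp
next
  case (Suc j)
  interpret Y: yokonuma_relations "Yalg d m k" "scalars d m k" "tY d m k" "gY d m k" "epsY d m k"
    "XY d m k" "XinvY d m k" k
    using Suc.prems assms(4) by (intro Yalg_relations) simp_all
  have j: "j \<in> {1..<k}"
    using Suc by simp
  note cl = Y.g_closed[OF j] Y.g_inv_closed[OF j]
  have X: "Xtilde d m k j \<in> carrier (Yalg d m k)"
    using Xtilde_Units[of j k d m] j assms(4) by (intro Y.Units_closed) simp
  show ?case
    unfolding Xtilde_Suc[OF Suc.hyps]
    using Suc j X cl assms(3) by (simp add: Yemb_mult Yemb_Units(2)[OF assms(3) Y.g_inverse(1)[OF j]] Yemb_gens)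
qed

lemma
  fixes a :: int and b :: nat
  assumes "1 \<le> k" "k \<le> n" "d > 0"
  shows Xtilde_t_closed:
      "Xtilde d m k k [^]\<^bsub>Yalg d m k\<^esub> a \<otimes>\<^bsub>Yalg d m k\<^esub> tY d m k k [^]\<^bsub>Yalg d m k\<^esub> b \<in> carrier (Yalg d m k)"
    and Yemb_Xtilde_t:
      "Yemb d m n (Xtilde d m k k [^]\<^bsub>Yalg d m k\<^esub> a \<otimes>\<^bsub>Yalg d m k\<^esub> tY d m k k [^]\<^bsub>Yalg d m k\<^esub> b)
        = Xtilde d m n k [^]\<^bsub>Yalg d m n\<^esub> a \<otimes>\<^bsub>Yalg d m n\<^esub> tY d m n k [^]\<^bsub>Yalg d m n\<^esub> b"
proof -
  interpret K: ring "Yalg d m k" by (rule Yalg_ring)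
  have X: "Xtilde d m k k \<in> Units (Yalg d m k)"
    using assms by (intro Xtilde_Units) simp_all
  have Xa: "Xtilde d m k k [^]\<^bsub>Yalg d m k\<^esub> a \<in> carrier (Yalg d m k)"
    by (rule K.Units_closed[OF K.int_pow_Units_closed[OF X]])
  have t: "tY d m k k \<in> carrier (Yalg d m k)"
    using assms(1) by (auto simp: tY_def generators_iff intro!: free_alg_gen)
  show "Xtilde d m k k [^]\<^bsub>Yalg d m k\<^esub> a \<otimes>\<^bsub>Yalg d m k\<^esub> tY d m k k [^]\<^bsub>Yalg d m k\<^esub> b \<in> carrier (Yalg d m k)"
    by (intro K.m_closed K.nat_pow_closed Xa t)
  show "Yemb d m n (Xtilde d m k k [^]\<^bsub>Yalg d m k\<^esub> a \<otimes>\<^bsub>Yalg d m k\<^esub> tY d m k k [^]\<^bsub>Yalg d m k\<^esub> b)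
        = Xtilde d m n k [^]\<^bsub>Yalg d m n\<^esub> a \<otimes>\<^bsub>Yalg d m n\<^esub> tY d m n k [^]\<^bsub>Yalg d m n\<^esub> b"
    unfolding Yemb_mult[OF assms(2) Xa K.nat_pow_closed[OF t]] Yemb_int_pow[OF assms(2) X]
      Yemb_nat_pow[OF assms(2) t] Yemb_Xtilde[OF assms(1) order.refl assms(2,3)] Yemb_gens[OF assms(2)] ..
qed

section \<open>Ranks zero and one\<close>

lemma Yalg_0_scalar:
  assumes "u \<in> carrier (Yalg d m 0)"
  shows "\<exists>r\<in>carrier (ground_ring m). u = to_Y d m 0 (scal r)"
proof -
  obtain f where f: "f \<in> carrier (free_alg m 0)" "u = to_Y d m 0 f"
    using assms by (auto simp: Yalg_carrier)
  have "\<exists>r\<in>carrier (ground_ring m). f = scal r"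
    using f(1)
  proof (induction rule: free_alg_induct)
    case (add f g)
    then show ?case using ground_add scal_add by metis
  next
    case (mult f g)
    then show ?case using ground_mult scal_mult by metis
  qed (auto simp: generators_def)
  then show ?thesis using f(2) by auto
qed

text \<open>At rank 0 there are no relations, so the ideal is zero and scalars embed injectively;
  this makes \<open>the_inv_into\<close> a genuine inverse.\<close>

lemma to_ground_scalar:
  assumes "r \<in> carrier (ground_ring m)"
  shows "to_ground d m (to_Y d m 0 (scal r)) = r"
proof -
  interpret F: ring "free_alg m 0" by (rule free_alg_ring)
  have no_rel: "\<not> Y_relation d m 0 f g" for f g
    by (auto elim: Y_relation.cases)
  have "rel_ideal d m 0 \<subseteq> {0}"
    unfolding rel_ideal_def using F.genideal_minimal[OF F.zeroideal] no_rel by simp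
  then have "inj_on (\<lambda>r. to_Y d m 0 (scal r)) (carrier (ground_ring m))"
  proof (intro inj_onI)
    fix r s assume "to_Y d m 0 (scal r) = to_Y d m 0 (scal s)"
    then have "scal r - scal s \<in> {0}"
      using \<open>rel_ideal d m 0 \<subseteq> {0}\<close> by (auto simp: to_Y_eq_iff)
    then show "r = s" by (simp add: scal_def) (metis lookup_single_eq)
  qed
  then have "inj_on (\<lambda>r. r \<odot>\<^bsub>Yalg d m 0\<^esub> \<one>\<^bsub>Yalg d m 0\<^esub>) (carrier (ground_ring m))"
    by (rule inj_on_cong[THEN iffD1, rotated]) (simp add: Yalg_smult_one)
  then show ?thesis
    unfolding to_ground_def using the_inv_into_f_f[OF _ assms] Yalg_smult_one[OF assms] by metis
qed

lemma Yalg_scalar_central: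
  assumes "r \<in> carrier (ground_ring m)" "u \<in> carrier (Yalg d m n)"
  shows "u \<otimes>\<^bsub>Yalg d m n\<^esub> to_Y d m n (scal r) = to_Y d m n (scal r) \<otimes>\<^bsub>Yalg d m n\<^esub> u"
proof -
  obtain f where "u = to_Y d m n f" "f \<in> carrier (free_alg m n)"
    using assms(2) by (auto simp: Yalg_carrier)
  then show ?thesis
    using to_Y_mult[of "scal r" m n f d] to_Y_mult[of f m n "scal r" d] scal_commute[of r f] assms(1)
    by (simp add: free_alg_scal)
qed

text \<open>Rank one has no \<open>g\<close>, and its remaining generators commute pairwise. This
  starts the induction for cyclicity, which the chain conditions address only from rank two
  on.\<close>

lemma Yalg_1_commute:
  assumes "d > 0" "u \<in> carrier (Yalg d m 1)" "v \<in> carrier (Yalg d m 1)"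
  shows "u \<otimes>\<^bsub>Yalg d m 1\<^esub> v = v \<otimes>\<^bsub>Yalg d m 1\<^esub> u"
proof -
  interpret Y: yokonuma_relations "Yalg d m 1" "scalars d m 1" "tY d m 1" "gY d m 1" "epsY d m 1"
    "XY d m 1" "XinvY d m 1" 1
    using assms(1) by (intro Yalg_relations) simp_all
  have A1: "carrier (Yalg d m 1) = Y.A 1"
    using A_eq_image[OF order.refl assms(1) order.refl] by (force simp: Yemb_self)
  have t1: "tY d m 1 1 \<in> carrier (Yalg d m 1)"
    by (rule Y.t_closed) simp
  have X: "XY d m 1 \<otimes>\<^bsub>Yalg d m 1\<^esub> w = w \<otimes>\<^bsub>Yalg d m 1\<^esub> XY d m 1" if "w \<in> Y.A 1" for w
  proof (rule Y.generate_ring_commute[OF that[unfolded Y.A_def] Y.gens_carrier[OF order.refl] Y.X_closed])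
    fix h assume "h \<in> Y.gens 1"
    then have "h \<in> scalars d m 1 \<or> h = tY d m 1 1 \<or> h = XY d m 1 \<or> h = XinvY d m 1"
      unfolding Y.gens_def by auto
    then show "XY d m 1 \<otimes>\<^bsub>Yalg d m 1\<^esub> h = h \<otimes>\<^bsub>Yalg d m 1\<^esub> XY d m 1"
      using Y.K_central[OF _ Y.X_closed, of h] Y.Xt_comm[of 1] Y.XY_one Y.YX_one by auto
  qed
  have u: "u \<in> Y.A 1" and v: "v \<in> Y.A 1"
    using assms A1 by auto
  show ?thesis
  proof (rule Y.generate_ring_commute[OF v[unfolded Y.A_def] Y.gens_carrier[OF order.refl] assms(2)])
    fix h assume "h \<in> Y.gens 1"
    then have "h \<in> scalars d m 1 \<or> h = tY d m 1 1 \<or> h = XY d m 1 \<or> h = XinvY d m 1"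
      unfolding Y.gens_def by auto
    then show "u \<otimes>\<^bsub>Yalg d m 1\<^esub> h = h \<otimes>\<^bsub>Yalg d m 1\<^esub> u"
      using Y.K_central[of h u] Y.t1_comm_A1[OF u, of 1] X[OF u] Y.Y_comm[OF X[OF u]] assms(2) by auto
  qed
qed

locale trace_chain =
  fixes d :: nat and m :: enat and z :: laurent and x :: "int \<Rightarrow> nat \<Rightarrow> laurent"
    and tr :: "nat \<Rightarrow> fpoly set \<Rightarrow> fpoly set"
  assumes d_pos: "d > 0" and m_pos: "m > 0"
    and z_ground: "z \<in> carrier (ground_ring m)"
    and x_ground: "\<lbrakk>a \<in> exponents m; b < d\<rbrakk> \<Longrightarrow> x a b \<in> carrier (ground_ring m)"
    and x_00: "x 0 0 = 1"
    and chain: "relative_trace_chain d m z x tr"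
begin

abbreviation I :: "nat \<Rightarrow> fpoly set \<Rightarrow> fpoly set" where
  "I \<equiv> iterated_trace tr"

section \<open>Properties of the individual relative traces\<close>

lemma linear: "linear_map (ground_ring m) (Yalg d m (Suc k)) (Yalg d m k) (tr (Suc k))"
proof -
  have "\<forall>k\<ge>1. linear_map (ground_ring m) (Yalg d m k) (Yalg d m (k - 1)) (tr k)"
    using chain by (simp add: relative_trace_chain_def)
  from this[rule_format, of "Suc k"] show ?thesis by simp
qed

lemma tr_closed: "Z \<in> carrier (Yalg d m (Suc k)) \<Longrightarrow> tr (Suc k) Z \<in> carrier (Yalg d m k)"
  using linear[of k] by (auto simp: linear_map_def)

lemma tr_add:
  "\<lbrakk>Z \<in> carrier (Yalg d m (Suc k)); W \<in> carrier (Yalg d m (Suc k))\<rbrakk>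
    \<Longrightarrow> tr (Suc k) (Z \<oplus>\<^bsub>Yalg d m (Suc k)\<^esub> W) = tr (Suc k) Z \<oplus>\<^bsub>Yalg d m k\<^esub> tr (Suc k) W"
  using linear[of k] by (simp add: linear_map_def)

lemma tr_scal:
  "\<lbrakk>r \<in> carrier (ground_ring m); Z \<in> carrier (Yalg d m (Suc k))\<rbrakk>
    \<Longrightarrow> tr (Suc k) (to_Y d m (Suc k) (scal r) \<otimes>\<^bsub>Yalg d m (Suc k)\<^esub> Z) = to_Y d m k (scal r) \<otimes>\<^bsub>Yalg d m k\<^esub> tr (Suc k) Z"
  using linear[of k] by (simp add: linear_map_def Yalg_smult)

lemma
  assumes "k \<ge> 1"
  shows tr_bimodule: "\<lbrakk>u \<in> carrier (Yalg d m k); v \<in> carrier (Yalg d m k); Z \<in> carrier (Yalg d m (Suc k))\<rbrakk> \<Longrightarrow>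
      tr (Suc k) (Yemb d m (Suc k) u \<otimes>\<^bsub>Yalg d m (Suc k)\<^esub> Z \<otimes>\<^bsub>Yalg d m (Suc k)\<^esub> Yemb d m (Suc k) v)
        = u \<otimes>\<^bsub>Yalg d m k\<^esub> tr (Suc k) Z \<otimes>\<^bsub>Yalg d m k\<^esub> v" (is "\<lbrakk>_; _; _\<rbrakk> \<Longrightarrow> ?bimod u v Z")
    and tr_conj: "\<lbrakk>u \<in> carrier (Yalg d m k); \<epsilon> \<in> {1, - 1}\<rbrakk> \<Longrightarrow>
      tr (Suc k) (gY d m (Suc k) k [^]\<^bsub>Yalg d m (Suc k)\<^esub> (\<epsilon>::int) \<otimes>\<^bsub>Yalg d m (Suc k)\<^esub> Yemb d m (Suc k) u
        \<otimes>\<^bsub>Yalg d m (Suc k)\<^esub> gY d m (Suc k) k [^]\<^bsub>Yalg d m (Suc k)\<^esub> (- \<epsilon>)) = Yemb d m k (tr k u)"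
    and tr_tr_g: "Z \<in> carrier (Yalg d m (Suc k)) \<Longrightarrow>
      tr k (tr (Suc k) (gY d m (Suc k) k \<otimes>\<^bsub>Yalg d m (Suc k)\<^esub> Z))
        = tr k (tr (Suc k) (Z \<otimes>\<^bsub>Yalg d m (Suc k)\<^esub> gY d m (Suc k) k))"
    and tr_g: "tr (Suc k) (gY d m (Suc k) k) = to_Y d m k (scal z)"
proof -
  note c = chain[unfolded relative_trace_chain_def, THEN conjunct2, THEN conjunct2, rule_format, of "Suc k"]
  have 2: "2 \<le> Suc k"
    using assms by simp
  note c = c[OF 2, unfolded diff_Suc_1]
  show "?bimod u v Z" if "u \<in> carrier (Yalg d m k)" "v \<in> carrier (Yalg d m k)" "Z \<in> carrier (Yalg d m (Suc k))"
    using conjunct1[OF c] that by blast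
  show "tr (Suc k) (gY d m (Suc k) k [^]\<^bsub>Yalg d m (Suc k)\<^esub> (\<epsilon>::int) \<otimes>\<^bsub>Yalg d m (Suc k)\<^esub> Yemb d m (Suc k) u
        \<otimes>\<^bsub>Yalg d m (Suc k)\<^esub> gY d m (Suc k) k [^]\<^bsub>Yalg d m (Suc k)\<^esub> (- \<epsilon>)) = Yemb d m k (tr k u)"
    if "u \<in> carrier (Yalg d m k)" "\<epsilon> \<in> {1, - 1}"
    using conjunct1[OF conjunct2[OF c]] that by blast
  show "tr k (tr (Suc k) (gY d m (Suc k) k \<otimes>\<^bsub>Yalg d m (Suc k)\<^esub> Z))
        = tr k (tr (Suc k) (Z \<otimes>\<^bsub>Yalg d m (Suc k)\<^esub> gY d m (Suc k) k))" if "Z \<in> carrier (Yalg d m (Suc k))"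
    using conjunct1[OF conjunct2[OF conjunct2[OF c]]] that by blast
  show "tr (Suc k) (gY d m (Suc k) k) = to_Y d m k (scal z)"
    using conjunct2[OF conjunct2[OF conjunct2[OF c]]] by (simp add: Yalg_smult_one z_ground)
qed

lemma tr_1:
  assumes "a \<in> exponents m" "b < d"
  shows "tr 1 (XY d m 1 [^]\<^bsub>Yalg d m 1\<^esub> a \<otimes>\<^bsub>Yalg d m 1\<^esub> tY d m 1 1 [^]\<^bsub>Yalg d m 1\<^esub> b) = to_Y d m 0 (scal (x a b))"
  using chain assms by (simp add: relative_trace_chain_def Yalg_smult_one x_ground)

text \<open>The bimodule condition of a chain starts with \<open>tr 2\<close>. For
  \<open>tr 1\<close> the algebra below consists of scalars, and linearity takes its place.\<close>

lemma tr_lmult: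
  assumes "u \<in> carrier (Yalg d m k)" "Z \<in> carrier (Yalg d m (Suc k))"
  shows "tr (Suc k) (Yemb d m (Suc k) u \<otimes>\<^bsub>Yalg d m (Suc k)\<^esub> Z) = u \<otimes>\<^bsub>Yalg d m k\<^esub> tr (Suc k) Z"
proof (cases "k = 0")
  case True
  then obtain r where "u = to_Y d m 0 (scal r)" "r \<in> carrier (ground_ring m)"
    using assms(1) Yalg_0_scalar by blast
  then show ?thesis
    using tr_scal[of r Z k] assms(2) True by (simp add: Yemb_to_Y)
next
  case False
  interpret ring "Yalg d m k" by (rule Yalg_ring)
  interpret N: ring "Yalg d m (Suc k)" by (rule Yalg_ring)
  show ?thesis
    using tr_bimodule[of k u "\<one>\<^bsub>Yalg d m k\<^esub>" Z] False assms Yemb_closed[of k "Suc k" u d m] tr_closed[OF assms(2)]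
    by (simp add: Yemb_one)
qed

lemma tr_rmult:
  assumes "u \<in> carrier (Yalg d m k)" "Z \<in> carrier (Yalg d m (Suc k))"
  shows "tr (Suc k) (Z \<otimes>\<^bsub>Yalg d m (Suc k)\<^esub> Yemb d m (Suc k) u) = tr (Suc k) Z \<otimes>\<^bsub>Yalg d m k\<^esub> u"
proof (cases "k = 0")
  case True
  then obtain r where r: "u = to_Y d m k (scal r)" "r \<in> carrier (ground_ring m)"
    using assms(1) Yalg_0_scalar by blast
  then show ?thesis
    using tr_scal[OF r(2) assms(2)] Yalg_scalar_central[OF r(2) assms(2)]
      Yalg_scalar_central[OF r(2) tr_closed[OF assms(2)]] by (simp add: Yemb_to_Y)
next
  case False
  interpret ring "Yalg d m k" by (rule Yalg_ring)
  interpret N: ring "Yalg d m (Suc k)" by (rule Yalg_ring)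
  show ?thesis
    using tr_bimodule[of k "\<one>\<^bsub>Yalg d m k\<^esub>" u Z] False assms Yemb_closed[of k "Suc k" u d m] tr_closed[OF assms(2)]
    by (simp add: Yemb_one)
qed

text \<open>\<open>x 0 0 = 1\<close> is the case of \<open>tr 1\<close>. In higher rank
  \<open>\<one>\<close> is written as \<open>g\<close> times \<open>\<one>\<close> times the inverse
  of \<open>g\<close>, and the conjugation condition passes to the rank below.\<close>

lemma tr_one: "tr (Suc k) \<one>\<^bsub>Yalg d m (Suc k)\<^esub> = \<one>\<^bsub>Yalg d m k\<^esub>"
proof (induction k)
  case 0
  interpret ring "Yalg d m (Suc 0)" by (rule Yalg_ring)
  have "0 \<in> exponents m"
    using m_pos by (auto simp: exponents_def zero_enat_def split: enat.split)
  then show ?case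
    using tr_1[of 0 0] d_pos x_00 by (simp add: to_Y_one)
next
  case (Suc k)
  interpret Y: yokonuma_relations "Yalg d m (Suc (Suc k))" "scalars d m (Suc (Suc k))" "tY d m (Suc (Suc k))"
    "gY d m (Suc (Suc k))" "epsY d m (Suc (Suc k))" "XY d m (Suc (Suc k))" "XinvY d m (Suc (Suc k))" "Suc (Suc k)"
    using d_pos by (intro Yalg_relations) simp_all
  interpret ring "Yalg d m (Suc k)" by (rule Yalg_ring)
  have U: "gY d m (Suc (Suc k)) (Suc k) \<in> Units (Yalg d m (Suc (Suc k)))"
    by (rule Y.g_inverse) simp
  have "gY d m (Suc (Suc k)) (Suc k) [^]\<^bsub>Yalg d m (Suc (Suc k))\<^esub> (1::int)
      \<otimes>\<^bsub>Yalg d m (Suc (Suc k))\<^esub> gY d m (Suc (Suc k)) (Suc k) [^]\<^bsub>Yalg d m (Suc (Suc k))\<^esub> (- 1::int)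
      = \<one>\<^bsub>Yalg d m (Suc (Suc k))\<^esub>"
    using Y.int_pow_Units_add[OF U, of 1 "- 1"] by simp
  then show ?case
    using tr_conj[of "Suc k" "\<one>\<^bsub>Yalg d m (Suc k)\<^esub>" 1] Suc Y.Units_closed[OF Y.int_pow_Units_closed[OF U]]
    by (simp add: Yemb_one)
qed

lemma tr_Yemb: "u \<in> carrier (Yalg d m k) \<Longrightarrow> tr (Suc k) (Yemb d m (Suc k) u) = u"
proof -
  assume u: "u \<in> carrier (Yalg d m k)"
  interpret ring "Yalg d m k" by (rule Yalg_ring)
  interpret N: ring "Yalg d m (Suc k)" by (rule Yalg_ring)
  show ?thesis
    using tr_lmult[OF u N.one_closed] u Yemb_closed[of k "Suc k" u d m] by (simp add: tr_one)
qed

text \<open>Conjugating down one rank at a time reduces to the prescribed values of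
  \<open>tr 1\<close>; these are scalars and survive every embedding on the way back.\<close>

lemma tr_Xtilde:
  assumes "a \<in> exponents m" "b < d"
  shows "tr (Suc k) (Xtilde d m (Suc k) (Suc k) [^]\<^bsub>Yalg d m (Suc k)\<^esub> a \<otimes>\<^bsub>Yalg d m (Suc k)\<^esub>
    tY d m (Suc k) (Suc k) [^]\<^bsub>Yalg d m (Suc k)\<^esub> b) = to_Y d m k (scal (x a b))"
proof (induction k)
  case 0
  then show ?case using tr_1[OF assms] by simp
next
  case (Suc k)
  let ?K = "Suc k" and ?N = "Suc (Suc k)"
  interpret Y: yokonuma_relations "Yalg d m ?N" "scalars d m ?N" "tY d m ?N"
    "gY d m ?N" "epsY d m ?N" "XY d m ?N" "XinvY d m ?N" ?N
    using d_pos by (intro Yalg_relations) simp_all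
  have k: "?K \<in> {1..<?N}" by simp
  note U = Y.g_inverse(1)[OF k]
  let ?w = "Xtilde d m ?K ?K [^]\<^bsub>Yalg d m ?K\<^esub> a \<otimes>\<^bsub>Yalg d m ?K\<^esub> tY d m ?K ?K [^]\<^bsub>Yalg d m ?K\<^esub> b"
  have w: "?w \<in> carrier (Yalg d m ?K)"
    by (rule Xtilde_t_closed[OF _ order.refl d_pos]) simp
  have Yemb_w: "Yemb d m ?N ?w
      = Xtilde d m ?N ?K [^]\<^bsub>Yalg d m ?N\<^esub> a \<otimes>\<^bsub>Yalg d m ?N\<^esub> tY d m ?N ?K [^]\<^bsub>Yalg d m ?N\<^esub> b"
    by (rule Yemb_Xtilde_t[OF _ _ d_pos]) simp_all
  \<comment> \<open>The exponents are spelled to match the conjugation condition for the sign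
    -1.\<close>
  have conj: "Xtilde d m ?N ?N [^]\<^bsub>Yalg d m ?N\<^esub> a \<otimes>\<^bsub>Yalg d m ?N\<^esub> tY d m ?N ?N [^]\<^bsub>Yalg d m ?N\<^esub> b
      = gY d m ?N ?K [^]\<^bsub>Yalg d m ?N\<^esub> (- 1::int) \<otimes>\<^bsub>Yalg d m ?N\<^esub> Yemb d m ?N ?w
        \<otimes>\<^bsub>Yalg d m ?N\<^esub> gY d m ?N ?K [^]\<^bsub>Yalg d m ?N\<^esub> (- (- 1)::int)"
    by (simp only: Xtilde_t_conj[OF k d_pos] Yemb_w minus_minus Y.int_pow_Units_neg_one[OF U]
        Y.int_pow_1[OF Y.Units_closed[OF U]])
  have "tr ?N (Xtilde d m ?N ?N [^]\<^bsub>Yalg d m ?N\<^esub> a \<otimes>\<^bsub>Yalg d m ?N\<^esub> tY d m ?N ?N [^]\<^bsub>Yalg d m ?N\<^esub> b)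
      = Yemb d m ?K (tr ?K ?w)"
    unfolding conj by (rule tr_conj[OF _ w]) simp_all
  also have "\<dots> = to_Y d m ?K (scal (x a b))"
    unfolding Suc.IH by (rule Yemb_to_Y) simp
  finally show ?case .
qed

section \<open>The composite of the relative traces\<close>

lemma I_closed: "Z \<in> carrier (Yalg d m n) \<Longrightarrow> I n Z \<in> carrier (Yalg d m 0)"
  by (induction n arbitrary: Z) (simp_all add: tr_closed)

lemma I_add:
  "\<lbrakk>Z \<in> carrier (Yalg d m n); W \<in> carrier (Yalg d m n)\<rbrakk>
    \<Longrightarrow> I n (Z \<oplus>\<^bsub>Yalg d m n\<^esub> W) = I n Z \<oplus>\<^bsub>Yalg d m 0\<^esub> I n W"
  by (induction n arbitrary: Z W) (simp_all add: tr_closed tr_add)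

lemma I_scal:
  "\<lbrakk>r \<in> carrier (ground_ring m); Z \<in> carrier (Yalg d m n)\<rbrakk>
    \<Longrightarrow> I n (to_Y d m n (scal r) \<otimes>\<^bsub>Yalg d m n\<^esub> Z) = to_Y d m 0 (scal r) \<otimes>\<^bsub>Yalg d m 0\<^esub> I n Z"
  by (induction n arbitrary: Z) (simp_all add: tr_closed tr_scal)

lemma I_Yemb:
  assumes "k \<le> n" "u \<in> carrier (Yalg d m k)"
  shows "I n (Yemb d m n u) = I k u"
  using assms(1)
proof (induction n rule: dec_induct)
  case base
  then show ?case using Yemb_self[OF assms(2)] by simp
next
  case (step n)
  then have "Yemb d m (Suc n) u = Yemb d m (Suc n) (Yemb d m n u)"
    using Yemb_Yemb[of k n "Suc n" u d m] assms by simp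
  then show ?case
    using step tr_Yemb[OF Yemb_closed[OF _ assms(2)]] by simp
qed

text \<open>Generators of rank \<open>k\<close> pass out of \<open>tr (Suc k)\<close> by the
  bimodule property and are handled by \<open>IH\<close>; \<open>g k\<close> is covered by a chain
  condition. The only other new generator is \<open>t (Suc k)\<close>, a conjugate of
  \<open>t k\<close> by \<open>g k\<close>, since \<open>X\<close> and its inverse already occur at
  rank one.\<close>

lemma I_Suc_gens_symmetric:
  assumes "k \<ge> 1"
    and IH: "\<And>u v. \<lbrakk>u \<in> carrier (Yalg d m k); v \<in> carrier (Yalg d m k)\<rbrakk>
      \<Longrightarrow> I k (u \<otimes>\<^bsub>Yalg d m k\<^esub> v) = I k (v \<otimes>\<^bsub>Yalg d m k\<^esub> u)"
    and a: "a \<in> generators (Suc k)" and Z: "Z \<in> carrier (Yalg d m (Suc k))"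
  shows "I (Suc k) (Z \<otimes>\<^bsub>Yalg d m (Suc k)\<^esub> to_Y d m (Suc k) (gen a))
    = I (Suc k) (to_Y d m (Suc k) (gen a) \<otimes>\<^bsub>Yalg d m (Suc k)\<^esub> Z)"
proof -
  let ?Y = "Yalg d m (Suc k)"
  interpret Y: yokonuma_relations ?Y "scalars d m (Suc k)" "tY d m (Suc k)"
    "gY d m (Suc k)" "epsY d m (Suc k)" "XY d m (Suc k)" "XinvY d m (Suc k)" "Suc k"
    using d_pos by (intro Yalg_relations) simp_all
  have k: "k \<in> {1..<Suc k}"
    using assms(1) by simp
  have emb: "I (Suc k) (Z \<otimes>\<^bsub>?Y\<^esub> Yemb d m (Suc k) u) = I (Suc k) (Yemb d m (Suc k) u \<otimes>\<^bsub>?Y\<^esub> Z)"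
    if "u \<in> carrier (Yalg d m k)" "Z \<in> carrier ?Y" for u Z
    using that IH[OF that(1) tr_closed[OF that(2)]] by (simp add: tr_lmult tr_rmult)
  \<comment> \<open>The chain condition holds after two traces, so \<open>I (Suc k)\<close> is
    unfolded twice, which is possible as \<open>k \<ge> 1\<close>.\<close>
  have g: "I (Suc k) (Z \<otimes>\<^bsub>?Y\<^esub> gY d m (Suc k) k) = I (Suc k) (gY d m (Suc k) k \<otimes>\<^bsub>?Y\<^esub> Z)"
    if "Z \<in> carrier ?Y" for Z
    using tr_tr_g[OF assms(1) that] assms(1) by (cases k) simp_all
  from a consider "a \<in> generators k" | "a = GL k" | "a = TL (Suc k)"
    using assms(1) by (auto simp: generators_def le_Suc_eq less_Suc_eq)
  then show ?thesis
  proof cases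
    case 1
    then have "to_Y d m k (gen a) \<in> carrier (Yalg d m k)"
      by (intro to_Y_closed free_alg_gen)
    from emb[OF this Z] show ?thesis
      by (simp add: Yemb_to_Y)
  next
    case 2
    then show ?thesis using g[OF Z] by (simp add: gY_def)
  next
    case 3
    let ?g = "gY d m (Suc k) k" and ?t = "tY d m (Suc k) k" and ?t' = "tY d m (Suc k) (Suc k)"
    note U = Y.g_inverse(1)[OF k]
    have t: "?t \<in> carrier ?Y" "?t' \<in> carrier ?Y"
      using assms(1) by (auto intro: Y.t_closed)
    note cl = Y.g_closed[OF k] Y.g_inv_closed[OF k] t Z
    have "?t \<otimes>\<^bsub>?Y\<^esub> ?g = ?g \<otimes>\<^bsub>?Y\<^esub> ?t'"
      using Y.tg_comm[of k k] assms(1) by simp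
    then have t': "?t' = inv\<^bsub>?Y\<^esub> ?g \<otimes>\<^bsub>?Y\<^esub> (?t \<otimes>\<^bsub>?Y\<^esub> ?g)"
      using cl U by (simp add: Y.Units_cancel_left)
    have "tY d m k k \<in> carrier (Yalg d m k)"
      using assms(1) by (auto simp: tY_def generators_iff intro!: to_Y_closed free_alg_gen)
    from emb[OF this] have tk: "I (Suc k) (W \<otimes>\<^bsub>?Y\<^esub> ?t) = I (Suc k) (?t \<otimes>\<^bsub>?Y\<^esub> W)" if "W \<in> carrier ?Y" for W
      using that by (simp add: Yemb_gens)
    \<comment> \<open>With \<open>?t'\<close> written as the conjugate of \<open>?t\<close>, the
      factors \<open>?g\<close> and \<open>?t\<close> are rotated to the front one at a time; there
      they become \<open>?g \<otimes> ?t'\<close>, and rotating \<open>?g\<close> back cancels its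
      inverse.\<close>
    have "I (Suc k) (Z \<otimes>\<^bsub>?Y\<^esub> ?t') = I (Suc k) ((Z \<otimes>\<^bsub>?Y\<^esub> inv\<^bsub>?Y\<^esub> ?g \<otimes>\<^bsub>?Y\<^esub> ?t) \<otimes>\<^bsub>?Y\<^esub> ?g)"
      unfolding t' using cl by (simp add: Y.m_assoc)
    also have "\<dots> = I (Suc k) ((?g \<otimes>\<^bsub>?Y\<^esub> Z \<otimes>\<^bsub>?Y\<^esub> inv\<^bsub>?Y\<^esub> ?g) \<otimes>\<^bsub>?Y\<^esub> ?t)"
      using cl by (subst g) (simp_all add: Y.m_assoc)
    also have "\<dots> = I (Suc k) (?t \<otimes>\<^bsub>?Y\<^esub> ?g \<otimes>\<^bsub>?Y\<^esub> (Z \<otimes>\<^bsub>?Y\<^esub> inv\<^bsub>?Y\<^esub> ?g))"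
      using cl by (subst tk) (simp_all add: Y.m_assoc)
    also have "\<dots> = I (Suc k) (?g \<otimes>\<^bsub>?Y\<^esub> (?t' \<otimes>\<^bsub>?Y\<^esub> Z \<otimes>\<^bsub>?Y\<^esub> inv\<^bsub>?Y\<^esub> ?g))"
      unfolding \<open>?t \<otimes>\<^bsub>?Y\<^esub> ?g = ?g \<otimes>\<^bsub>?Y\<^esub> ?t'\<close> using cl by (simp add: Y.m_assoc)
    also have "\<dots> = I (Suc k) (?t' \<otimes>\<^bsub>?Y\<^esub> Z \<otimes>\<^bsub>?Y\<^esub> inv\<^bsub>?Y\<^esub> ?g \<otimes>\<^bsub>?Y\<^esub> ?g)"
      using cl by (subst g) simp_all
    also have "\<dots> = I (Suc k) (?t' \<otimes>\<^bsub>?Y\<^esub> Z)"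
      using cl U by (simp add: Y.m_assoc)
    finally show ?thesis
      by (simp add: 3 tY_def)
  qed
qed

text \<open>The elements that are cyclic against every \<open>Z\<close> are closed under sums and
  products, so the generators suffice.\<close>

lemma I_symmetric:
  assumes "Z \<in> carrier (Yalg d m n)" "W \<in> carrier (Yalg d m n)"
  shows "I n (Z \<otimes>\<^bsub>Yalg d m n\<^esub> W) = I n (W \<otimes>\<^bsub>Yalg d m n\<^esub> Z)"
  using assms
proof (induction n arbitrary: Z W)
  case 0
  then obtain r where "W = to_Y d m 0 (scal r)" "r \<in> carrier (ground_ring m)"
    using Yalg_0_scalar by blast
  then show ?case
    using Yalg_scalar_central[of r m Z d 0] 0 by simp
next
  case (Suc k)
  show ?case
  proof (cases "k = 0")
    case True
    then show ?thesis
      using Yalg_1_commute[OF d_pos] Suc.prems by simp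
  next
    case False
    let ?N = "Suc k"
    interpret ring "Yalg d m ?N" by (rule Yalg_ring)
    obtain f where f: "W = to_Y d m ?N f" "f \<in> carrier (free_alg m ?N)"
      using Suc.prems(2) by (auto simp: Yalg_carrier)
    \<comment> \<open>\<open>Z\<close> is quantified inside the induction because a product
      \<open>f * g\<close> uses the hypotheses at \<open>Z\<close> times \<open>f\<close> and at
      \<open>g\<close> times \<open>Z\<close>.\<close>
    have "\<forall>Z\<in>carrier (Yalg d m ?N). I ?N (Z \<otimes>\<^bsub>Yalg d m ?N\<^esub> to_Y d m ?N f) = I ?N (to_Y d m ?N f \<otimes>\<^bsub>Yalg d m ?N\<^esub> Z)"
      using f(2)
    proof (induction rule: free_alg_induct)
      case (scal r)
      then show ?case using Yalg_scalar_central by simp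
    next
      case (gen a)
      then show ?case
        using I_Suc_gens_symmetric[OF _ Suc.IH] False by simp
    next
      case (add f g)
      then show ?case
        by (simp add: to_Y_add l_distr r_distr I_add del: iterated_trace.simps)
    next
      case (mult f g)
      note cl = to_Y_closed[OF mult.hyps(1), where d = d] to_Y_closed[OF mult.hyps(2), where d = d]
      show ?case
      proof
        fix Z assume Z: "Z \<in> carrier (Yalg d m ?N)"
        let ?F = "to_Y d m ?N f" and ?G = "to_Y d m ?N g"
        have "I ?N (Z \<otimes>\<^bsub>Yalg d m ?N\<^esub> to_Y d m ?N (f * g)) = I ?N ((Z \<otimes>\<^bsub>Yalg d m ?N\<^esub> ?F) \<otimes>\<^bsub>Yalg d m ?N\<^esub> ?G)"
          using cl Z mult.hyps by (simp add: to_Y_mult m_assoc)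
        also have "\<dots> = I ?N (?G \<otimes>\<^bsub>Yalg d m ?N\<^esub> (Z \<otimes>\<^bsub>Yalg d m ?N\<^esub> ?F))"
          using mult.IH(2) cl Z by blast
        also have "\<dots> = I ?N ((?G \<otimes>\<^bsub>Yalg d m ?N\<^esub> Z) \<otimes>\<^bsub>Yalg d m ?N\<^esub> ?F)"
          using cl Z by (simp add: m_assoc)
        also have "\<dots> = I ?N (?F \<otimes>\<^bsub>Yalg d m ?N\<^esub> (?G \<otimes>\<^bsub>Yalg d m ?N\<^esub> Z))"
          using mult.IH(1) cl Z by blast
        also have "\<dots> = I ?N (to_Y d m ?N (f * g) \<otimes>\<^bsub>Yalg d m ?N\<^esub> Z)"
          using cl Z mult.hyps by (simp add: to_Y_mult m_assoc)
        finally show "I ?N (Z \<otimes>\<^bsub>Yalg d m ?N\<^esub> to_Y d m ?N (f * g)) = I ?N (to_Y d m ?N (f * g) \<otimes>\<^bsub>Yalg d m ?N\<^esub> Z)" .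
      qed
    qed
    then show ?thesis
      using f(1) Suc.prems(1) by blast
  qed
qed

section \<open>The composite as a Markov trace\<close>

definition T :: "nat \<Rightarrow> fpoly set \<Rightarrow> laurent" where
  "T n = to_ground d m \<circ> I n"

lemma T_eqI: "\<lbrakk>I n Z = to_Y d m 0 (scal r); r \<in> carrier (ground_ring m)\<rbrakk> \<Longrightarrow> T n Z = r"
  by (simp add: T_def to_ground_scalar)

lemma I_eq_T:
  assumes "Z \<in> carrier (Yalg d m n)"
  shows "T n Z \<in> carrier (ground_ring m)" "I n Z = to_Y d m 0 (scal (T n Z))"
proof -
  obtain r where r: "r \<in> carrier (ground_ring m)" "I n Z = to_Y d m 0 (scal r)"
    using Yalg_0_scalar[OF I_closed[OF assms]] by blast
  moreover have "T n Z = r"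
    by (rule T_eqI[OF r(2,1)])
  ultimately show "T n Z \<in> carrier (ground_ring m)" "I n Z = to_Y d m 0 (scal (T n Z))"
    by simp_all
qed

lemma T_scal:
  assumes "r \<in> carrier (ground_ring m)" "Z \<in> carrier (Yalg d m n)"
  shows "T n (to_Y d m n (scal r) \<otimes>\<^bsub>Yalg d m n\<^esub> Z) = r * T n Z"
proof (rule T_eqI)
  show "I n (to_Y d m n (scal r) \<otimes>\<^bsub>Yalg d m n\<^esub> Z) = to_Y d m 0 (scal (r * T n Z))"
    using I_scal[OF assms] I_eq_T[OF assms(2)] assms(1) by (simp add: scal_mult to_Y_mult free_alg_scal)
qed (use assms I_eq_T in \<open>auto intro: ground_mult\<close>)

lemma T_Yemb: "\<lbrakk>k \<le> n; u \<in> carrier (Yalg d m k)\<rbrakk> \<Longrightarrow> T n (Yemb d m n u) = T k u"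
  by (simp add: T_def I_Yemb)

text \<open>The traces above rank \<open>k + 1\<close> fix the product, and
  \<open>tr (Suc k)\<close> turns \<open>W\<close> into the scalar \<open>r\<close> while
  \<open>u\<close> passes out. Both remaining Markov conditions follow, with \<open>W\<close> equal
  to \<open>g\<close> or to a product of powers of \<open>Xtilde\<close> and
  \<open>t\<close>.\<close>

lemma T_Yemb_mult:
  assumes "Suc k \<le> n" "W \<in> carrier (Yalg d m (Suc k))" "u \<in> carrier (Yalg d m k)"
    and "tr (Suc k) W = to_Y d m k (scal r)" "r \<in> carrier (ground_ring m)"
  shows "T n (Yemb d m n W \<otimes>\<^bsub>Yalg d m n\<^esub> Yemb d m n u) = r * T n (Yemb d m n u)"
proof -
  interpret ring "Yalg d m (Suc k)" by (rule Yalg_ring)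
  have u: "Yemb d m (Suc k) u \<in> carrier (Yalg d m (Suc k))"
    using assms(3) by (intro Yemb_closed) simp_all
  have "Yemb d m n W \<otimes>\<^bsub>Yalg d m n\<^esub> Yemb d m n u = Yemb d m n (W \<otimes>\<^bsub>Yalg d m (Suc k)\<^esub> Yemb d m (Suc k) u)"
    using assms(1-3) u Yemb_Yemb[of k "Suc k" n u d m] by (simp add: Yemb_mult)
  then have "T n (Yemb d m n W \<otimes>\<^bsub>Yalg d m n\<^esub> Yemb d m n u) = T (Suc k) (W \<otimes>\<^bsub>Yalg d m (Suc k)\<^esub> Yemb d m (Suc k) u)"
    using T_Yemb[OF assms(1)] assms(2) u by simp
  also have "\<dots> = T k (to_Y d m k (scal r) \<otimes>\<^bsub>Yalg d m k\<^esub> u)"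
    using tr_rmult[OF assms(3,2)] assms(4) by (simp add: T_def)
  also have "\<dots> = r * T n (Yemb d m n u)"
    using T_scal[OF assms(5,3)] T_Yemb[of k n u] assms(1,3) by simp
  finally show ?thesis .
qed

lemma markov_trace_T:
  assumes "n > 0"
  shows "markov_trace d m n z x (T n)"
  unfolding markov_trace_def
proof (intro conjI ballI allI impI)
  interpret Y: yokonuma_relations "Yalg d m n" "scalars d m n" "tY d m n" "gY d m n" "epsY d m n"
    "XY d m n" "XinvY d m n" n
    using assms d_pos by (intro Yalg_relations) simp_all
  have T_add: "T n (Z \<oplus>\<^bsub>Yalg d m n\<^esub> W) = T n Z + T n W"
    if "Z \<in> carrier (Yalg d m n)" "W \<in> carrier (Yalg d m n)" for Z W
  proof (rule T_eqI)
    show "I n (Z \<oplus>\<^bsub>Yalg d m n\<^esub> W) = to_Y d m 0 (scal (T n Z + T n W))"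
      using I_add[OF that] I_eq_T[OF that(1)] I_eq_T[OF that(2)] by (simp add: scal_add to_Y_add free_alg_scal)
  qed (use that I_eq_T in \<open>auto intro: ground_add\<close>)
  show "linear_map (ground_ring m) (Yalg d m n) (ground_ring m) (T n)"
    unfolding linear_map_def Yalg_smult
    using T_add T_scal I_eq_T(1) by (auto simp: ground_ring_def)
  have "I n \<one>\<^bsub>Yalg d m n\<^esub> = \<one>\<^bsub>Yalg d m 0\<^esub>"
    by (induction n) (simp_all add: tr_one)
  then show "T n \<one>\<^bsub>Yalg d m n\<^esub> = 1"
    by (intro T_eqI) (simp_all add: to_Y_one)
  show "T n (Z \<otimes>\<^bsub>Yalg d m n\<^esub> W) = T n (W \<otimes>\<^bsub>Yalg d m n\<^esub> Z)"
    if "Z \<in> carrier (Yalg d m n)" "W \<in> carrier (Yalg d m n)" for Z W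
    using I_symmetric[OF that] by (simp add: T_def)
  show "T n (gY d m n (k - 1) \<otimes>\<^bsub>Yalg d m n\<^esub> Yemb d m n u) = z * T n (Yemb d m n u)"
    if k: "k \<in> {2..n}" and u: "u \<in> carrier (Yalg d m (k - 1))" for k u
  proof -
    obtain j where j: "k = Suc j" "j \<ge> 1"
      using k by (cases k) auto
    have "gY d m k j \<in> carrier (Yalg d m k)"
      using j by (auto simp: gY_def generators_iff intro!: free_alg_gen)
    then show ?thesis
      using T_Yemb_mult[of j n "gY d m k j" u z] k u j tr_g[of j] z_ground by (simp add: Yemb_gens)
  qed
  show "T n (Xtilde d m n k [^]\<^bsub>Yalg d m n\<^esub> a \<otimes>\<^bsub>Yalg d m n\<^esub> tY d m n k [^]\<^bsub>Yalg d m n\<^esub> b \<otimes>\<^bsub>Yalg d m n\<^esub> Yemb d m n u)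
      = x a b * T n (Yemb d m n u)"
    if k: "k \<in> {1..n}" and u: "u \<in> carrier (Yalg d m (k - 1))" and ab: "a \<in> exponents m" "b < d" for k u a b
  proof -
    obtain j where j: "k = Suc j"
      using k by (cases k) auto
    let ?w = "Xtilde d m k k [^]\<^bsub>Yalg d m k\<^esub> a \<otimes>\<^bsub>Yalg d m k\<^esub> tY d m k k [^]\<^bsub>Yalg d m k\<^esub> b"
    have kn: "1 \<le> k" "k \<le> n"
      using k by simp_all
    have "T n (Yemb d m n ?w \<otimes>\<^bsub>Yalg d m n\<^esub> Yemb d m n u) = x a b * T n (Yemb d m n u)"
      unfolding j
    proof (rule T_Yemb_mult[OF _ _ _ tr_Xtilde[OF ab] x_ground[OF ab]])
      show "Xtilde d m (Suc j) (Suc j) [^]\<^bsub>Yalg d m (Suc j)\<^esub> a \<otimes>\<^bsub>Yalg d m (Suc j)\<^esub>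
        tY d m (Suc j) (Suc j) [^]\<^bsub>Yalg d m (Suc j)\<^esub> b \<in> carrier (Yalg d m (Suc j))"
        by (rule Xtilde_t_closed[OF kn(1)[unfolded j] order.refl d_pos])
    qed (use kn u j in simp_all)
    then show ?thesis
      unfolding Yemb_Xtilde_t[OF kn d_pos] .
  qed
qed

end

theorem proposition5p8:
  fixes d n :: nat and m :: enat
    and z :: laurent and x :: "int \<Rightarrow> nat \<Rightarrow> laurent"
    and tr :: "nat \<Rightarrow> fpoly set \<Rightarrow> fpoly set"
    and \<tau> :: "fpoly set \<Rightarrow> laurent"
  assumes "d > 0" and "n > 0" and "m > 0"
    and "z \<in> carrier (ground_ring m)"
    and "\<And>a b. a \<in> exponents m \<Longrightarrow> b < d \<Longrightarrow> x a b \<in> carrier (ground_ring m)"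
    and "x 0 0 = 1"
    and "relative_trace_chain d m z x tr"
    and "\<tau> = to_ground d m \<circ> iterated_trace tr n"
  shows "markov_trace d m n z x \<tau> \<and>
    (\<forall>\<tau>'. markov_trace d m n z x \<tau>' \<longrightarrow> (\<forall>Y\<in>carrier (Yalg d m n). \<tau>' Y = \<tau> Y))"
proof -
  interpret trace_chain d m z x tr
    using assms by unfold_locales auto
  have "markov_trace d m n z x \<tau>"
    using markov_trace_T[OF assms(2)] assms(8) by (simp add: T_def)
  then show ?thesis
    using markov_trace_unique[OF assms(1-3)] by blast
qed

end
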